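(* Suppose $\iota\in\mathbb Z$. Let $\mathcal N$ be a $\check{\mathcal D}^{\tau,\iota}_{\vec\ell}$-module generated by a subspace $\mathcal N_0$ such that $\check{\mathcal D}^{\tau,\iota}_{\vec\ell,m}(\mathcal N_0)=\{0\}$ for some $m\in\mathbb N$ with $m>\tilde\ell$. Then the following defines a representation $\sigma_{\mathcal N}$ of the Lie algebra $\hat{\mathcal A}^\tau_{\vec\ell}$ on $\mathcal N$: $\sigma_{\mathcal N}(\kappa)=\kappa_0$ and $$\sigma_{\mathcal N}(a^\tau_{\vec\ell}(r,z))=\sum_{l_1\in\mathcal Z_i,\,l_2\in\mathcal Z_j}\langle-l_2-\iota-1/2\rangle_r\,a^{\tau,\iota}_{\vec\ell}(l_1,l_2)z^{-l_1-l_2-2\iota-r-1}+(r+\ell_j)!\,\Im_{0,r+\ell_j}(\mathrm{tr}\,a)\kappa_0z^{-r-\ell_j-1}-(-1)^\epsilon r!\,\ell_i!\,\Im_{r,\ell_i}(\mathrm{tr}\,a)\kappa_0z^{-r-\ell_i-1}$$ for $i,j\in\overline{1,n}$, $a\in\mathcal B_{i,j}$ and $r\in\mathbb N$.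
   Context: All spaces are over $\mathbb C$; $\mathbb N$ = nonnegative integers; $\overline{1,n}=\{1,\dots,n\}$; $\mathcal Z=\mathbb Z+1/2$; $\langle\mu\rangle_0=1$, $\langle\mu\rangle_m=\mu(\mu-1)\cdots(\mu-m+1)$. $\mathbb A=\sum_{i\ge0}\mathbb C[t,t^{-1}]\partial_t^i$, $\partial_t=d/dt$. $\mathcal A$ is an associative algebra with identity $1_{\mathcal A}$ and a linear map $\mathrm{tr}:\mathcal A\to\mathbb C$ with $\mathrm{tr}\,1_{\mathcal A}\ne0$, $\mathrm{tr}\,ab=\mathrm{tr}\,ba$. It has left ideals $\mathcal B_1,\dots,\mathcal B_n$ with $\mathcal A=\bigoplus_i\mathcal B_i$, and subspace decompositions $\mathcal B_j=\bigoplus_{i=1}^n\mathcal B_{i,j}$ with $\mathcal B_{i,j}\mathcal B_{l,k}=\{0\}$ if $j\ne l$. $\tau$ is a linear transformation of $\mathcal A$ with $\tau^2=\mathrm{Id}$, $\tau(1_{\mathcal A})=1_{\mathcal A}$, $\tau(ab)=\tau(b)\tau(a)$, $\mathrm{tr}\circ\tau=\mathrm{tr}$ and $\tau(\mathcal B_{i,j})\subset\mathcal B_{\pi(j),\pi(i)}$ for a permutation $\pi$ of $\overline{1,n}$. Fix $\epsilon\in\{0,1\}$ and $\vec\ell=(\ell_1,\dots,\ell_n)\in\mathbb N^n$ with $\ell_i\in2\mathbb Z+\epsilon$ and $\ell_i=\ell_{\pi(i)}$ for all $i$. $\hat{\mathcal A}=\mathcal A\otimes\mathbb A\oplus\mathbb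 C\kappa$ is the Lie algebra with $\kappa$ central and $$[a\otimes t^{i_1}\partial_t^{j_1},b\otimes t^{i_2}\partial_t^{j_2}]=ab\otimes t^{i_1}\partial_t^{j_1}\cdot t^{i_2}\partial_t^{j_2}-ba\otimes t^{i_2}\partial_t^{j_2}\cdot t^{i_1}\partial_t^{j_1}+(-1)^{j_1}\delta_{i_1+i_2,j_1+j_2}j_1!j_2!\binom{i_1}{j_1+j_2+1}(\mathrm{tr}\,ab)\kappa.$$ $\hat{\mathcal A}^\tau_{\vec\ell}$ is the Lie subalgebra spanned by $\kappa$ and all $a\otimes t^m\partial_t^{r+\ell_j}-(-1)^\epsilon\tau(a)\otimes(-\partial_t)^rt^m\partial_t^{\ell_i}$ with $i,j\in\overline{1,n}$, $a\in\mathcal B_{i,j}$, $r\in\mathbb N$, $m\in\mathbb Z$. For such $a,r$, $$a^\tau_{\vec\ell}(r,z)=\sum_{m\in\mathbb Z}\bigl(a\otimes t^m\partial_t^{r+\ell_j}-(-1)^\epsilon\tau(a)\otimes(-\partial_t)^rt^m\partial_t^{\ell_i}\bigr)z^{-m-1}.$$ $\check{\mathcal A}=\bigoplus_{i,j\in\mathcal Z}\mathcal At_1^it_2^j\oplus\mathbb C\kappa_0$, $a(i,j)=at_1^it_2^j$, is the Lie algebra with $\kappa_0$ central and $$[a(l_1,l_2),b(k_1,k_2)]=\delta_{l_2+k_1,0}ab(l_1,k_2)-\delta_{l_1+k_2,0}ba(k_1,l_2)+\delta_{l_1+k_2,0}\delta_{l_2+k_1,0}[H(l_1)H(l_2)-H(k_1)H(k_2)](\mathrm{tr}\,ab)\kappa_0,$$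 $H(l)=1$ for $l>0$, $0$ for $l<0$. For $a\in\mathcal B_{i,j}$ and $l_1,l_2\in\mathcal Z$, $$a^{\tau,\iota}_{\vec\ell}(l_1,l_2)=(-1)^\epsilon\langle l_2+\iota-1/2\rangle_{\ell_j}a(l_1,l_2+2\iota-\ell_j)-\langle l_1+\iota-1/2\rangle_{\ell_i}\tau(a)(l_2,l_1+2\iota-\ell_i).$$ Put $\mathcal Z_i=\mathcal Z\setminus\{-\iota+1/2,-\iota+3/2,\dots,-\iota+\ell_i-1/2\}$. $\check{\mathcal D}^{\tau,\iota}_{\vec\ell}$ is the Lie subalgebra of $\check{\mathcal A}$ spanned by $\kappa_0$ and all $a^{\tau,\iota}_{\vec\ell}(l_1,l_2)$ with $i,j\in\overline{1,n}$, $a\in\mathcal B_{i,j}$, $l_1\in\mathcal Z_i$, $l_2\in\mathcal Z_j$. $\tilde\ell=|2\iota|+\max\{\ell_1,\dots,\ell_n\}$, and for $m>\tilde\ell$, $\check{\mathcal D}^{\tau,\iota}_{\vec\ell,m}$ is the span of all $a^{\tau,\iota}_{\vec\ell}(l_1,-l_2)$ with $i,j\in\overline{1,n}$, $a\in\mathcal B_{i,j}$, $m<l_1\in\mathcal Z_i$, $m<l_2\in\mathcal Z_j$. The constants $\Im_{r_1,r_2}$ are defined by $\sum_{r_1,r_2\ge0}\Im_{r_1,r_2}x^{r_1}y^{r_2}z^{-r_1-r_2-1}=\frac1{x-y}\bigl((\frac{z+y}{z+x})^\iota-1\bigr)$, expanded in nonnegative powers of $x,y$. *)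

theory Defs
  imports
    Complex_Main
    "HOL-Library.FuncSet"
    "HOL-Library.Poly_Mapping"
    "HOL-Library.Product_Plus"
    "HOL-Combinatorics.Permutations"
    "HOL-Computational_Algebra.Formal_Laurent_Series"
begin

section \<open>Falling factorials\<close>

definition ffact :: "'b::comm_ring_1 \<Rightarrow> nat \<Rightarrow> 'b" where
  "ffact \<mu> m = (\<Prod>k<m. \<mu> - of_nat k)"

lemma ffact_conv_gbinomial:
  fixes \<mu> :: "'b::field_char_0"
  shows "ffact \<mu> m = fact m * (\<mu> gchoose m)"
  by (simp add: ffact_def gbinomial_mult_fact lessThan_atLeast0)

lemma ffact_add: "ffact \<mu> (m + k) = ffact \<mu> m * ffact (\<mu> - of_nat m) k"
  by (induction k) (simp_all add: ffact_def algebra_simps)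


section \<open>Lie algebras as subspaces of an ambient space with a bracket\<close>

definition lie_subalgebra ::
  "(complex \<Rightarrow> 'g \<Rightarrow> 'g) \<Rightarrow> ('g::ab_group_add \<Rightarrow> 'g \<Rightarrow> 'g) \<Rightarrow> 'g set \<Rightarrow> bool" where
  "lie_subalgebra scale br L \<longleftrightarrow>
     module.subspace scale L \<and> (\<forall>x\<in>L. \<forall>y\<in>L. br x y \<in> L)"

definition lie_representation ::
  "(complex \<Rightarrow> 'g \<Rightarrow> 'g) \<Rightarrow> ('g::ab_group_add \<Rightarrow> 'g \<Rightarrow> 'g) \<Rightarrow> 'g set \<Rightarrow>
   (complex \<Rightarrow> 'v \<Rightarrow> 'v::ab_group_add) \<Rightarrow> ('g \<Rightarrow> 'v \<Rightarrow> 'v) \<Rightarrow> bool" where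
  "lie_representation scale br L scaleV \<rho> \<longleftrightarrow>
     (\<forall>x\<in>L. Vector_Spaces.linear scaleV scaleV (\<rho> x)) \<and>
     (\<forall>x\<in>L. \<forall>y\<in>L. \<forall>v. \<rho> (x + y) v = \<rho> x v + \<rho> y v) \<and>
     (\<forall>c. \<forall>x\<in>L. \<forall>v. \<rho> (scale c x) v = scaleV c (\<rho> x v)) \<and>
     (\<forall>x\<in>L. \<forall>y\<in>L. \<forall>v. \<rho> (br x y) v = \<rho> x (\<rho> y v) - \<rho> y (\<rho> x v))"

definition generates_module ::
  "'g set \<Rightarrow> (complex \<Rightarrow> 'v \<Rightarrow> 'v::ab_group_add) \<Rightarrow> ('g \<Rightarrow> 'v \<Rightarrow> 'v) \<Rightarrow> 'v set \<Rightarrow> bool" where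
  "generates_module L scaleV \<rho> S \<longleftrightarrow>
     (\<forall>W. module.subspace scaleV W \<and> S \<subseteq> W \<and> (\<forall>x\<in>L. \<forall>w\<in>W. \<rho> x w \<in> W) \<longrightarrow> W = UNIV)"

text \<open>
  Both ambient Lie algebras have the form \<open>(\<A> \<otimes> V) \<oplus> \<complex>\<close>, where \<open>V\<close> has a basis indexed by
  a type \<open>'k\<close>.  They are represented as pairs of a finitely supported \<open>\<A>\<close>-valued function on
  \<open>'k\<close> and a complex number, the coefficient of the central element.  A bracket on basis
  elements is extended biadditively; the central summand does not contribute.
\<close>

type_synonym ('k, 'a) ext = "('k \<Rightarrow>\<^sub>0 'a) \<times> complex"

definition ext_scale ::
  "(complex \<Rightarrow> 'a \<Rightarrow> 'a) \<Rightarrow> complex \<Rightarrow> ('k, 'a::zero) ext \<Rightarrow> ('k, 'a) ext" where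
  "ext_scale scale c x = (Poly_Mapping.map (scale c) (fst x), c * snd x)"

definition central :: "('k, 'a::zero) ext" where
  "central = (0, 1)"

definition ext_bracket ::
  "('a \<Rightarrow> 'k \<Rightarrow> 'a \<Rightarrow> 'k \<Rightarrow> ('k, 'a) ext) \<Rightarrow>
   ('k, 'a::ab_group_add) ext \<Rightarrow> ('k, 'a) ext \<Rightarrow> ('k, 'a) ext" where
  "ext_bracket \<beta> x y =
     (\<Sum>p\<in>Poly_Mapping.keys (fst x). \<Sum>q\<in>Poly_Mapping.keys (fst y). \<beta> (Poly_Mapping.lookup (fst x) p) p (Poly_Mapping.lookup (fst y) q) q)"

lemma ext_bracket_single:
  assumes "\<beta> 0 p b q = 0" and "\<beta> a p 0 q = 0"
  shows "ext_bracket \<beta> (Poly_Mapping.single p a, c) (Poly_Mapping.single q b, d) = \<beta> a p b q"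
  using assms by (cases "a = 0"; cases "b = 0") (simp_all add: ext_bracket_def)

lemma ext_bracket_central:
  "ext_bracket \<beta> central x = 0" "ext_bracket \<beta> x central = 0"
  by (simp_all add: ext_bracket_def central_def)

lemma vector_space_ext_scale:
  fixes scale :: "complex \<Rightarrow> 'a::ab_group_add \<Rightarrow> 'a"
  assumes "vector_space scale"
  shows "vector_space (ext_scale scale :: complex \<Rightarrow> ('k, 'a) ext \<Rightarrow> ('k, 'a) ext)"
proof -
  interpret vector_space scale by fact
  have lk: "Poly_Mapping.lookup (Poly_Mapping.map (scale c) p) k = scale c (Poly_Mapping.lookup p k)"
    for c k and p :: "'k \<Rightarrow>\<^sub>0 'a"
    by (simp add: Poly_Mapping.map.rep_eq when_def)
  show ?thesis
    by unfold_locales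
      (auto simp: ext_scale_def prod_eq_iff poly_mapping_eq_iff fun_eq_iff lk lookup_add
        algebra_simps scale_left_distrib scale_right_distrib)
qed


section \<open>Differential operators with Laurent polynomial coefficients\<close>

text \<open>
  The algebra \<open>\<bbbA>\<close>: the function supported at \<open>(i, j)\<close> with value \<open>1\<close> stands for
  \<open>t\<^sup>i \<partial>\<^sub>t\<^sup>j\<close>, and the product is given by the Leibniz rule
  \<open>t\<^sup>i \<partial>\<^sup>j \<cdot> t\<^sup>k \<partial>\<^sup>l = (\<Sum>s\<le>j. (j choose s) \<langle>k\<rangle>\<^sub>s t\<^bsup>i+k-s\<^esup> \<partial>\<^bsup>j+l-s\<^esup>)\<close>.
\<close>

type_synonym diffop = "(int \<times> nat) \<Rightarrow>\<^sub>0 complex"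

definition dmono :: "int \<Rightarrow> nat \<Rightarrow> diffop" where
  "dmono i j = Poly_Mapping.single (i, j) 1"

definition dmult :: "diffop \<Rightarrow> diffop \<Rightarrow> diffop" where
  "dmult D E =
     (\<Sum>p\<in>Poly_Mapping.keys D. \<Sum>q\<in>Poly_Mapping.keys E. \<Sum>s\<le>snd p.
        Poly_Mapping.single (fst p + fst q - int s, snd p + snd q - s)
          (Poly_Mapping.lookup D p * Poly_Mapping.lookup E q * of_nat (snd p choose s) * ffact (of_int (fst q)) s))"

text \<open>
  The action on Laurent polynomials (finitely supported functions on the exponents), used only
  to confirm that \<^const>\<open>dmult\<close> is composition of operators.
\<close>

definition dact :: "diffop \<Rightarrow> (int \<Rightarrow>\<^sub>0 complex) \<Rightarrow> (int \<Rightarrow>\<^sub>0 complex)" where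
  "dact D f =
     (\<Sum>q\<in>Poly_Mapping.keys D. \<Sum>p\<in>Poly_Mapping.keys f.
        Poly_Mapping.single (p + fst q - int (snd q))
          (Poly_Mapping.lookup D q * Poly_Mapping.lookup f p * ffact (of_int p) (snd q)))"

lemma dact_cong_supersets:
  assumes "finite A" "Poly_Mapping.keys D \<subseteq> A" "finite B" "Poly_Mapping.keys f \<subseteq> B"
  shows "dact D f =
     (\<Sum>q\<in>A. \<Sum>p\<in>B. Poly_Mapping.single (p + fst q - int (snd q))
          (Poly_Mapping.lookup D q * Poly_Mapping.lookup f p * ffact (of_int p) (snd q)))"
proof -
  have "dact D f =
     (\<Sum>q\<in>Poly_Mapping.keys D. \<Sum>p\<in>B. Poly_Mapping.single (p + fst q - int (snd q))
          (Poly_Mapping.lookup D q * Poly_Mapping.lookup f p * ffact (of_int p) (snd q)))"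
    unfolding dact_def using assms
    by (intro sum.cong refl sum.mono_neutral_left) (auto simp: Poly_Mapping.in_keys_iff)
  also have "\<dots> = (\<Sum>q\<in>A. \<Sum>p\<in>B. Poly_Mapping.single (p + fst q - int (snd q))
          (Poly_Mapping.lookup D q * Poly_Mapping.lookup f p * ffact (of_int p) (snd q)))"
    using assms by (intro sum.mono_neutral_left) (auto simp: Poly_Mapping.in_keys_iff)
  finally show ?thesis .
qed

lemma dact_add_left: "dact (D + E) f = dact D f + dact E f"
proof -
  have "Poly_Mapping.keys (D + E) \<subseteq> Poly_Mapping.keys D \<union> Poly_Mapping.keys E"
    by (rule Poly_Mapping.keys_add)
  then show ?thesis
    by (simp add: dact_cong_supersets[of "Poly_Mapping.keys D \<union> Poly_Mapping.keys E" _ "Poly_Mapping.keys f"] lookup_add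
        ring_distribs Poly_Mapping.single_add flip: sum.distrib)
qed

lemma dact_add_right: "dact D (f + g) = dact D f + dact D g"
proof -
  have "Poly_Mapping.keys (f + g) \<subseteq> Poly_Mapping.keys f \<union> Poly_Mapping.keys g"
    by (rule Poly_Mapping.keys_add)
  then show ?thesis
    by (simp add: dact_cong_supersets[of "Poly_Mapping.keys D" _ "Poly_Mapping.keys f \<union> Poly_Mapping.keys g"] lookup_add
        ring_distribs Poly_Mapping.single_add flip: sum.distrib)
qed

lemma dact_sum_left: "dact (\<Sum>x\<in>X. F x) f = (\<Sum>x\<in>X. dact (F x) f)"
  by (induction X rule: infinite_finite_induct) (simp_all add: dact_add_left, simp_all add: dact_def)

lemma dact_sum_right: "dact D (\<Sum>x\<in>X. F x) = (\<Sum>x\<in>X. dact D (F x))"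
  by (induction X rule: infinite_finite_induct) (simp_all add: dact_add_right, simp_all add: dact_def)

lemma dact_single:
  "dact (Poly_Mapping.single (i, j) c) (Poly_Mapping.single p d) =
     Poly_Mapping.single (p + i - int j) (c * d * ffact (of_int p) j)"
  by (subst dact_cong_supersets[of "{(i, j)}" _ "{p}"]) auto

lemma ffact_Leibniz:
  "ffact (of_int p) l * ffact (of_int (p + k - int l)) j =
     (\<Sum>s\<le>j. of_nat (j choose s) * ffact (of_int k) s * ffact (of_int p) (j + l - s) :: complex)"
proof -
  let ?u = "of_int p - of_nat l :: complex"
  have "ffact (of_int (p + k - int l)) j = fact j * ((of_int k + ?u) gchoose j)"
    by (simp add: ffact_conv_gbinomial algebra_simps)
  also have "\<dots> = (\<Sum>s\<le>j. fact j * ((of_int k gchoose s) * (?u gchoose (j - s))))"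
    by (simp add: gbinomial_Vandermonde[symmetric] sum_distrib_left atLeast0AtMost)
  also have "\<dots> = (\<Sum>s\<le>j. of_nat (j choose s) * ffact (of_int k) s * ffact ?u (j - s))"
    by (intro sum.cong) (simp_all add: ffact_conv_gbinomial binomial_fact field_simps)
  finally have "ffact (of_int p) l * ffact (of_int (p + k - int l)) j =
      (\<Sum>s\<le>j. of_nat (j choose s) * ffact (of_int k) s * (ffact (of_int p) l * ffact ?u (j - s)))"
    by (simp add: sum_distrib_left mult_ac)
  also have "\<dots> =
      (\<Sum>s\<le>j. of_nat (j choose s) * ffact (of_int k) s * ffact (of_int p) (j + l - s))"
  proof (intro sum.cong refl)
    fix s assume "s \<in> {..j}"
    then have "j + l - s = l + (j - s)" by simp
    then show "of_nat (j choose s) * ffact (of_int k) s * (ffact (of_int p) l * ffact ?u (j - s)) =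
        of_nat (j choose s) * ffact (of_int k) s * ffact (of_int p) (j + l - s)"
      by (simp only: ffact_add)
  qed
  finally show ?thesis .
qed

lemma single_sum:
  "(\<Sum>x\<in>X. Poly_Mapping.single k (F x)) = Poly_Mapping.single k (\<Sum>x\<in>X. F x)"
  by (induction X rule: infinite_finite_induct) (simp_all add: Poly_Mapping.single_add)

lemma sum_single_self: "(\<Sum>p\<in>Poly_Mapping.keys f. Poly_Mapping.single p (Poly_Mapping.lookup f p)) = f"
  by (rule poly_mapping_eqI)
    (simp add: lookup_sum lookup_single when_def Poly_Mapping.in_keys_iff sum.delta)

lemma sum_swap3:
  "(\<Sum>p\<in>P. \<Sum>b\<in>Y. \<Sum>a\<in>X. F a b p) = (\<Sum>a\<in>X. \<Sum>b\<in>Y. \<Sum>p\<in>P. F a b p)"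
proof -
  have "(\<Sum>p\<in>P. \<Sum>b\<in>Y. \<Sum>a\<in>X. F a b p) = (\<Sum>p\<in>P. \<Sum>a\<in>X. \<Sum>b\<in>Y. F a b p)"
    by (intro sum.cong refl sum.swap)
  also have "\<dots> = (\<Sum>a\<in>X. \<Sum>p\<in>P. \<Sum>b\<in>Y. F a b p)"
    by (rule sum.swap)
  also have "\<dots> = (\<Sum>a\<in>X. \<Sum>b\<in>Y. \<Sum>p\<in>P. F a b p)"
    by (intro sum.cong refl sum.swap)
  finally show ?thesis .
qed

lemma sum_swap4:
  "(\<Sum>a\<in>X. \<Sum>b\<in>Y. \<Sum>s\<in>S a. \<Sum>p\<in>P. F a b s p) = (\<Sum>p\<in>P. \<Sum>a\<in>X. \<Sum>b\<in>Y. \<Sum>s\<in>S a. F a b s p)"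
proof -
  have "(\<Sum>a\<in>X. \<Sum>b\<in>Y. \<Sum>s\<in>S a. \<Sum>p\<in>P. F a b s p) = (\<Sum>a\<in>X. \<Sum>b\<in>Y. \<Sum>p\<in>P. \<Sum>s\<in>S a. F a b s p)"
    by (intro sum.cong refl sum.swap)
  also have "\<dots> = (\<Sum>a\<in>X. \<Sum>p\<in>P. \<Sum>b\<in>Y. \<Sum>s\<in>S a. F a b s p)"
    by (rule sum.cong[OF refl], rule sum.swap)
  also have "\<dots> = (\<Sum>p\<in>P. \<Sum>a\<in>X. \<Sum>b\<in>Y. \<Sum>s\<in>S a. F a b s p)"
    by (rule sum.swap)
  finally show ?thesis .
qed

theorem dact_dmult: "dact (dmult D E) f = dact D (dact E f)"
proof -
  have *: "(\<Sum>s\<le>snd a. dact (Poly_Mapping.single (fst a + fst b - int s, snd a + snd b - s)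
             (c * d * of_nat (snd a choose s) * ffact (of_int (fst b)) s)) (Poly_Mapping.single p e))
        = dact (Poly_Mapping.single a c) (dact (Poly_Mapping.single b d) (Poly_Mapping.single p e))"
    for a b :: "int \<times> nat" and c d e p
  proof -
    obtain i j k l where ab: "a = (i, j)" "b = (k, l)" by (metis surj_pair)
    have "(\<Sum>s\<le>j. dact (Poly_Mapping.single (i + k - int s, j + l - s)
             (c * d * of_nat (j choose s) * ffact (of_int k) s)) (Poly_Mapping.single p e))
        = (\<Sum>s\<le>j. Poly_Mapping.single (p + i + k - int j - int l)
             (c * d * e * (of_nat (j choose s) * ffact (of_int k) s * ffact (of_int p) (j + l - s))))"
      by (intro sum.cong refl) (simp add: dact_single of_nat_diff algebra_simps)
    also have "\<dots> = Poly_Mapping.single (p + i + k - int j - int l)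
             (c * d * e * (ffact (of_int p) l * ffact (of_int (p + k - int l)) j))"
      by (simp only: ffact_Leibniz sum_distrib_left single_sum)
    finally show ?thesis
      by (simp add: ab dact_single algebra_simps)
  qed
  have "dact D (dact E f) =
    dact (\<Sum>a\<in>Poly_Mapping.keys D. Poly_Mapping.single a (Poly_Mapping.lookup D a))
     (dact (\<Sum>b\<in>Poly_Mapping.keys E. Poly_Mapping.single b (Poly_Mapping.lookup E b))
       (\<Sum>p\<in>Poly_Mapping.keys f. Poly_Mapping.single p (Poly_Mapping.lookup f p)))"
    by (simp only: sum_single_self)
  also have "\<dots> = (\<Sum>a\<in>Poly_Mapping.keys D. \<Sum>b\<in>Poly_Mapping.keys E. \<Sum>p\<in>Poly_Mapping.keys f. dact (Poly_Mapping.single a (Poly_Mapping.lookup D a))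
      (dact (Poly_Mapping.single b (Poly_Mapping.lookup E b)) (Poly_Mapping.single p (Poly_Mapping.lookup f p))))"
    by (simp only: dact_sum_left dact_sum_right)
      (rule sum_swap3)
  also have "\<dots> = (\<Sum>a\<in>Poly_Mapping.keys D. \<Sum>b\<in>Poly_Mapping.keys E. \<Sum>p\<in>Poly_Mapping.keys f.
      \<Sum>s\<le>snd a. dact (Poly_Mapping.single (fst a + fst b - int s, snd a + snd b - s)
         (Poly_Mapping.lookup D a * Poly_Mapping.lookup E b * of_nat (snd a choose s) * ffact (of_int (fst b)) s))
        (Poly_Mapping.single p (Poly_Mapping.lookup f p)))"
    by (simp only: *)
  also have "\<dots> = (\<Sum>a\<in>Poly_Mapping.keys D. \<Sum>b\<in>Poly_Mapping.keys E. \<Sum>s\<le>snd a. \<Sum>p\<in>Poly_Mapping.keys f.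
      dact (Poly_Mapping.single (fst a + fst b - int s, snd a + snd b - s)
         (Poly_Mapping.lookup D a * Poly_Mapping.lookup E b * of_nat (snd a choose s) * ffact (of_int (fst b)) s))
        (Poly_Mapping.single p (Poly_Mapping.lookup f p)))"
    by (intro sum.cong refl sum.swap)
  also have "\<dots> = dact (dmult D E) (\<Sum>p\<in>Poly_Mapping.keys f. Poly_Mapping.single p (Poly_Mapping.lookup f p))"
    by (simp only: dmult_def dact_sum_left dact_sum_right) (rule sum_swap4)
  finally show ?thesis
    by (simp only: sum_single_self)
qed

text \<open>The pure tensor \<open>a \<otimes> D\<close>.\<close>

definition tens :: "(complex \<Rightarrow> 'a \<Rightarrow> 'a) \<Rightarrow> 'a \<Rightarrow> diffop \<Rightarrow> (int \<times> nat) \<Rightarrow>\<^sub>0 'a::zero" where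
  "tens scale a D = Poly_Mapping.map (\<lambda>c. scale c a) D"


section \<open>The algebra with trace and anti-involution\<close>

definition direct_sum_decomp ::
  "(complex \<Rightarrow> 'a \<Rightarrow> 'a::ab_group_add) \<Rightarrow> 'i set \<Rightarrow> ('i \<Rightarrow> 'a set) \<Rightarrow> 'a set \<Rightarrow> bool" where
  "direct_sum_decomp scale I B V \<longleftrightarrow>
     (\<forall>i\<in>I. module.subspace scale (B i) \<and> B i \<subseteq> V) \<and>
     (\<forall>v\<in>V. \<exists>!f. f \<in> (\<Pi>\<^sub>E i\<in>I. B i) \<and> v = (\<Sum>i\<in>I. f i))"

text \<open>The scalar multiplication \<open>scale\<close> makes the ring \<open>'a\<close> an associative unital \<open>\<complex>\<close>-algebra.\<close>

locale tau_setting =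
  vector_space scale
  for scale :: "complex \<Rightarrow> 'a::ring_1 \<Rightarrow> 'a" +
  fixes tr :: "'a \<Rightarrow> complex"
    and \<tau> :: "'a \<Rightarrow> 'a"
    and n :: nat
    and B :: "nat \<Rightarrow> 'a set"
    and BB :: "nat \<Rightarrow> nat \<Rightarrow> 'a set"
    and \<pi> :: "nat \<Rightarrow> nat"
    and \<epsilon> :: nat
    and ell :: "nat \<Rightarrow> nat"
  assumes scale_mult_left: "scale c a * b = scale c (a * b)"
    and scale_mult_right: "a * scale c b = scale c (a * b)"
    and tr_linear: "Vector_Spaces.linear scale (*) tr"
    and tr_one: "tr 1 \<noteq> 0"
    and tr_commute: "tr (a * b) = tr (b * a)"
    and left_ideal: "j \<in> {1..n} \<Longrightarrow> b \<in> B j \<Longrightarrow> a * b \<in> B j"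
    and decomp: "direct_sum_decomp scale {1..n} B UNIV"
    and decomp_B: "j \<in> {1..n} \<Longrightarrow> direct_sum_decomp scale {1..n} (\<lambda>i. BB i j) (B j)"
    and BB_mult: "i \<in> {1..n} \<Longrightarrow> j \<in> {1..n} \<Longrightarrow> l \<in> {1..n} \<Longrightarrow> k \<in> {1..n} \<Longrightarrow> j \<noteq> l \<Longrightarrow>
      a \<in> BB i j \<Longrightarrow> b \<in> BB l k \<Longrightarrow> a * b = 0"
    and tau_linear: "Vector_Spaces.linear scale scale \<tau>"
    and tau_tau: "\<tau> (\<tau> a) = a"
    and tau_one: "\<tau> 1 = 1"
    and tau_mult: "\<tau> (a * b) = \<tau> b * \<tau> a"
    and tr_tau: "tr (\<tau> a) = tr a"
    and perm: "\<pi> permutes {1..n}"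
    and tau_BB: "i \<in> {1..n} \<Longrightarrow> j \<in> {1..n} \<Longrightarrow> a \<in> BB i j \<Longrightarrow> \<tau> a \<in> BB (\<pi> j) (\<pi> i)"
    and eps: "\<epsilon> \<in> {0, 1}"
    and ell_parity: "i \<in> {1..n} \<Longrightarrow> ell i mod 2 = \<epsilon>"
    and ell_perm: "i \<in> {1..n} \<Longrightarrow> ell (\<pi> i) = ell i"


section \<open>The central extension of differential operators\<close>

text \<open>The Lie algebra \<open>\<A> \<otimes> \<bbbA> \<oplus> \<complex>\<kappa>\<close>, with \<open>\<kappa>\<close> being \<^const>\<open>central\<close>.\<close>

type_synonym 'a hat_alg = "(int \<times> nat, 'a) ext"

definition hat_basis_bracket ::
  "(complex \<Rightarrow> 'a \<Rightarrow> 'a::ring_1) \<Rightarrow> ('a \<Rightarrow> complex) \<Rightarrow>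
   'a \<Rightarrow> int \<times> nat \<Rightarrow> 'a \<Rightarrow> int \<times> nat \<Rightarrow> 'a hat_alg" where
  "hat_basis_bracket scale tr a p b q =
     (case p of (i1, j1) \<Rightarrow> case q of (i2, j2) \<Rightarrow>
       (tens scale (a * b) (dmult (dmono i1 j1) (dmono i2 j2)) -
          tens scale (b * a) (dmult (dmono i2 j2) (dmono i1 j1)),
        if i1 + i2 = int j1 + int j2
        then (-1) ^ j1 * fact j1 * fact j2 * (of_int i1 gchoose (j1 + j2 + 1)) * tr (a * b)
        else 0))"

definition hat_bracket ::
  "(complex \<Rightarrow> 'a \<Rightarrow> 'a::ring_1) \<Rightarrow> ('a \<Rightarrow> complex) \<Rightarrow> 'a hat_alg \<Rightarrow> 'a hat_alg \<Rightarrow> 'a hat_alg" where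
  "hat_bracket scale tr = ext_bracket (hat_basis_bracket scale tr)"

text \<open>
  For \<open>a \<in> BB i j\<close>, the coefficient of \<open>z\<^bsup>-m-1\<^esup>\<close> in the formal series attached to \<open>a\<close> and \<open>r\<close>.
  The indices \<open>i\<close>, \<open>j\<close> are passed explicitly.
\<close>

definition hat_gen ::
  "(complex \<Rightarrow> 'a \<Rightarrow> 'a::ring_1) \<Rightarrow> ('a \<Rightarrow> 'a) \<Rightarrow> nat \<Rightarrow> (nat \<Rightarrow> nat) \<Rightarrow>
   nat \<Rightarrow> nat \<Rightarrow> 'a \<Rightarrow> nat \<Rightarrow> int \<Rightarrow> 'a hat_alg" where
  "hat_gen scale \<tau> \<epsilon> ell i j a r m =
     (tens scale a (dmono m (r + ell j)), 0) -
     ext_scale scale ((-1) ^ \<epsilon>)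
       (tens scale (\<tau> a) (dmult (Poly_Mapping.single (0, r) ((-1) ^ r)) (dmono m (ell i))), 0)"

definition hat_sub ::
  "(complex \<Rightarrow> 'a \<Rightarrow> 'a::ring_1) \<Rightarrow> ('a \<Rightarrow> 'a) \<Rightarrow> nat \<Rightarrow> (nat \<Rightarrow> nat \<Rightarrow> 'a set) \<Rightarrow>
   nat \<Rightarrow> (nat \<Rightarrow> nat) \<Rightarrow> 'a hat_alg set" where
  "hat_sub scale \<tau> n BB \<epsilon> ell =
     module.span (ext_scale scale)
       (insert central {hat_gen scale \<tau> \<epsilon> ell i j a r m | i j a r m.
          i \<in> {1..n} \<and> j \<in> {1..n} \<and> a \<in> BB i j})"


section \<open>The central extension of infinite matrices\<close>

definition half_odds :: "real set" where
  "half_odds = {l. \<exists>k::int. l = of_int k + 1 / 2}"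

text \<open>
  The function supported at \<open>(l\<^sub>1, l\<^sub>2)\<close> with value \<open>a\<close> stands for \<open>a(l\<^sub>1, l\<^sub>2)\<close>.
  The type allows arbitrary real indices; the Lie algebra of interest consists of the elements
  supported on \<^term>\<open>half_odds \<times> half_odds\<close>, which contains all the subspaces considered below.
\<close>

type_synonym 'a check_alg = "(real \<times> real, 'a) ext"

definition heaviside :: "real \<Rightarrow> complex" where
  "heaviside l = (if l > 0 then 1 else 0)"

definition check_basis_bracket ::
  "('a \<Rightarrow> complex) \<Rightarrow> 'a \<Rightarrow> real \<times> real \<Rightarrow> 'a \<Rightarrow> real \<times> real \<Rightarrow> 'a::ring_1 check_alg" where
  "check_basis_bracket tr a p b q =
     (case p of (l1, l2) \<Rightarrow> case q of (k1, k2) \<Rightarrow>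
       ((if l2 + k1 = 0 then Poly_Mapping.single (l1, k2) (a * b) else 0) -
          (if l1 + k2 = 0 then Poly_Mapping.single (k1, l2) (b * a) else 0),
        if l1 + k2 = 0 \<and> l2 + k1 = 0
        then (heaviside l1 * heaviside l2 - heaviside k1 * heaviside k2) * tr (a * b)
        else 0))"

definition check_bracket ::
  "('a \<Rightarrow> complex) \<Rightarrow> 'a::ring_1 check_alg \<Rightarrow> 'a check_alg \<Rightarrow> 'a check_alg" where
  "check_bracket tr = ext_bracket (check_basis_bracket tr)"

definition check_gen ::
  "(complex \<Rightarrow> 'a \<Rightarrow> 'a::ring_1) \<Rightarrow> ('a \<Rightarrow> 'a) \<Rightarrow> nat \<Rightarrow> (nat \<Rightarrow> nat) \<Rightarrow> int \<Rightarrow>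
   nat \<Rightarrow> nat \<Rightarrow> 'a \<Rightarrow> real \<Rightarrow> real \<Rightarrow> 'a check_alg" where
  "check_gen scale \<tau> \<epsilon> ell \<iota> i j a l1 l2 =
     ext_scale scale ((-1) ^ \<epsilon> * ffact (of_real (l2 + of_int \<iota> - 1 / 2)) (ell j))
       (Poly_Mapping.single (l1, l2 + 2 * of_int \<iota> - of_nat (ell j)) a, 0) -
     ext_scale scale (ffact (of_real (l1 + of_int \<iota> - 1 / 2)) (ell i))
       (Poly_Mapping.single (l2, l1 + 2 * of_int \<iota> - of_nat (ell i)) (\<tau> a), 0)"

definition idx :: "(nat \<Rightarrow> nat) \<Rightarrow> int \<Rightarrow> nat \<Rightarrow> real set" where
  "idx ell \<iota> i = half_odds - {- of_int \<iota> + of_nat k + 1 / 2 | k. k < ell i}"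

definition check_sub ::
  "(complex \<Rightarrow> 'a \<Rightarrow> 'a::ring_1) \<Rightarrow> ('a \<Rightarrow> 'a) \<Rightarrow> nat \<Rightarrow> (nat \<Rightarrow> nat \<Rightarrow> 'a set) \<Rightarrow>
   nat \<Rightarrow> (nat \<Rightarrow> nat) \<Rightarrow> int \<Rightarrow> 'a check_alg set" where
  "check_sub scale \<tau> n BB \<epsilon> ell \<iota> =
     module.span (ext_scale scale)
       (insert central {check_gen scale \<tau> \<epsilon> ell \<iota> i j a l1 l2 | i j a l1 l2.
          i \<in> {1..n} \<and> j \<in> {1..n} \<and> a \<in> BB i j \<and> l1 \<in> idx ell \<iota> i \<and> l2 \<in> idx ell \<iota> j})"

definition check_sub_above ::
  "(complex \<Rightarrow> 'a \<Rightarrow> 'a::ring_1) \<Rightarrow> ('a \<Rightarrow> 'a) \<Rightarrow> nat \<Rightarrow> (nat \<Rightarrow> nat \<Rightarrow> 'a set) \<Rightarrow>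
   nat \<Rightarrow> (nat \<Rightarrow> nat) \<Rightarrow> int \<Rightarrow> nat \<Rightarrow> 'a check_alg set" where
  "check_sub_above scale \<tau> n BB \<epsilon> ell \<iota> m =
     module.span (ext_scale scale)
       {check_gen scale \<tau> \<epsilon> ell \<iota> i j a l1 (- l2) | i j a l1 l2.
          i \<in> {1..n} \<and> j \<in> {1..n} \<and> a \<in> BB i j \<and>
          of_nat m < l1 \<and> l1 \<in> idx ell \<iota> i \<and> of_nat m < l2 \<and> l2 \<in> idx ell \<iota> j}"

definition ell_tilde :: "nat \<Rightarrow> (nat \<Rightarrow> nat) \<Rightarrow> int \<Rightarrow> int" where
  "ell_tilde n ell \<iota> = \<bar>2 * \<iota>\<bar> + int (Max (ell ` {1..n}))"

lemma hat_bracket_single: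
  assumes "tau_setting scale tr \<tau> n B BB \<pi> \<epsilon> ell"
  shows "hat_bracket scale tr (Poly_Mapping.single p a, c) (Poly_Mapping.single q b, d) =
    hat_basis_bracket scale tr a p b q"
proof -
  interpret tau_setting scale tr \<tau> n B BB \<pi> \<epsilon> ell by fact
  interpret tr: Vector_Spaces.linear scale "(*)" tr by (rule tr_linear)
  have "tens scale 0 D = 0" for D
    by (rule poly_mapping_eqI) (simp add: tens_def Poly_Mapping.map.rep_eq)
  then show ?thesis
    unfolding hat_bracket_def
    by (intro ext_bracket_single) (simp_all add: hat_basis_bracket_def tr.zero zero_prod_def split: prod.split)
qed

lemma check_bracket_single:
  assumes "tau_setting scale tr \<tau> n B BB \<pi> \<epsilon> ell"
  shows "check_bracket tr (Poly_Mapping.single p a, c) (Poly_Mapping.single q b, d) =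
    check_basis_bracket tr a p b q"
proof -
  interpret tau_setting scale tr \<tau> n B BB \<pi> \<epsilon> ell by fact
  interpret tr: Vector_Spaces.linear scale "(*)" tr by (rule tr_linear)
  show ?thesis
    unfolding check_bracket_def
    by (intro ext_bracket_single) (simp_all add: check_basis_bracket_def tr.zero zero_prod_def split: prod.split)
qed


section \<open>The constants given by a generating function\<close>

text \<open>
  Power series in \<open>x\<close> (outer) and \<open>y\<close> (inner) over the field of formal Laurent series in \<open>z\<close>.
  The factor \<open>1 / (x - y)\<close> is cleared.
\<close>

type_synonym xyz_series = "complex fls fps fps"

definition ser_x :: xyz_series where "ser_x = fps_X"
definition ser_y :: xyz_series where "ser_y = fps_const fps_X"
definition ser_z :: xyz_series where "ser_z = fps_const (fps_const fls_X)"

definition Im_genfun :: "(nat \<Rightarrow> nat \<Rightarrow> complex) \<Rightarrow> xyz_series" where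
  "Im_genfun c =
     Abs_fps (\<lambda>r1. Abs_fps (\<lambda>r2. fls_const (c r1 r2) * fls_X_intpow (- int r1 - int r2 - 1)))"

definition is_Im :: "int \<Rightarrow> (nat \<Rightarrow> nat \<Rightarrow> complex) \<Rightarrow> bool" where
  "is_Im \<iota> c \<longleftrightarrow>
     (ser_x - ser_y) * Im_genfun c = ((ser_z + ser_y) * inverse (ser_z + ser_x)) powi \<iota> - 1"

definition Im_const :: "int \<Rightarrow> nat \<Rightarrow> nat \<Rightarrow> complex" where
  "Im_const \<iota> = (THE c. is_Im \<iota> c)"

lemma nested_inverse_unique:
  fixes f g :: xyz_series
  assumes "f * g = 1"
  shows "inverse f = g"
proof -
  have "f $ 0 * g $ 0 = 1"
    using assms fps_mult_nth_0[of f g] by simp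
  then have "inverse (f $ 0) = g $ 0"
    by (rule fps_inverse_unique)
  moreover have "g $ 0 * f $ 0 = 1"
    using \<open>f $ 0 * g $ 0 = 1\<close> by (simp add: mult.commute)
  ultimately show ?thesis
    using fps_lr_inverse_unique_ring1(2)[OF assms] by (simp add: fps_inverse_def)
qed

definition homog :: "int \<Rightarrow> xyz_series \<Rightarrow> bool" where
  "homog d f \<longleftrightarrow> (\<exists>c. \<forall>r1 r2. f $ r1 $ r2 = fls_const (c r1 r2) * fls_X_intpow (d - int r1 - int r2))"

lemma homogI: "(\<And>r1 r2. \<exists>c. f $ r1 $ r2 = fls_const c * fls_X_intpow (d - int r1 - int r2)) \<Longrightarrow> homog d f"
  unfolding homog_def by metis

lemma homog_add: assumes "homog d f" "homog d g" shows "homog d (f + g)"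
proof -
  obtain a b where "\<And>r1 r2. f $ r1 $ r2 = fls_const (a r1 r2) * fls_X_intpow (d - int r1 - int r2)"
    "\<And>r1 r2. g $ r1 $ r2 = fls_const (b r1 r2) * fls_X_intpow (d - int r1 - int r2)"
    using assms unfolding homog_def by metis
  then show ?thesis
    by (intro homogI, rule_tac x = "a r1 r2 + b r1 r2" in exI) (simp add: fls_plus_const[symmetric] ring_distribs del: fls_plus_const)
qed

lemma homog_0: "homog d 0"
  by (intro homogI exI[of _ 0]) simp

lemma homog_uminus: assumes "homog d f" shows "homog d (- f)"
proof -
  obtain a where "\<And>r1 r2. f $ r1 $ r2 = fls_const (a r1 r2) * fls_X_intpow (d - int r1 - int r2)"
    using assms unfolding homog_def by metis
  then show ?thesis
    by (intro homogI, rule_tac x = "- a r1 r2" in exI) simp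
qed

lemma homog_sum: "(\<And>i. i \<in> I \<Longrightarrow> homog d (f i)) \<Longrightarrow> homog d (\<Sum>i\<in>I. f i)"
  by (induction I rule: infinite_finite_induct) (auto intro: homog_add homog_0)

lemma fls_const_sum: "fls_const (\<Sum>i\<in>I. F i) = (\<Sum>i\<in>I. fls_const (F i :: complex))"
  by (induction I rule: infinite_finite_induct) (simp_all add: fls_plus_const[symmetric] del: fls_plus_const)

lemma homog_mult: assumes "homog d f" "homog e g" shows "homog (d + e) (f * g)"
proof -
  obtain a b where a: "\<And>r1 r2. f $ r1 $ r2 = fls_const (a r1 r2) * fls_X_intpow (d - int r1 - int r2)"
    and b: "\<And>r1 r2. g $ r1 $ r2 = fls_const (b r1 r2) * fls_X_intpow (e - int r1 - int r2)"
    using assms unfolding homog_def by metis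
  show ?thesis
  proof (rule homogI)
    fix r1 r2
    have "(f * g) $ r1 $ r2 = (\<Sum>i=0..r1. \<Sum>j=0..r2. f $ i $ j * g $ (r1 - i) $ (r2 - j))"
      by (simp add: fps_mult_nth fps_sum_nth)
    also have "\<dots> = (\<Sum>i=0..r1. \<Sum>j=0..r2.
        fls_const (a i j * b (r1 - i) (r2 - j)) * fls_X_intpow (d + e - int r1 - int r2))"
    proof (intro sum.cong refl)
      fix i j assume ij: "i \<in> {0..r1}" "j \<in> {0..r2}"
      have "f $ i $ j * g $ (r1 - i) $ (r2 - j) =
        (fls_const (a i j) * fls_const (b (r1 - i) (r2 - j))) *
        (fls_X_intpow (d - int i - int j) * fls_X_intpow (e - int (r1 - i) - int (r2 - j)))"
        by (simp only: a b mult_ac)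
      also have "fls_X_intpow (d - int i - int j) * fls_X_intpow (e - int (r1 - i) - int (r2 - j)) =
          (fls_X_intpow (d + e - int r1 - int r2) :: complex fls)"
        unfolding fls_X_intpow_times_fls_X_intpow
        by (rule arg_cong[where f = fls_X_intpow]) (use ij in auto)
      finally show "f $ i $ j * g $ (r1 - i) $ (r2 - j) =
          fls_const (a i j * b (r1 - i) (r2 - j)) * fls_X_intpow (d + e - int r1 - int r2)"
        by (simp only: fls_const_mult_const)
    qed
    also have "\<dots> = fls_const (\<Sum>i=0..r1. \<Sum>j=0..r2. a i j * b (r1 - i) (r2 - j)) *
        fls_X_intpow (d + e - int r1 - int r2)"
      by (simp only: fls_const_sum sum_distrib_right)
    finally show "\<exists>c. (f * g) $ r1 $ r2 = fls_const c * fls_X_intpow (d + e - int r1 - int r2)"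
      by blast
  qed
qed

lemma homog_1: "homog 0 1"
  by (rule homogI) (auto intro: exI[of _ 1] exI[of _ 0])

lemma homog_power: "homog 0 f \<Longrightarrow> homog 0 (f ^ k)"
proof (induction k)
  case (Suc k)
  then show ?case using homog_mult[of 0 f 0 "f ^ k"] by simp
qed (simp add: homog_1)

lemma homog_x: "homog 1 ser_x" and homog_y: "homog 1 ser_y" and homog_z: "homog 1 ser_z"
proof -
  have 1: "\<exists>c. (if P then 1 else 0 :: complex fls) = fls_const c * fls_X_intpow k"
    if "P \<Longrightarrow> k = 0" for P k
    using that by (cases P) (auto intro: exI[of _ 1] exI[of _ 0])
  have 2: "\<exists>c. (if P then fls_X else 0 :: complex fls) = fls_const c * fls_X_intpow k"
    if "P \<Longrightarrow> k = 1" for P k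
    using that by (cases P) (auto intro: exI[of _ 1] exI[of _ 0] simp: fls_X_conv_shift_1)
  have "ser_x $ r1 $ r2 = (if r1 = 1 \<and> r2 = 0 then 1 else 0)"
    "ser_y $ r1 $ r2 = (if r1 = 0 \<and> r2 = 1 then 1 else 0)"
    "ser_z $ r1 $ r2 = (if r1 = 0 \<and> r2 = 0 then fls_X else 0)" for r1 r2
    by (auto simp: ser_x_def ser_y_def ser_z_def)
  then show "homog 1 ser_x" "homog 1 ser_y" "homog 1 ser_z"
    by (intro homogI; simp only:; intro 1 2; simp)+
qed

definition inv_x :: xyz_series where
  "inv_x = Abs_fps (\<lambda>k. fps_const (fls_const ((-1) ^ k) * fls_X_intpow (- 1 - int k)))"

definition inv_y :: xyz_series where
  "inv_y = fps_const (Abs_fps (\<lambda>k. fls_const ((-1) ^ k) * fls_X_intpow (- 1 - int k)))"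

lemma fls_X_times_intpow: "fls_X * fls_X_intpow k = (fls_X_intpow (k + 1) :: complex fls)"
proof -
  have "(fls_X :: complex fls) = fls_X_intpow 1"
    by (simp add: fls_X_conv_shift_1)
  then have "fls_X * fls_X_intpow k = (fls_X_intpow 1 * fls_X_intpow k :: complex fls)"
    by (rule arg_cong)
  also have "\<dots> = fls_X_intpow (1 + k)"
    by (rule fls_X_intpow_times_fls_X_intpow)
  finally show ?thesis
    by (simp only: add.commute)
qed

lemma inv_aux_0: "fls_X * (fls_const 1 * fls_X_intpow (- 1)) = (1 :: complex fls)"
  using fls_X_times_intpow[of "-1"] by simp

lemma inv_aux_Suc: "fls_X * (fls_const ((-1) ^ Suc k) * fls_X_intpow (- 1 - int (Suc k))) +
    fls_const ((-1) ^ k) * fls_X_intpow (- 1 - int k) = (0 :: complex fls)"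
proof -
  have "fls_X * (fls_const ((-1) ^ Suc k) * fls_X_intpow (- 1 - int (Suc k))) =
      - (fls_const ((-1) ^ k) * (fls_X * fls_X_intpow (- 1 - int (Suc k))) :: complex fls)"
    by (simp add: mult_ac del: fls_X_times_conv_shift fls_X_intpow_times_conv_shift)
  then show ?thesis
    by (simp only: fls_X_times_intpow) (simp add: algebra_simps)
qed

lemma inv_x: "(ser_z + ser_x) * inv_x = 1"
proof (rule fps_ext)
  fix k
  have "((ser_z + ser_x) * inv_x) $ k =
     fps_const fls_X * inv_x $ k + (if k = 0 then 0 else inv_x $ (k - 1))"
    by (simp add: ring_distribs ser_z_def ser_x_def)
  then show "((ser_z + ser_x) * inv_x) $ k = 1 $ k"
    using inv_aux_0 inv_aux_Suc
    by (cases k) (simp_all only: inv_x_def fps_nth_Abs_fps fps_const_mult fps_const_add, simp_all)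
qed

lemma inv_y: "(ser_z + ser_y) * inv_y = 1"
proof -
  let ?g = "Abs_fps (\<lambda>k. fls_const ((-1) ^ k) * fls_X_intpow (- 1 - int k)) :: complex fls fps"
  have "(fps_const fls_X + fps_X) * ?g = 1"
  proof (rule fps_ext)
    fix k
    have "((fps_const fls_X + fps_X) * ?g) $ k =
       fls_X * ?g $ k + (if k = 0 then 0 else ?g $ (k - 1))"
      by (simp add: ring_distribs)
    then show "((fps_const fls_X + fps_X) * ?g) $ k = 1 $ k"
      using inv_aux_0 inv_aux_Suc
      by (cases k) (simp_all only: fps_nth_Abs_fps, simp_all)
  qed
  then show ?thesis
    by (simp add: ser_z_def ser_y_def inv_y_def)
qed

lemma homog_inv_x: "homog (-1) inv_x" and homog_inv_y: "homog (-1) inv_y"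
proof -
  have 1: "\<exists>c. (if P then fls_const a * fls_X_intpow k else 0) = fls_const c * fls_X_intpow l"
    if "P \<Longrightarrow> k = l" for P k l and a :: complex
    using that by (cases P) (auto intro: exI[of _ 0])
  have "inv_x $ r1 $ r2 = (if r2 = 0 then fls_const ((-1) ^ r1) * fls_X_intpow (- 1 - int r1) else 0)"
    "inv_y $ r1 $ r2 = (if r1 = 0 then fls_const ((-1) ^ r2) * fls_X_intpow (- 1 - int r2) else 0)"
    for r1 r2
    by (simp_all add: inv_x_def inv_y_def)
  then show "homog (-1) inv_x" "homog (-1) inv_y"
    by (auto intro!: homogI 1)
qed

lemma ex_is_Im: "\<exists>c. is_Im \<iota> c"
proof -
  have inv: "inverse (ser_z + ser_x) = inv_x"
    by (rule nested_inverse_unique) (rule inv_x)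
  let ?U = "(ser_z + ser_y) * inv_x" and ?V = "(ser_z + ser_x) * inv_y"
  have hU: "homog 0 ?U" and hV: "homog 0 ?V"
    using homog_mult[OF homog_add[OF homog_z homog_y] homog_inv_x]
      homog_mult[OF homog_add[OF homog_z homog_x] homog_inv_y] by simp_all
  have "?U * ?V = ((ser_z + ser_x) * inv_x) * ((ser_z + ser_y) * inv_y)"
    by (simp only: mult_ac)
  then have UV: "inverse ?U = ?V"
    by (intro nested_inverse_unique) (simp add: inv_x inv_y)
  have "\<exists>G. homog (-1) G \<and> (ser_x - ser_y) * G = ?U powi \<iota> - 1"
  proof (cases "\<iota> \<ge> 0")
    case True
    let ?G = "- (inv_x * (\<Sum>i<nat \<iota>. ?U ^ i))"
    have "?U - 1 = ?U - (ser_z + ser_x) * inv_x"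
      by (simp only: inv_x)
    then have "?U - 1 = (ser_y - ser_x) * inv_x"
      by (simp add: algebra_simps)
    then have "?U powi \<iota> - 1 = ((ser_y - ser_x) * inv_x) * (\<Sum>i<nat \<iota>. ?U ^ i)"
      using True by (simp add: power_int_def power_diff_1_eq)
    also have "\<dots> = (ser_x - ser_y) * ?G"
      by (simp only: minus_diff_eq[of ser_x ser_y, symmetric] mult_minus_left mult_minus_right mult_ac)
    finally have "(ser_x - ser_y) * ?G = ?U powi \<iota> - 1" by simp
    moreover have "homog (-1 + 0) (inv_x * (\<Sum>i<nat \<iota>. ?U ^ i))"
      by (intro homog_mult homog_inv_x homog_sum homog_power hU)
    ultimately show ?thesis
      using homog_uminus by fastforce
  next
    case False
    let ?G = "inv_y * (\<Sum>i<nat (- \<iota>). ?V ^ i)"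
    have "?V - 1 = ?V - (ser_z + ser_y) * inv_y"
      by (simp only: inv_y)
    then have "?V - 1 = (ser_x - ser_y) * inv_y"
      by (simp add: algebra_simps)
    then have "?U powi \<iota> - 1 = ((ser_x - ser_y) * inv_y) * (\<Sum>i<nat (- \<iota>). ?V ^ i)"
      using False by (simp add: power_int_def UV power_diff_1_eq)
    also have "\<dots> = (ser_x - ser_y) * ?G"
      by (simp only: mult_ac)
    finally have "(ser_x - ser_y) * ?G = ?U powi \<iota> - 1" by simp
    moreover have "homog (-1 + 0) ?G"
      by (intro homog_mult homog_inv_y homog_sum homog_power hV)
    ultimately show ?thesis by auto
  qed
  then obtain G c where G: "(ser_x - ser_y) * G = ?U powi \<iota> - 1"
    and c: "\<And>r1 r2. G $ r1 $ r2 = fls_const (c r1 r2) * fls_X_intpow (-1 - int r1 - int r2)"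
    unfolding homog_def by blast
  have "Im_genfun c = G"
    by (intro fps_ext) (simp add: Im_genfun_def c algebra_simps)
  then show ?thesis
    using G unfolding is_Im_def inv by metis
qed

lemma is_Im_unique: assumes "is_Im \<iota> c" "is_Im \<iota> d" shows "c = d"
proof -
  have "(ser_x - ser_y) $ 1 $ 0 = 1"
    by (simp add: ser_x_def ser_y_def)
  then have "ser_x - ser_y \<noteq> 0" by force
  then have eq: "Im_genfun c = Im_genfun d"
    using assms unfolding is_Im_def by (metis mult_left_cancel)
  show ?thesis
  proof (intro ext)
    fix r1 r2
    have "Im_genfun c $ r1 $ r2 = Im_genfun d $ r1 $ r2"
      by (simp only: eq)
    then have "fls_const (c r1 r2) = fls_const (d r1 r2)"
      unfolding Im_genfun_def fps_nth_Abs_fps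
      by (metis mult_right_cancel fls_X_intpow_nonzero)
    then have "fls_nth (fls_const (c r1 r2)) 0 = fls_nth (fls_const (d r1 r2)) 0"
      by (rule arg_cong)
    then show "c r1 r2 = d r1 r2" by simp
  qed
qed

theorem is_Im_Im_const: "is_Im \<iota> (Im_const \<iota>)"
  unfolding Im_const_def using ex_is_Im[of \<iota>] is_Im_unique[of \<iota>] by (metis theI)

end

theory Submission
  imports Defs
begin

text \<open>
  A differential operator is determined by its matrix on the basis \<open>t\<^sup>k\<close>, \<open>k \<in> \<int>\<close>, of the Laurent
  polynomials, and this matrix has finitely many nonzero diagonals.  Both Lie algebras are therefore
  studied inside one ring, that of the band matrices over \<open>\<A>\<close> (\<open>mat_inject\<close>,
  \<open>mat_hat_bracket\<close>), where \<open>t\<^sup>k\<close> corresponds to the index \<open>k - \<iota> + 1/2\<close> of the second algebra.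

  Let \<open>e\<^sub>j \<in> B\<^sub>j\<close> be the components of \<open>1\<close>.  They are orthogonal idempotents with
  \<open>B\<^bsub>i,j\<^esub> = e\<^sub>i \<A> e\<^sub>j\<close> and \<open>\<tau> e\<^sub>j = e\<^bsub>\<pi> j\<^esub>\<close>.  Put \<open>L = (\<Sum>j. e\<^sub>j \<otimes> \<partial>\<^bsup>\<ell>\<^sub>j\<^esup>)\<close>, and let \<open>*\<close> be
  the anti-automorphism with \<open>a\<^sup>* = \<tau> a\<close>, \<open>t\<^sup>* = t\<close>, \<open>\<partial>\<^sup>* = -\<partial>\<close>.  The parity condition says
  \<open>L\<^sup>* = (-1)\<^sup>\<epsilon> L\<close>, and the generators of the twisted algebra of differential operators are the
  \<open>(X - (-1)\<^sup>\<epsilon> X\<^sup>*) L\<close>.  Hence, modulo the centre, this algebra consists of the products \<open>Y L\<close> with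
  \<open>Y\<close> skew, that is \<open>Y\<^sup>* = -(-1)\<^sup>\<epsilon> Y\<close>.  It is closed under brackets because
  \<open>[Y L, Z L] = (Y L Z - Z L Y) L\<close> and \<open>Y L Z - Z L Y\<close> is skew again.

  The algebra of infinite matrices has the same shape.  Let \<open>P\<close> be the diagonal projection that
  removes the rows excluded by the index sets.  Then the spanning elements are \<open>P (E - (-1)\<^sup>\<epsilon> E\<^sup>*) L\<close>
  for matrices \<open>E\<close> with a single nonzero entry (\<open>lift_skew_unit\<close>), and \<open>L P = L\<close> shows that
  \<open>Y L \<mapsto> P Y L\<close> preserves products.  So the sum that defines the representation on \<open>Y L\<close>
  is the action of the infinite matrix \<open>P Y L\<close>.  Every vector of the module is annihilated by
  the matrix entries that are close to the diagonal and far from the origin (\<open>eventually_killed\<close>),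
  because such entries commute with any given element and kill the generating subspace.  Thus all
  sufficiently large truncations \<open>P Y\<^sub>K L\<close> act in the same way on a given vector, and their common
  value defines the action.  The truncation of a bracket and the bracket of the truncations differ by
  \<open>P D L\<close> with \<open>D\<close> skew and supported far from the origin, which acts as zero (\<open>sigma_bracket\<close>).

  It remains to compare the central terms.  With \<open>h\<^sub>\<iota> k = 1\<close> for \<open>k \<ge> \<iota>\<close> and \<open>0\<close> otherwise, the two
  cocycles are \<open>\<Sum>p k. (h p - h k) tr (M\<^bsub>p k\<^esub> N\<^bsub>k p\<^esub>)\<close> for \<open>h = h\<^sub>0\<close> (differential operators, by a
  convolution of binomial coefficients) and \<open>h = h\<^sub>\<iota>\<close> (infinite matrices).  Since \<open>h\<^sub>\<iota> - h\<^sub>0\<close> has finite support, they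
  differ by the coboundary of \<open>M \<mapsto> \<Sum>k. (h\<^sub>\<iota> k - h\<^sub>0 k) tr M\<^bsub>k k\<^esub>\<close> (\<open>cocycle_shift\<close>), and
  adding this functional to the action makes it a representation.  Its values on the
  generators are the stated multiples of the constants (\<open>Im_const_eq\<close>): the generating function
  \<open>F\<^sub>\<iota>\<close> of the constants satisfies \<open>F\<^bsub>\<iota>+1\<^esub> - F\<^sub>\<iota> = -(z + y)\<^sup>\<iota> (z + x)\<^bsup>-\<iota>-1\<^esup>\<close>.
\<close>

alias single = Poly_Mapping.single
alias lookup = Poly_Mapping.lookup
alias keys = Poly_Mapping.keys

section \<open>The ring of band matrices\<close>

typedef (overloaded) 'a band =
  "{M :: int \<Rightarrow> int \<Rightarrow> 'a::zero. \<exists>b. \<forall>p q. M p q \<noteq> 0 \<longrightarrow> \<bar>p - q\<bar> \<le> b}"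
  morphisms ent Band
  by (rule exI[of _ "\<lambda>_ _. 0"]) simp

setup_lifting type_definition_band

lemma band_eqI: "(\<And>p q. ent M p q = ent N p q) \<Longrightarrow> M = N"
  by (simp add: ent_inject[symmetric] fun_eq_iff)

definition bandwidth :: "int \<Rightarrow> 'a::zero band \<Rightarrow> bool" where
  "bandwidth b M \<longleftrightarrow> (\<forall>p q. ent M p q \<noteq> 0 \<longrightarrow> \<bar>p - q\<bar> \<le> b)"

lemma bandwidthD: "bandwidth b M \<Longrightarrow> ent M p q \<noteq> 0 \<Longrightarrow> \<bar>p - q\<bar> \<le> b"
  by (simp add: bandwidth_def)

lemma ex_bandwidth: "\<exists>b\<ge>0. bandwidth b M"
proof -
  obtain b where "\<forall>p q. ent M p q \<noteq> 0 \<longrightarrow> \<bar>p - q\<bar> \<le> b"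
    using ent[of M] by auto
  then show ?thesis
    unfolding bandwidth_def by (intro exI[of _ "max 0 b"]) (simp add: le_max_iff_disj)
qed

lemma bandwidth_mono: "bandwidth b M \<Longrightarrow> b \<le> c \<Longrightarrow> bandwidth c M"
  unfolding bandwidth_def by (meson order_trans)

lemma finite_row: "finite {q. ent M p q \<noteq> 0}"
proof -
  obtain b where b: "bandwidth b M" using ex_bandwidth by blast
  have "q \<in> {p - b..p + b}" if "ent M p q \<noteq> 0" for q
    using bandwidthD[OF b that] by auto
  then have "{q. ent M p q \<noteq> 0} \<subseteq> {p - b..p + b}" by blast
  then show ?thesis by (rule finite_subset) simp
qed

lemma finite_col: "finite {p. ent M p q \<noteq> 0}"
proof -
  obtain b where b: "bandwidth b M" using ex_bandwidth by blast
  have "p \<in> {q - b..q + b}" if "ent M p q \<noteq> 0" for p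
    using bandwidthD[OF b that] by auto
  then have "{p. ent M p q \<noteq> 0} \<subseteq> {q - b..q + b}" by blast
  then show ?thesis by (rule finite_subset) simp
qed

lemma sum_times_nonzero:
  fixes f g :: "'b \<Rightarrow> 'a::ring_1"
  assumes "(\<Sum>q\<in>S. f q * g q) \<noteq> 0"
  obtains q where "f q \<noteq> 0" "g q \<noteq> 0"
proof (rule ccontr)
  assume "\<not> thesis"
  then have "f q = 0 \<or> g q = 0" for q using that by blast
  then have "f q * g q = 0" for q by (metis mult_zero_left mult_zero_right)
  with assms show False by simp
qed

instantiation band :: (ring_1) ring_1
begin

lift_definition zero_band :: "'a band" is "\<lambda>_ _. 0" by simp

lift_definition one_band :: "'a band" is "\<lambda>p q. if p = q then 1 else 0"
  by (rule exI[of _ 0]) simp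

lift_definition plus_band :: "'a band \<Rightarrow> 'a band \<Rightarrow> 'a band" is "\<lambda>M N p q. M p q + N p q"
proof -
  fix M N :: "int \<Rightarrow> int \<Rightarrow> 'a"
  assume "\<exists>b. \<forall>p q. M p q \<noteq> 0 \<longrightarrow> \<bar>p - q\<bar> \<le> b" "\<exists>b. \<forall>p q. N p q \<noteq> 0 \<longrightarrow> \<bar>p - q\<bar> \<le> b"
  then obtain b c where bc: "\<And>p q. M p q \<noteq> 0 \<Longrightarrow> \<bar>p - q\<bar> \<le> b" "\<And>p q. N p q \<noteq> 0 \<Longrightarrow> \<bar>p - q\<bar> \<le> c"
    by blast
  have "\<bar>p - q\<bar> \<le> max b c" if "M p q + N p q \<noteq> 0" for p q
  proof -
    have "M p q \<noteq> 0 \<or> N p q \<noteq> 0" using that by auto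
    then show ?thesis using bc(1)[of p q] bc(2)[of p q] by linarith
  qed
  then show "\<exists>b. \<forall>p q. M p q + N p q \<noteq> 0 \<longrightarrow> \<bar>p - q\<bar> \<le> b" by blast
qed

lift_definition uminus_band :: "'a band \<Rightarrow> 'a band" is "\<lambda>M p q. - M p q" by simp

definition minus_band :: "'a band \<Rightarrow> 'a band \<Rightarrow> 'a band" where
  "minus_band M N = M + (- N)"

lift_definition times_band :: "'a band \<Rightarrow> 'a band \<Rightarrow> 'a band" is
  "\<lambda>M N p r. \<Sum>q | M p q \<noteq> 0. M p q * N q r"
proof -
  fix M N :: "int \<Rightarrow> int \<Rightarrow> 'a"
  assume "\<exists>b. \<forall>p q. M p q \<noteq> 0 \<longrightarrow> \<bar>p - q\<bar> \<le> b" "\<exists>b. \<forall>p q. N p q \<noteq> 0 \<longrightarrow> \<bar>p - q\<bar> \<le> b"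
  then obtain b c where bc: "\<And>p q. M p q \<noteq> 0 \<Longrightarrow> \<bar>p - q\<bar> \<le> b" "\<And>p q. N p q \<noteq> 0 \<Longrightarrow> \<bar>p - q\<bar> \<le> c"
    by blast
  have "\<bar>p - r\<bar> \<le> b + c" if nz: "(\<Sum>q | M p q \<noteq> 0. M p q * N q r) \<noteq> 0" for p r
  proof -
    obtain q where "M p q \<noteq> 0" "N q r \<noteq> 0"
      using nz by (rule sum_times_nonzero)
    then show ?thesis using bc(1)[of p q] bc(2)[of q r] by linarith
  qed
  then show "\<exists>b. \<forall>p r. (\<Sum>q | M p q \<noteq> 0. M p q * N q r) \<noteq> 0 \<longrightarrow> \<bar>p - r\<bar> \<le> b" by blast
qed

text \<open>
  The product sums over the nonzero entries of a row of the left factor; any finite set of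
  intermediate indices outside of which one of the factors vanishes gives the same value.
\<close>

lemma ent_times_superset:
  fixes M N :: "'a band"
  assumes "finite S" "\<And>q. ent M p q \<noteq> 0 \<Longrightarrow> ent N q r \<noteq> 0 \<Longrightarrow> q \<in> S"
  shows "ent (M * N) p r = (\<Sum>q\<in>S. ent M p q * ent N q r)"
proof -
  have "ent (M * N) p r = (\<Sum>q | ent M p q \<noteq> 0. ent M p q * ent N q r)"
    by (simp add: times_band.rep_eq)
  also have "\<dots> = (\<Sum>q\<in>S \<union> {q. ent M p q \<noteq> 0}. ent M p q * ent N q r)"
    by (intro sum.mono_neutral_left) (use assms(1) finite_row in auto)
  also have "\<dots> = (\<Sum>q\<in>S. ent M p q * ent N q r)"
  proof (intro sum.mono_neutral_right ballI)
    fix q assume "q \<in> S \<union> {q. ent M p q \<noteq> 0} - S"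
    then have "ent N q r = 0" using assms(2) by auto
    then show "ent M p q * ent N q r = 0" by simp
  qed (use assms(1) finite_row in auto)
  finally show ?thesis .
qed

instance
proof
  fix a b c :: "'a band"
  show "a + b + c = a + (b + c)" by transfer (simp add: add.assoc)
  show "a + b = b + a" by transfer (simp add: add.commute)
  show "0 + a = a" by transfer simp
  show "- a + a = 0" by transfer simp
  show "a - b = a + - b" by (rule minus_band_def)
  show "1 * a = a"
  proof (rule band_eqI)
    fix p q
    have "ent (1 * a) p q = (\<Sum>r\<in>{p}. ent 1 p r * ent a r q)"
      by (rule ent_times_superset) (auto simp: one_band.rep_eq split: if_splits)
    then show "ent (1 * a) p q = ent a p q" by (simp add: one_band.rep_eq)
  qed
  show "a * 1 = a"
  proof (rule band_eqI)
    fix p q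
    have "ent (a * 1) p q = (\<Sum>r\<in>{q}. ent a p r * ent 1 r q)"
      by (rule ent_times_superset) (auto simp: one_band.rep_eq split: if_splits)
    then show "ent (a * 1) p q = ent a p q" by (simp add: one_band.rep_eq)
  qed
  show "(0::'a band) \<noteq> 1"
  proof
    assume "(0::'a band) = 1"
    then have "ent (0::'a band) 0 0 = ent 1 0 0" by simp
    then show False by (simp add: one_band.rep_eq zero_band.rep_eq)
  qed
  show "(a + b) * c = a * c + b * c"
  proof (rule band_eqI)
    fix p r
    let ?S = "{q. ent c q r \<noteq> 0}"
    have *: "ent (d * c) p r = (\<Sum>q\<in>?S. ent d p q * ent c q r)" for d :: "'a band"
      by (rule ent_times_superset) (auto simp: finite_col)
    show "ent ((a + b) * c) p r = ent (a * c + b * c) p r"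
      by (simp add: * plus_band.rep_eq ring_distribs sum.distrib)
  qed
  show "a * (b + c) = a * b + a * c"
    by (rule band_eqI) (simp add: times_band.rep_eq plus_band.rep_eq ring_distribs sum.distrib)
  show "a * b * c = a * (b * c)"
  proof (rule band_eqI)
    fix p s
    let ?Q = "{q. ent a p q \<noteq> 0}" and ?R = "{r. ent c r s \<noteq> 0}"
    have "ent (a * b * c) p s = (\<Sum>r\<in>?R. ent (a * b) p r * ent c r s)"
      by (rule ent_times_superset) (auto simp: finite_col)
    also have "\<dots> = (\<Sum>r\<in>?R. \<Sum>q\<in>?Q. ent a p q * ent b q r * ent c r s)"
      by (simp add: times_band.rep_eq sum_distrib_right)
    also have "\<dots> = (\<Sum>q\<in>?Q. \<Sum>r\<in>?R. ent a p q * (ent b q r * ent c r s))"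
      by (subst sum.swap) (simp add: mult.assoc)
    also have "\<dots> = (\<Sum>q\<in>?Q. ent a p q * ent (b * c) q s)"
    proof (intro sum.cong refl)
      fix q
      have "ent (b * c) q s = (\<Sum>r\<in>?R. ent b q r * ent c r s)"
        by (rule ent_times_superset) (auto simp: finite_col)
      then show "(\<Sum>r\<in>?R. ent a p q * (ent b q r * ent c r s)) = ent a p q * ent (b * c) q s"
        by (simp add: sum_distrib_left)
    qed
    also have "\<dots> = ent (a * (b * c)) p s"
      by (simp add: times_band.rep_eq)
    finally show "ent (a * b * c) p s = ent (a * (b * c)) p s" .
  qed
qed

end

lemma ent_add [simp]: "ent (M + N) p q = ent M p q + ent N p q"
  and ent_0 [simp]: "ent 0 p q = 0"
  and ent_minus [simp]: "ent (- M) p q = - ent M p q"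
  by (transfer; simp)+

lemma ent_diff [simp]: "ent (M - N) p q = ent M p q - ent N p q"
  by (simp only: minus_band_def ent_add ent_minus) simp

lemma ent_sum: "ent (\<Sum>i\<in>I. M i) p q = (\<Sum>i\<in>I. ent (M i) p q)"
  by (induction I rule: infinite_finite_induct) auto

lemma ent_sign_times: "ent ((-1) ^ k * M) p q = (-1) ^ k * ent M p q"
  by (cases "even k") auto

lemma ent_times_nonzero:
  fixes M N :: "'a::ring_1 band"
  assumes "ent (M * N) p r \<noteq> 0"
  obtains q where "ent M p q \<noteq> 0" "ent N q r \<noteq> 0"
  using assms unfolding times_band.rep_eq
  by (rule sum_times_nonzero) (rule that)

lemma bandwidth_times:
  assumes "bandwidth b M" "bandwidth c N"
  shows "bandwidth (b + c) (M * N)"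
  unfolding bandwidth_def
proof (intro allI impI)
  fix p r assume "ent (M * N) p r \<noteq> 0"
  then obtain q where "ent M p q \<noteq> 0" "ent N q r \<noteq> 0"
    by (rule ent_times_nonzero)
  then have "\<bar>p - q\<bar> \<le> b" "\<bar>q - r\<bar> \<le> c" using assms by (simp_all add: bandwidth_def)
  then show "\<bar>p - r\<bar> \<le> b + c" by linarith
qed

lemma bandwidth_diff:
  assumes "bandwidth b M" "bandwidth b N"
  shows "bandwidth b (M - N)"
  unfolding bandwidth_def
proof (intro allI impI)
  fix p q assume "ent (M - N) p q \<noteq> 0"
  then have "ent M p q \<noteq> 0 \<or> ent N p q \<noteq> 0" by auto
  then show "\<bar>p - q\<bar> \<le> b" using bandwidthD[OF assms(1), of p q] bandwidthD[OF assms(2), of p q] by argo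
qed

text \<open>
  Only the row index is bounded: a bandwidth then bounds the column index as well, and the relation
  passes to products with a loss equal to that bandwidth.
\<close>

definition agree :: "int \<Rightarrow> 'a::zero band \<Rightarrow> 'a band \<Rightarrow> bool" where
  "agree m M N \<longleftrightarrow> (\<forall>p q. \<bar>p\<bar> < m \<longrightarrow> ent M p q = ent N p q)"

lemma agree_times:
  fixes M N :: "'a::ring_1 band"
  assumes M: "agree m M M'" and N: "agree (m + b) N N'" and b: "bandwidth b M'"
  shows "agree m (M * N) (M' * N')"
  unfolding agree_def
proof (intro allI impI)
  fix p r assume p: "\<bar>p\<bar> < m"
  let ?S = "{q. ent M' p q \<noteq> 0}"
  have "ent (M * N) p r = (\<Sum>q\<in>?S. ent M p q * ent N q r)"
    by (rule ent_times_superset) (use M p in \<open>auto simp: finite_row agree_def\<close>)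
  also have "\<dots> = (\<Sum>q\<in>?S. ent M' p q * ent N' q r)"
  proof (intro sum.cong refl)
    fix q assume "q \<in> ?S"
    then have "\<bar>p - q\<bar> \<le> b" using b by (simp add: bandwidth_def)
    then have "\<bar>q\<bar> < m + b" using p by linarith
    then show "ent M p q * ent N q r = ent M' p q * ent N' q r"
      using M N p by (simp add: agree_def)
  qed
  finally show "ent (M * N) p r = ent (M' * N') p r" by (simp add: times_band.rep_eq)
qed

lemma agree_refl: "agree m M M"
  by (simp add: agree_def)

lemma agree_diff: "agree m M M' \<Longrightarrow> agree m N N' \<Longrightarrow> agree m (M - N) (M' - N')"
  by (simp add: agree_def)

lemma agree_mono: "agree m M N \<Longrightarrow> k \<le> m \<Longrightarrow> agree k M N"
  by (simp add: agree_def)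

definition support :: "'a::zero band \<Rightarrow> (int \<times> int) set" where
  "support M = {(p, q). ent M p q \<noteq> 0}"

lemma finite_support_times:
  fixes M N :: "'a::ring_1 band"
  assumes "finite (support M) \<or> finite (support N)"
  shows "finite (support (M * N))"
proof -
  have "support (M * N) \<subseteq> (\<lambda>((p, q), r). (p, r)) ` (SIGMA z:support M. {r. ent N (snd z) r \<noteq> 0})"
    and "support (M * N) \<subseteq> (\<lambda>((q, r), p). (p, r)) ` (SIGMA z:support N. {p. ent M p (fst z) \<noteq> 0})"
  proof -
    have ex: "\<exists>q. ent M p q \<noteq> 0 \<and> ent N q r \<noteq> 0" if "(p, r) \<in> support (M * N)" for p r
      using that ent_times_nonzero[of M N p r] by (auto simp: support_def)
    show "support (M * N) \<subseteq> (\<lambda>((p, q), r). (p, r)) ` (SIGMA z:support M. {r. ent N (snd z) r \<noteq> 0})"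
    proof (rule subrelI)
      fix p r assume "(p, r) \<in> support (M * N)"
      then obtain q where "ent M p q \<noteq> 0" "ent N q r \<noteq> 0" using ex by blast
      then show "(p, r) \<in> (\<lambda>((p, q), r). (p, r)) ` (SIGMA z:support M. {r. ent N (snd z) r \<noteq> 0})"
        by (intro image_eqI[of _ _ "((p, q), r)"]) (auto simp: support_def)
    qed
    show "support (M * N) \<subseteq> (\<lambda>((q, r), p). (p, r)) ` (SIGMA z:support N. {p. ent M p (fst z) \<noteq> 0})"
    proof (rule subrelI)
      fix p r assume "(p, r) \<in> support (M * N)"
      then obtain q where "ent M p q \<noteq> 0" "ent N q r \<noteq> 0" using ex by blast
      then show "(p, r) \<in> (\<lambda>((q, r), p). (p, r)) ` (SIGMA z:support N. {p. ent M p (fst z) \<noteq> 0})"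
        by (intro image_eqI[of _ _ "((q, r), p)"]) (auto simp: support_def)
    qed
  qed
  moreover have "finite (SIGMA z:support M. {r. ent N (snd z) r \<noteq> 0})" if "finite (support M)"
    using that finite_row by blast
  moreover have "finite (SIGMA z:support N. {p. ent M p (fst z) \<noteq> 0})" if "finite (support N)"
    using that finite_col by blast
  ultimately show ?thesis
    using assms by (meson finite_imageI finite_subset)
qed

lemma finite_support_diff:
  fixes M N :: "'a::ring_1 band"
  shows "finite (support M) \<Longrightarrow> finite (support N) \<Longrightarrow> finite (support (M - N))"
  by (rule finite_subset[of _ "support M \<union> support N"]) (auto simp: support_def)

lift_definition unit_entry :: "'a::zero \<Rightarrow> int \<Rightarrow> int \<Rightarrow> 'a band" is
  "\<lambda>a p q p' q'. if p' = p \<and> q' = q then a else 0"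
  by (rule exI) auto

lemma ent_unit_entry: "ent (unit_entry a p q) p' q' = (if p' = p \<and> q' = q then a else 0)"
  by transfer simp

lemma finite_support_unit_entry: "finite (support (unit_entry a p q))"
  by (rule finite_subset[of _ "{(p, q)}"]) (auto simp: support_def ent_unit_entry split: if_splits)

lemma sum_unit_entry:
  fixes M :: "'a::ring_1 band"
  assumes "finite (support M)"
  shows "(\<Sum>(p, q)\<in>support M. unit_entry (ent M p q) p q) = M"
proof (rule band_eqI)
  fix p q
  have "ent (\<Sum>(p, q)\<in>support M. unit_entry (ent M p q) p q) p q =
      (\<Sum>z\<in>support M. if z = (p, q) then ent M p q else 0)"
    unfolding ent_sum by (intro sum.cong) (auto simp: ent_unit_entry split: if_splits)
  also have "\<dots> = ent M p q"
    using assms by (simp add: sum.delta support_def)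
  finally show "ent (\<Sum>(p, q)\<in>support M. unit_entry (ent M p q) p q) p q = ent M p q" .
qed

text \<open>
  The half-open window \<open>{-K..<K}\<close> is invariant under \<open>q \<mapsto> -q - 1\<close>, the substitution by which the
  transpose below exchanges rows and columns.  So truncation commutes with the transpose.
\<close>

lift_definition trunc :: "int \<Rightarrow> 'a::zero band \<Rightarrow> 'a band" is
  "\<lambda>K M p q. if p \<in> {-K..<K} \<and> q \<in> {-K..<K} then M p q else 0"
  by auto

lemma ent_trunc: "ent (trunc K M) p q = (if p \<in> {-K..<K} \<and> q \<in> {-K..<K} then ent M p q else 0)"
  by transfer simp

lemma finite_support_trunc: "finite (support (trunc K M))"
  by (rule finite_subset[of _ "{-K..<K} \<times> {-K..<K}"]) (auto simp: support_def ent_trunc split: if_splits)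

lemma bandwidth_trunc: "bandwidth b M \<Longrightarrow> bandwidth b (trunc K M)"
  by (simp add: bandwidth_def ent_trunc)

lemma agree_trunc: "bandwidth b M \<Longrightarrow> agree (K - b) (trunc K M) M"
  unfolding agree_def ent_trunc
proof (intro allI impI)
  fix p q assume b: "bandwidth b M" and p: "\<bar>p\<bar> < K - b"
  show "(if p \<in> {-K..<K} \<and> q \<in> {-K..<K} then ent M p q else 0) = ent M p q"
  proof (cases "ent M p q = 0")
    case False
    with b have "\<bar>p - q\<bar> \<le> b" by (rule bandwidthD)
    with p have "p \<in> {-K..<K} \<and> q \<in> {-K..<K}" by auto
    then show ?thesis by simp
  qed simp
qed

text \<open>
  Keeps the index set \<open>{1..n}\<close> from being rewritten to \<open>{Suc 0..n}\<close>.
\<close>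

declare One_nat_def [simp del]

section \<open>Idempotents, transpose and weight\<close>

lemma ffact_reflect: "ffact (- x - 1) r = (-1) ^ r * ffact (x + of_nat r) r" for x :: "'b::comm_ring_1"
proof -
  have "ffact (- x - 1) r = (\<Prod>k<r. (-1) * (x + of_nat (Suc k)))"
    unfolding ffact_def by (intro prod.cong) (auto simp: algebra_simps)
  also have "\<dots> = (-1) ^ r * (\<Prod>k<r. x + of_nat (Suc k))"
    by (simp only: prod.distrib prod_constant card_lessThan)
  also have "(\<Prod>k<r. x + of_nat (Suc k)) = (\<Prod>k<r. x + of_nat (Suc (r - Suc k)))"
    by (rule prod.nat_diff_reindex[symmetric])
  also have "\<dots> = ffact (x + of_nat r) r"
    unfolding ffact_def by (intro prod.cong) (auto simp: Suc_diff_Suc of_nat_diff simp del: of_nat_Suc)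
  finally show ?thesis .
qed

context tau_setting
begin

sublocale tr: Vector_Spaces.linear scale "(*)" tr
  by (rule tr_linear)

sublocale tau: Vector_Spaces.linear scale scale \<tau>
  by (rule tau_linear)

lemma BB_subspace: "i \<in> {1..n} \<Longrightarrow> j \<in> {1..n} \<Longrightarrow> subspace (BB i j)"
  and BB_subset_B: "i \<in> {1..n} \<Longrightarrow> j \<in> {1..n} \<Longrightarrow> BB i j \<subseteq> B j"
  and B_subspace: "j \<in> {1..n} \<Longrightarrow> subspace (B j)"
  using decomp decomp_B unfolding direct_sum_decomp_def by blast+

lemma B_sum_unique:
  assumes "\<And>j. j \<in> {1..n} \<Longrightarrow> f j \<in> B j" "\<And>j. j \<in> {1..n} \<Longrightarrow> g j \<in> B j"
    and "(\<Sum>j\<in>{1..n}. f j) = (\<Sum>j\<in>{1..n}. g j)" and "j \<in> {1..n}"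
  shows "f j = g j"
proof -
  let ?v = "\<Sum>j\<in>{1..n}. f j"
  have "\<exists>!h. h \<in> (\<Pi>\<^sub>E i\<in>{1..n}. B i) \<and> ?v = (\<Sum>i\<in>{1..n}. h i)"
    using decomp unfolding direct_sum_decomp_def by blast
  moreover have "restrict f {1..n} \<in> (\<Pi>\<^sub>E i\<in>{1..n}. B i) \<and> ?v = (\<Sum>i\<in>{1..n}. restrict f {1..n} i)"
    using assms(1) by (auto intro!: sum.cong)
  moreover have "restrict g {1..n} \<in> (\<Pi>\<^sub>E i\<in>{1..n}. B i) \<and> ?v = (\<Sum>i\<in>{1..n}. restrict g {1..n} i)"
    using assms(2) unfolding assms(3) by (auto intro!: sum.cong)
  ultimately have "restrict f {1..n} = restrict g {1..n}" by blast
  then show ?thesis using assms(4) by (metis restrict_apply')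
qed

text \<open>
  The components of \<open>1\<close> in the decomposition into the left ideals \<open>B j\<close>.
\<close>

definition idem :: "nat \<Rightarrow> 'a" where
  "idem = (SOME f. (\<forall>j\<in>{1..n}. f j \<in> B j) \<and> (\<Sum>j\<in>{1..n}. f j) = 1)"

lemma idem_in_B: "j \<in> {1..n} \<Longrightarrow> idem j \<in> B j"
  and sum_idem: "(\<Sum>j\<in>{1..n}. idem j) = 1"
proof -
  have "\<exists>f. f \<in> (\<Pi>\<^sub>E i\<in>{1..n}. B i) \<and> 1 = (\<Sum>i\<in>{1..n}. f i)"
    using decomp unfolding direct_sum_decomp_def by blast
  then have "\<exists>f. (\<forall>j\<in>{1..n}. f j \<in> B j) \<and> (\<Sum>j\<in>{1..n}. f j) = 1"
    by (metis PiE_mem)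
  from someI_ex[OF this] show "j \<in> {1..n} \<Longrightarrow> idem j \<in> B j" "(\<Sum>j\<in>{1..n}. idem j) = 1"
    unfolding idem_def by blast+
qed

text \<open>
  Both sides are decompositions of \<open>a = a \<cdot> 1\<close> into components from the \<open>B k\<close>.
\<close>

lemma B_times_idem:
  assumes "a \<in> B j" "j \<in> {1..n}" "k \<in> {1..n}"
  shows "a * idem k = (if k = j then a else 0)"
proof (rule B_sum_unique[of "\<lambda>k. a * idem k" "\<lambda>k. if k = j then a else 0"])
  show "(\<Sum>k\<in>{1..n}. a * idem k) = (\<Sum>k\<in>{1..n}. if k = j then a else 0)"
    using assms(2) by (simp add: sum_idem flip: sum_distrib_left)
  show "(if k = j then a else 0) \<in> B k" if "k \<in> {1..n}" for k
    using assms(1) subspace_0[OF B_subspace[OF that]] by simp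
qed (use assms idem_in_B left_ideal in auto)

lemma idem_times_idem:
  "j \<in> {1..n} \<Longrightarrow> k \<in> {1..n} \<Longrightarrow> idem j * idem k = (if k = j then idem j else 0)"
  by (rule B_times_idem) (auto intro: idem_in_B)

lemma B_components:
  assumes "a \<in> B j" "j \<in> {1..n}"
  obtains f where "\<And>i. i \<in> {1..n} \<Longrightarrow> f i \<in> BB i j" "a = (\<Sum>i\<in>{1..n}. f i)"
proof -
  have "\<exists>f. f \<in> (\<Pi>\<^sub>E i\<in>{1..n}. BB i j) \<and> a = (\<Sum>i\<in>{1..n}. f i)"
    using decomp_B[OF assms(2)] assms(1) unfolding direct_sum_decomp_def by blast
  then show ?thesis using that by (metis PiE_mem)
qed

text \<open>
  Let \<open>f i\<close> be the component of \<open>e\<^sub>j\<close> in \<open>BB i j\<close>.  For \<open>i \<noteq> j\<close> it is annihilated from the left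
  by every \<open>B k\<close>: for \<open>k \<noteq> i\<close> by the multiplication rule, and for \<open>k = i\<close> because \<open>a f\<^sub>i = a e\<^sub>j = 0\<close>
  for \<open>a \<in> B i\<close>.
  As \<open>1\<close> is a sum of elements of the \<open>B k\<close>, it vanishes.
\<close>

lemma idem_in_BB: assumes j: "j \<in> {1..n}" shows "idem j \<in> BB j j"
proof -
  obtain f where f: "\<And>i. i \<in> {1..n} \<Longrightarrow> f i \<in> BB i j" and sum: "idem j = (\<Sum>i\<in>{1..n}. f i)"
    using B_components[OF idem_in_B[OF j] j] by blast
  have ann: "a * f i = 0" if i: "i \<in> {1..n}" "i \<noteq> j" and k: "k \<in> {1..n}" and a: "a \<in> B k" for a i k
  proof -
    obtain g where g: "\<And>i. i \<in> {1..n} \<Longrightarrow> g i \<in> BB i k" "a = (\<Sum>i\<in>{1..n}. g i)"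
      using B_components[OF a k] by blast
    have *: "g l * f i' = 0" if "l \<in> {1..n}" "i' \<in> {1..n}" "k \<noteq> i'" for l i'
      by (rule BB_mult[of l k i' j]) (use that k j g(1) f in auto)
    show ?thesis
    proof (cases "k = i")
      case False
      then show ?thesis unfolding g(2) sum_distrib_right using * i by (intro sum.neutral) auto
    next
      case True
      have "a * idem j = a * f i"
      proof -
        have "a * idem j = (\<Sum>i'\<in>{1..n}. a * f i')"
          by (simp add: sum sum_distrib_left)
        also have "\<dots> = (\<Sum>i'\<in>{1..n}. if i' = i then a * f i else 0)"
        proof (intro sum.cong refl)
          fix i' assume i': "i' \<in> {1..n}"
          show "a * f i' = (if i' = i then a * f i else 0)"
          proof (cases "i' = i")
            case False
            then have "a * f i' = 0"
              unfolding g(2) sum_distrib_right using * i' True by (intro sum.neutral) auto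
            then show ?thesis using False by simp
          qed simp
        qed
        also have "\<dots> = a * f i" using i by simp
        finally show ?thesis .
      qed
      moreover have "a * idem j = 0"
        using B_times_idem[OF a k j] True i by simp
      ultimately show ?thesis by simp
    qed
  qed
  have "f i = 0" if i: "i \<in> {1..n}" "i \<noteq> j" for i
  proof -
    have "1 * f i = (\<Sum>k\<in>{1..n}. idem k * f i)"
      by (simp only: sum_idem[symmetric] sum_distrib_right)
    also have "\<dots> = 0"
      using ann[OF i] idem_in_B by (intro sum.neutral) blast
    finally show ?thesis by simp
  qed
  then have "idem j = (\<Sum>i\<in>{1..n}. if i = j then f j else 0)"
    unfolding sum by (intro sum.cong) auto
  then have "idem j = f j" using j by simp
  then show ?thesis using f[OF j] by simp
qed

lemma BB_times_idem:
  assumes "a \<in> BB i j" "i \<in> {1..n}" "j \<in> {1..n}" "k \<in> {1..n}"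
  shows "a * idem k = (if k = j then a else 0)"
  using B_times_idem[of a j k] BB_subset_B[of i j] assms by blast

lemma idem_times_BB:
  assumes a: "a \<in> BB i j" and "i \<in> {1..n}" "j \<in> {1..n}" "k \<in> {1..n}"
  shows "idem k * a = (if k = i then a else 0)"
proof -
  have 0: "idem k * a = 0" if "k \<in> {1..n}" "k \<noteq> i" for k
    using BB_mult[of k k i j "idem k" a] idem_in_BB assms that by blast
  have "a = (\<Sum>k\<in>{1..n}. idem k * a)"
    by (simp only: sum_distrib_right[symmetric] sum_idem mult_1_left)
  also have "\<dots> = (\<Sum>k\<in>{1..n}. if k = i then idem i * a else 0)"
    using 0 by (intro sum.cong) auto
  also have "\<dots> = idem i * a" using assms by simp
  finally show ?thesis using 0 assms by auto
qed

text \<open>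
  Together with the two preceding lemmas this is the Peirce decomposition \<open>BB i j = e\<^sub>i \<A> e\<^sub>j\<close>.
\<close>

lemma idem_times_times_idem:
  assumes i: "i \<in> {1..n}" and j: "j \<in> {1..n}"
  shows "idem i * a * idem j \<in> BB i j"
proof -
  have "a * idem j \<in> B j" using left_ideal idem_in_B j by blast
  then obtain f where f: "\<And>l. l \<in> {1..n} \<Longrightarrow> f l \<in> BB l j" "a * idem j = (\<Sum>l\<in>{1..n}. f l)"
    using B_components j by blast
  have "idem i * a * idem j = (\<Sum>l\<in>{1..n}. idem i * f l)"
    by (simp add: mult.assoc f(2) sum_distrib_left)
  also have "\<dots> = (\<Sum>l\<in>{1..n}. if l = i then f i else 0)"
    by (intro sum.cong refl) (auto simp: idem_times_BB[OF f(1) _ j i])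
  also have "\<dots> = f i" using i by simp
  finally show ?thesis using f(1) i by simp
qed

lemma sum_idem_components:
  "a = (\<Sum>i\<in>{1..n}. \<Sum>j\<in>{1..n}. idem i * a * idem j)"
proof -
  have "(\<Sum>i\<in>{1..n}. \<Sum>j\<in>{1..n}. idem i * a * idem j) =
      (\<Sum>i\<in>{1..n}. idem i) * a * (\<Sum>j\<in>{1..n}. idem j)"
    unfolding sum_distrib_right by (simp add: sum_distrib_left)
  then show ?thesis by (simp add: sum_idem)
qed

lemma perm_in: "j \<in> {1..n} \<Longrightarrow> \<pi> j \<in> {1..n}"
  using permutes_in_image[OF perm] by blast

lemma sum_perm: "(\<Sum>j\<in>{1..n}. f (\<pi> j)) = (\<Sum>j\<in>{1..n}. f j)"
  using sum.permute[OF perm, of f] by (simp add: comp_def)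

text \<open>
  The elements \<open>\<tau> e\<^sub>j \<in> BB (\<pi> j) (\<pi> j)\<close> also add up to \<open>1\<close>, and components are unique.
\<close>

lemma tau_idem:
  assumes "j \<in> {1..n}" shows "\<tau> (idem j) = idem (\<pi> j)"
proof -
  let ?f = "\<lambda>j. \<tau> (idem (inv \<pi> j))"
  have inv: "inv \<pi> j \<in> {1..n} \<and> \<pi> (inv \<pi> j) = j" if "j \<in> {1..n}" for j
    using permutes_in_image[OF permutes_inv[OF perm]] permutes_inverses[OF perm] that by metis
  have "?f j \<in> B j" if "j \<in> {1..n}" for j
    using tau_BB[OF _ _ idem_in_BB] inv[OF that] BB_subset_B[OF that that] by (metis in_mono)
  moreover have "(\<Sum>j\<in>{1..n}. ?f j) = (\<Sum>j\<in>{1..n}. idem j)"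
  proof -
    have "(\<Sum>j\<in>{1..n}. ?f j) = (\<Sum>j\<in>{1..n}. ?f (\<pi> j))"
      by (rule sum_perm[symmetric])
    also have "\<dots> = \<tau> (\<Sum>j\<in>{1..n}. idem j)"
      by (simp add: tau.sum permutes_inverses[OF perm])
    finally show ?thesis by (simp add: sum_idem tau_one)
  qed
  ultimately have "?f (\<pi> j) = idem (\<pi> j)"
    using B_sum_unique[of ?f idem "\<pi> j"] idem_in_B perm_in[OF assms] by blast
  then show ?thesis by (simp add: permutes_inverses[OF perm])
qed

subsection \<open>The transpose of a band matrix\<close>

text \<open>
  The formal adjoint of a differential operator, with coefficients transformed by \<open>\<tau>\<close>, read off on
  matrices: with respect to the residue pairing \<open>res (f g)\<close>, the dual of \<open>t\<^sup>k\<close> is \<open>t\<^bsup>-k-1\<^esup>\<close>.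
\<close>

lift_definition star :: "'a band \<Rightarrow> 'a band" is "\<lambda>M p q. \<tau> (M (- q - 1) (- p - 1))"
proof -
  fix M :: "int \<Rightarrow> int \<Rightarrow> 'a"
  assume "\<exists>b. \<forall>p q. M p q \<noteq> 0 \<longrightarrow> \<bar>p - q\<bar> \<le> b"
  then obtain b where b: "\<And>p q. M p q \<noteq> 0 \<Longrightarrow> \<bar>p - q\<bar> \<le> b" by blast
  have "\<bar>p - q\<bar> \<le> b" if "\<tau> (M (- q - 1) (- p - 1)) \<noteq> 0" for p q
  proof -
    have "M (- q - 1) (- p - 1) \<noteq> 0" using that tau.zero by metis
    from b[OF this] show ?thesis by simp
  qed
  then show "\<exists>b. \<forall>p q. \<tau> (M (- q - 1) (- p - 1)) \<noteq> 0 \<longrightarrow> \<bar>p - q\<bar> \<le> b" by blast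
qed

lemma ent_star: "ent (star M) p q = \<tau> (ent M (- q - 1) (- p - 1))"
  by transfer simp

lemma tau_eq_0_iff [simp]: "\<tau> a = 0 \<longleftrightarrow> a = 0"
  by (metis tau_tau tau.zero)

lemma star_star [simp]: "star (star M) = M"
  by (rule band_eqI) (simp add: ent_star tau_tau)

lemma star_add: "star (M + N) = star M + star N"
  and star_diff: "star (M - N) = star M - star N"
  and star_0: "star 0 = 0"
  and star_minus: "star (- M) = - star M"
  by (rule band_eqI, simp add: ent_star tau.add tau.diff tau.neg)+

lemma star_sum: "star (\<Sum>i\<in>I. M i) = (\<Sum>i\<in>I. star (M i))"
  by (induction I rule: infinite_finite_induct) (simp_all add: star_0 star_add)

lemma star_sign: "star ((-1) ^ k * M) = (-1) ^ k * star M"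
  by (cases "even k") (auto simp: star_minus)

lemma star_times: "star (M * N) = star N * star M"
proof (rule band_eqI)
  fix p r
  let ?S = "{q. ent M (- r - 1) q \<noteq> 0}"
  have "ent (star N * star M) p r = (\<Sum>q\<in>(\<lambda>q. - q - 1) ` ?S. ent (star N) p q * ent (star M) q r)"
  proof (rule ent_times_superset)
    fix q assume "ent (star M) q r \<noteq> 0"
    then have "- q - 1 \<in> ?S" by (simp add: ent_star)
    then show "q \<in> (\<lambda>q. - q - 1) ` ?S" by (rule rev_image_eqI) simp
  qed (simp add: finite_row)
  also have "\<dots> = (\<Sum>q\<in>?S. \<tau> (ent N q (- p - 1)) * \<tau> (ent M (- r - 1) q))"
    by (subst sum.reindex) (auto simp: inj_on_def ent_star)
  also have "\<dots> = ent (star (M * N)) p r"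
    by (simp add: ent_star times_band.rep_eq tau.sum tau_mult)
  finally show "ent (star (M * N)) p r = ent (star N * star M) p r" by simp
qed

text \<open>
  Products of these matrices with the weight \<open>L\<close> below make up both twisted subalgebras.
\<close>

definition skew :: "'a band \<Rightarrow> bool" where
  "skew Y \<longleftrightarrow> star Y = - ((-1) ^ \<epsilon> * Y)"

lemma sign_cancel: "(-1) ^ \<epsilon> * ((-1) ^ \<epsilon> * (x :: 'b::ring_1)) = x"
  by (cases "even \<epsilon>") auto

lemma skew_0: "skew 0"
  by (simp add: skew_def star_0)

lemma skew_add: "skew Y \<Longrightarrow> skew Z \<Longrightarrow> skew (Y + Z)"
  by (simp add: skew_def star_add algebra_simps)

lemma skew_diff: "skew Y \<Longrightarrow> skew Z \<Longrightarrow> skew (Y - Z)"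
  by (simp add: skew_def star_diff algebra_simps)

lemma skew_skew_part: "skew (X - (-1) ^ \<epsilon> * star X)"
  by (simp add: skew_def star_diff star_sign right_diff_distrib sign_cancel)

lemma skew_double: "skew Y \<Longrightarrow> Y + Y = Y - (-1) ^ \<epsilon> * star Y"
  by (simp add: skew_def sign_cancel)

lemma skew_trunc: "skew Y \<Longrightarrow> skew (trunc K Y)"
proof -
  assume Y: "skew Y"
  have "star (trunc K Y) = trunc K (star Y)"
    by (rule band_eqI) (auto simp: ent_star ent_trunc)
  then show ?thesis
    using Y by (simp add: skew_def) (rule band_eqI, simp add: ent_trunc ent_sign_times)
qed

subsection \<open>The weight matrix\<close>

text \<open>
  The matrix of the operator \<open>L = (\<Sum>j. e\<^sub>j \<otimes> \<partial>\<^bsup>\<ell>\<^sub>j\<^esup>)\<close>.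
\<close>

lift_definition weight :: "'a band" is
  "\<lambda>q k. \<Sum>j\<in>{1..n}. if k - q = int (ell j) then scale (ffact (of_int k) (ell j)) (idem j) else 0"
proof -
  let ?W = "\<lambda>q k. \<Sum>j\<in>{1..n}. if k - q = int (ell j) then scale (ffact (of_int k) (ell j)) (idem j) else 0"
  have "\<bar>q - k\<bar> \<le> int (Max (ell ` {1..n}))" if nz: "?W q k \<noteq> 0" for q k
  proof -
    obtain j where "j \<in> {1..n}" "k - q = int (ell j)"
      using nz by (elim sum.not_neutral_contains_not_neutral) (auto split: if_splits)
    moreover from this have "ell j \<le> Max (ell ` {1..n})" by simp
    ultimately show ?thesis by simp
  qed
  then show "\<exists>b. \<forall>q k. ?W q k \<noteq> 0 \<longrightarrow> \<bar>q - k\<bar> \<le> b" by blast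
qed

lemma ent_weight: "ent weight q k =
    (\<Sum>j\<in>{1..n}. if k - q = int (ell j) then scale (ffact (of_int k) (ell j)) (idem j) else 0)"
  by transfer simp

lemma sign_ell: assumes "j \<in> {1..n}" shows "(-1) ^ ell j = ((-1) ^ \<epsilon> :: 'b::ring_1)"
proof -
  have "even (ell j) \<longleftrightarrow> even \<epsilon>"
    using ell_parity[OF assms] by presburger
  then show ?thesis by (simp add: minus_one_power_iff)
qed

lemma scale_sign: "scale ((-1) ^ k * c) a = (-1) ^ k * scale c a"
  by (cases "even k") auto

text \<open>
  Since \<open>(\<partial>\<^bsup>l\<^esup>)\<^sup>* = (-1)\<^sup>l \<partial>\<^bsup>l\<^esup>\<close>, this combines the parity of the \<open>ell j\<close> with their invariance
  under \<open>\<pi>\<close>.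
\<close>

lemma star_weight: "star weight = (-1) ^ \<epsilon> * weight"
proof (rule band_eqI)
  fix q k
  have "ent (star weight) q k = (\<Sum>j\<in>{1..n}. if k - q = int (ell j)
      then scale (ffact (of_int (- q - 1)) (ell j)) (idem (\<pi> j)) else 0)"
    unfolding ent_star ent_weight tau.sum
    by (intro sum.cong refl) (auto simp: tau.scale tau_idem)
  also have "\<dots> = (\<Sum>j\<in>{1..n}. if k - q = int (ell (\<pi> j))
      then (-1) ^ \<epsilon> * scale (ffact (of_int k) (ell (\<pi> j))) (idem (\<pi> j)) else 0)"
  proof (intro sum.cong refl)
    fix j assume j: "j \<in> {1..n}"
    show "(if k - q = int (ell j) then scale (ffact (of_int (- q - 1)) (ell j)) (idem (\<pi> j)) else 0) =
      (if k - q = int (ell (\<pi> j)) then (-1) ^ \<epsilon> * scale (ffact (of_int k) (ell (\<pi> j))) (idem (\<pi> j)) else 0)"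
    proof (cases "k - q = int (ell j)")
      case True
      then have "k = q + int (ell j)" by simp
      then have "ffact (of_int (- q - 1)) (ell j) = ((-1) ^ \<epsilon> * ffact (of_int k) (ell j) :: complex)"
        using ffact_reflect[of "of_int q :: complex" "ell j"] by (simp add: sign_ell[OF j])
      then show ?thesis using True by (simp add: ell_perm[OF j] scale_sign)
    qed (simp add: ell_perm[OF j])
  qed
  also have "\<dots> = (\<Sum>j\<in>{1..n}. if k - q = int (ell j)
      then (-1) ^ \<epsilon> * scale (ffact (of_int k) (ell j)) (idem j) else 0)"
    by (rule sum_perm)
  also have "\<dots> = ent ((-1) ^ \<epsilon> * weight) q k"
    unfolding ent_sign_times ent_weight sum_distrib_left by (intro sum.cong) auto
  finally show "ent (star weight) q k = ent ((-1) ^ \<epsilon> * weight) q k" .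
qed

text \<open>
  The sign of \<open>L\<^sup>*\<close> is what makes the space of skew matrices closed under \<open>Y, Z \<mapsto> Y L Z - Z L Y\<close>.
\<close>

lemma skew_commutator:
  assumes "skew Y" "skew Z"
  shows "skew (Y * weight * Z - Z * weight * Y)"
  using assms unfolding skew_def star_diff star_times star_weight
  by (cases "even \<epsilon>") (simp_all add: mult.assoc)

lemma ent_times_weight:
  "ent (M * weight) p k =
    (\<Sum>j\<in>{1..n}. scale (ffact (of_int k) (ell j)) (ent M p (k - int (ell j)) * idem j))"
proof -
  let ?S = "(\<lambda>j. k - int (ell j)) ` {1..n}"
  have "ent (M * weight) p k = (\<Sum>q\<in>?S. ent M p q * ent weight q k)"
  proof (rule ent_times_superset)
    fix q assume "ent weight q k \<noteq> 0"
    then obtain j where "j \<in> {1..n}" "k - q = int (ell j)"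
      unfolding ent_weight by (elim sum.not_neutral_contains_not_neutral) (auto split: if_splits)
    then show "q \<in> ?S" by (intro image_eqI[of _ _ j]) auto
  qed simp
  also have "\<dots> = (\<Sum>q\<in>?S. \<Sum>j\<in>{1..n}. if q = k - int (ell j)
      then scale (ffact (of_int k) (ell j)) (ent M p q * idem j) else 0)"
    unfolding ent_weight sum_distrib_left
    by (intro sum.cong refl) (auto simp: scale_mult_right)
  also have "\<dots> = (\<Sum>j\<in>{1..n}. \<Sum>q\<in>?S. if q = k - int (ell j)
      then scale (ffact (of_int k) (ell j)) (ent M p q * idem j) else 0)"
    by (rule sum.swap)
  also have "\<dots> = (\<Sum>j\<in>{1..n}. scale (ffact (of_int k) (ell j)) (ent M p (k - int (ell j)) * idem j))"
    by (intro sum.cong refl) (simp add: sum.delta)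
  finally show ?thesis .
qed

lemma ent_times_weight_idem:
  assumes "j \<in> {1..n}"
  shows "ent (M * weight) p k * idem j =
    scale (ffact (of_int k) (ell j)) (ent M p (k - int (ell j)) * idem j)"
proof -
  have "ent (M * weight) p k * idem j =
     (\<Sum>i\<in>{1..n}. if i = j then scale (ffact (of_int k) (ell j)) (ent M p (k - int (ell j)) * idem j) else 0)"
    unfolding ent_times_weight sum_distrib_right
    by (intro sum.cong refl) (auto simp: scale_mult_left mult.assoc idem_times_idem[OF _ assms])
  then show ?thesis using assms by simp
qed

lemma BB_times_weight:
  assumes "i \<in> {1..n}" "j \<in> {1..n}" and a: "\<And>q. ent M p q \<in> BB i j"
  shows "ent (M * weight) p k = scale (ffact (of_int k) (ell j)) (ent M p (k - int (ell j)))"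
proof -
  have "ent (M * weight) p k =
      (\<Sum>l\<in>{1..n}. if l = j then scale (ffact (of_int k) (ell j)) (ent M p (k - int (ell j))) else 0)"
    unfolding ent_times_weight
    by (intro sum.cong refl) (auto simp: BB_times_idem[OF a assms(1,2)])
  then show ?thesis using assms by simp
qed

end

section \<open>Differential operators as band matrices\<close>

text \<open>
  The coefficient of \<open>t\<^sup>p\<close> in \<open>t\<^sup>i \<partial>\<^sup>j t\<^sup>k\<close> for \<open>\<kappa> = (i, j)\<close>.
\<close>

definition mono_ent :: "int \<times> nat \<Rightarrow> int \<Rightarrow> int \<Rightarrow> complex" where
  "mono_ent \<kappa> p k = (if p = k + fst \<kappa> - int (snd \<kappa>) then ffact (of_int k) (snd \<kappa>) else 0)"

lemma lookup_dact_single_one: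
  "lookup (dact D (single k 1)) p =
     (\<Sum>\<kappa>\<in>keys D. lookup D \<kappa> * mono_ent \<kappa> p k)"
proof -
  have "dact D (single k 1) = (\<Sum>q\<in>keys D.
      single (k + fst q - int (snd q)) (lookup D q * ffact (of_int k) (snd q)))"
    by (subst dact_cong_supersets[of "keys D" _ "{k}"]) auto
  then show ?thesis
    unfolding mono_ent_def by (simp add: lookup_sum lookup_single when_def) (intro sum.cong, auto)
qed

lemma sum_choose_convolution:
  "(\<Sum>m<d. (m + a choose a) * (d - Suc m choose b)) = (d + a choose (a + b + 1))"
proof (induction d arbitrary: b)
  case (Suc d)
  have "(\<Sum>m<Suc d. (m + a choose a) * (Suc d - Suc m choose b)) =
      (\<Sum>m<d. (m + a choose a) * (d - m choose b)) + (d + a choose a) * (0 choose b)"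
    by simp
  also have "\<dots> = (Suc d + a choose (a + b + 1))"
  proof (cases b)
    case 0
    then have "(\<Sum>m<d. (m + a choose a) * (d - m choose b)) = (\<Sum>m<d. (m + a choose a) * (d - Suc m choose 0))"
      by simp
    also have "\<dots> = (d + a choose (a + 1))" using Suc[of 0] by simp
    finally have "(\<Sum>m<d. (m + a choose a) * (d - m choose b)) = (d + a choose (a + 1))" .
    moreover have "(Suc d + a choose (a + 1)) = (d + a choose a) + (d + a choose (a + 1))"
      unfolding Suc_eq_plus1[of a, symmetric] add_Suc by (rule binomial_Suc_Suc)
    ultimately show ?thesis using 0 by simp
  next
    case (Suc b')
    have "(\<Sum>m<d. (m + a choose a) * (d - m choose b)) =
       (\<Sum>m<d. (m + a choose a) * (d - Suc m choose b') + (m + a choose a) * (d - Suc m choose Suc b'))"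
    proof (intro sum.cong refl)
      fix m assume "m \<in> {..<d}"
      then have "d - m = Suc (d - Suc m)" by auto
      then show "(m + a choose a) * (d - m choose b) =
        (m + a choose a) * (d - Suc m choose b') + (m + a choose a) * (d - Suc m choose Suc b')"
        by (simp add: Suc algebra_simps)
    qed
    then show ?thesis
      using Suc.IH[of b'] Suc.IH[of "Suc b'"] Suc by (simp add: sum.distrib)
  qed
  finally show ?case .
qed simp

lemma ffact_of_nat: "ffact (of_nat m) r = (fact r * of_nat (m choose r) :: 'b::field_char_0)"
  by (simp add: ffact_conv_gbinomial binomial_gbinomial)

lemma ffact_neg_Suc: "ffact (- of_nat (Suc m)) r = ((-1) ^ r * fact r * of_nat (m + r choose r) :: 'b::field_char_0)"
  using ffact_reflect[of "of_nat m :: 'b" r] ffact_of_nat[of "m + r" r, where 'b = 'b] by (simp add: algebra_simps minus_diff_commute)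

definition step :: "int \<Rightarrow> int \<Rightarrow> complex" where
  "step \<iota> p = (if p \<ge> \<iota> then 1 else 0)"

text \<open>
  The central term of the bracket of two differential monomials of opposite degree \<open>d\<close> and \<open>-d\<close>.
  The factor \<open>step 0 (k + d) - step 0 k\<close> restricts the sum to \<open>-d \<le> k < 0\<close> if \<open>d \<ge> 0\<close> and, with the
  opposite sign, to \<open>0 \<le> k < -d\<close> if \<open>d < 0\<close>.  In both cases one of the falling factorials is taken at
  nonnegative and the other one at negative integers, so that the sum becomes a convolution of
  binomial coefficients.
\<close>

lemma sum_ffact_step:
  assumes I: "finite I" "{-\<bar>d\<bar>..\<bar>d\<bar>} \<subseteq> I"
  shows "(\<Sum>k\<in>I. (step 0 (k + d) - step 0 k) * (ffact (of_int k) j1 * ffact (of_int (k + d)) j2)) =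
    (-1) ^ j1 * fact j1 * fact j2 * ((of_int d + of_nat j1) gchoose (j1 + j2 + 1))"
    (is "?L = ?R")
proof -
  let ?t = "\<lambda>k. (step 0 (k + d) - step 0 k) * (ffact (of_int k) j1 * ffact (of_int (k + d)) j2) :: complex"
  show ?thesis
  proof (cases "d \<ge> 0")
    case True
    then obtain D where D: "d = int D" using nonneg_int_cases by blast
    have "?L = (\<Sum>k\<in>(\<lambda>m. - int (Suc m)) ` {..<D}. ?t k)"
    proof (rule sum.mono_neutral_right[OF I(1)])
      have "- int (Suc m) \<in> {-\<bar>d\<bar>..\<bar>d\<bar>}" if "m < D" for m using D that by simp
      then show "(\<lambda>m. - int (Suc m)) ` {..<D} \<subseteq> I" using I(2) by blast
      show "\<forall>k\<in>I - (\<lambda>m. - int (Suc m)) ` {..<D}. ?t k = 0"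
      proof
        fix k assume k: "k \<in> I - (\<lambda>m. - int (Suc m)) ` {..<D}"
        have "\<not> (k < 0 \<and> k + d \<ge> 0)"
        proof
          assume a: "k < 0 \<and> k + d \<ge> 0"
          then have "k = - int (Suc (nat (- k - 1)))" "nat (- k - 1) < D" using D by auto
          then show False using k by blast
        qed
        then show "?t k = 0"
          using True by (auto simp: step_def)
      qed
    qed
    also have "\<dots> = (\<Sum>m<D. ffact (- of_nat (Suc m)) j1 * ffact (of_nat (D - Suc m)) j2)"
    proof (subst sum.reindex)
      show "inj_on (\<lambda>m. - int (Suc m)) {..<D}" by (simp add: inj_on_def)
      have "(step 0 (- int (Suc m) + d) - step 0 (- int (Suc m))) *
          (ffact (of_int (- int (Suc m))) j1 * ffact (of_int (- int (Suc m) + d)) j2) =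
          ffact (- of_nat (Suc m)) j1 * ffact (of_nat (D - Suc m)) j2" if "m < D" for m
      proof -
        have e: "- int (Suc m) + d = int (D - Suc m)" using that D by simp
        show ?thesis unfolding e by (simp add: step_def)
      qed
      then show "sum (?t \<circ>
          (\<lambda>m. - int (Suc m))) {..<D} = (\<Sum>m<D. ffact (- of_nat (Suc m)) j1 * ffact (of_nat (D - Suc m)) j2)"
        by (intro sum.cong) (simp_all only: comp_def lessThan_iff)
    qed
    also have "\<dots> = (\<Sum>m<D. (-1) ^ j1 * fact j1 * fact j2 * of_nat ((m + j1 choose j1) * (D - Suc m choose j2)))"
      unfolding ffact_neg_Suc ffact_of_nat by (intro sum.cong) simp_all
    also have "\<dots> = (-1) ^ j1 * fact j1 * fact j2 * of_nat (D + j1 choose (j1 + j2 + 1))"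
      by (simp only: sum_distrib_left[symmetric] of_nat_sum[symmetric] sum_choose_convolution)
    finally show ?thesis by (simp add: D binomial_gbinomial)
  next
    case False
    then obtain D where D: "d = - int D" by (metis int_cases2 of_nat_0_le_iff)
    have "?L = (\<Sum>k\<in>(\<lambda>m. int D - int (Suc m)) ` {..<D}. ?t k)"
    proof (rule sum.mono_neutral_right[OF I(1)])
      have "int D - int (Suc m) \<in> {-\<bar>d\<bar>..\<bar>d\<bar>}" if "m < D" for m using D that by simp
      then show "(\<lambda>m. int D - int (Suc m)) ` {..<D} \<subseteq> I" using I(2) by blast
      show "\<forall>k\<in>I - (\<lambda>m. int D - int (Suc m)) ` {..<D}. ?t k = 0"
      proof
        fix k assume k: "k \<in> I - (\<lambda>m. int D - int (Suc m)) ` {..<D}"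
        have "\<not> (k \<ge> 0 \<and> k + d < 0)"
        proof
          assume a: "k \<ge> 0 \<and> k + d < 0"
          then have "k = int D - int (Suc (nat (int D - k - 1)))" "nat (int D - k - 1) < D" using D by auto
          then show False using k by blast
        qed
        then show "?t k = 0"
          using False by (auto simp: step_def)
      qed
    qed
    also have "\<dots> = (\<Sum>m<D. - (ffact (- of_nat (Suc m)) j2 * ffact (of_nat (D - Suc m)) j1))"
    proof (subst sum.reindex)
      show "inj_on (\<lambda>m. int D - int (Suc m)) {..<D}" by (simp add: inj_on_def)
      have "(step 0 (int D - int (Suc m) + d) - step 0 (int D - int (Suc m))) *
          (ffact (of_int (int D - int (Suc m))) j1 * ffact (of_int (int D - int (Suc m) + d)) j2) =
          - (ffact (- of_nat (Suc m)) j2 * ffact (of_nat (D - Suc m)) j1)" if "m < D" for m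
      proof -
        have e: "int D - int (Suc m) = int (D - Suc m)" "int (D - Suc m) + d = - int (Suc m)" using that D by simp_all
        show ?thesis unfolding e by (simp add: step_def mult.commute)
      qed
      then show "sum (?t \<circ>
          (\<lambda>m. int D - int (Suc m))) {..<D} = (\<Sum>m<D. - (ffact (- of_nat (Suc m)) j2 * ffact (of_nat (D - Suc m)) j1))"
        by (intro sum.cong) (simp_all only: comp_def lessThan_iff)
    qed
    also have "\<dots> = (\<Sum>m<D. - ((-1) ^ j2 * fact j1 * fact j2) * of_nat ((m + j2 choose j2) * (D - Suc m choose j1)))"
      unfolding ffact_neg_Suc ffact_of_nat by (intro sum.cong) simp_all
    also have "\<dots> = - ((-1) ^ j2 * fact j1 * fact j2) * of_nat (D + j2 choose (j2 + j1 + 1))"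
      by (simp only: sum_distrib_left[symmetric] of_nat_sum[symmetric] sum_choose_convolution)
    also have "of_nat (D + j2 choose (j2 + j1 + 1)) =
        (-1) ^ (j1 + j2 + 1) * ((of_int d + of_nat j1 :: complex) gchoose (j1 + j2 + 1))"
      by (subst gbinomial_negated_upper) (simp add: D binomial_gbinomial algebra_simps power_add)
    also have "- ((-1) ^ j2 * fact j1 * fact j2) * ((-1) ^ (j1 + j2 + 1) * ((of_int d + of_nat j1 :: complex) gchoose (j1 + j2 + 1))) = ?R"
      by (cases "even j1"; cases "even j2") (simp_all add: power_add)
    finally show ?thesis .
  qed
qed

context tau_setting
begin

definition mat :: "(int \<times> nat \<Rightarrow>\<^sub>0 'a) \<Rightarrow> 'a band" where
  "mat f = Band (\<lambda>p k. \<Sum>\<kappa>\<in>keys f. scale (mono_ent \<kappa> p k) (lookup f \<kappa>))"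

lemma ent_mat: "ent (mat f) p k = (\<Sum>\<kappa>\<in>keys f. scale (mono_ent \<kappa> p k) (lookup f \<kappa>))"
proof -
  let ?M = "\<lambda>p k. \<Sum>\<kappa>\<in>keys f. scale (mono_ent \<kappa> p k) (lookup f \<kappa>)"
  let ?b = "\<Sum>\<kappa>\<in>keys f. \<bar>fst \<kappa>\<bar> + int (snd \<kappa>)"
  have "\<bar>p - k\<bar> \<le> ?b" if nz: "?M p k \<noteq> 0" for p k
  proof -
    obtain \<kappa> where \<kappa>: "\<kappa> \<in> keys f" "mono_ent \<kappa> p k \<noteq> 0"
      using nz by (elim sum.not_neutral_contains_not_neutral) auto
    then have "\<bar>p - k\<bar> \<le> \<bar>fst \<kappa>\<bar> + int (snd \<kappa>)" by (auto simp: mono_ent_def split: if_splits)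
    also have "\<dots> \<le> ?b" by (rule member_le_sum) (use \<kappa> in auto)
    finally show ?thesis .
  qed
  then have "?M \<in> {M. \<exists>b. \<forall>p q. M p q \<noteq> 0 \<longrightarrow> \<bar>p - q\<bar> \<le> b}" by blast
  then show ?thesis unfolding mat_def by (simp only: Band_inverse)
qed

lemma ent_mat_superset:
  assumes "finite A" "keys f \<subseteq> A"
  shows "ent (mat f) p k = (\<Sum>\<kappa>\<in>A. scale (mono_ent \<kappa> p k) (lookup f \<kappa>))"
  unfolding ent_mat using assms by (intro sum.mono_neutral_left) (auto simp: Poly_Mapping.in_keys_iff)

lemma mat_single: "ent (mat (single \<kappa> a)) p k = scale (mono_ent \<kappa> p k) a"
  by (subst ent_mat_superset[of "{\<kappa>}"]) auto

lemma mat_add: "mat (f + g) = mat f + mat g"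
proof (rule band_eqI)
  fix p k
  let ?A = "keys f \<union> keys g"
  have "ent (mat h) p k = (\<Sum>\<kappa>\<in>?A. scale (mono_ent \<kappa> p k) (lookup h \<kappa>))"
    if "keys h \<subseteq> ?A" for h
    by (rule ent_mat_superset) (use that in auto)
  then show "ent (mat (f + g)) p k = ent (mat f + mat g) p k"
    using Poly_Mapping.keys_add[of f g] by (simp add: lookup_add scale_right_distrib sum.distrib)
qed

lemma mat_0: "mat 0 = 0"
  by (rule band_eqI) (simp add: ent_mat)

lemma mat_minus: "mat (- f) = - mat f"
  using mat_add[of f "- f"] mat_0 by (simp add: eq_neg_iff_add_eq_0 add.commute)

lemma mat_diff: "mat (f - g) = mat f - mat g"
  using mat_add[of f "- g"] by (simp add: mat_minus)

lemma mat_sum: "mat (\<Sum>i\<in>I. f i) = (\<Sum>i\<in>I. mat (f i))"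
  by (induction I rule: infinite_finite_induct) (simp_all add: mat_0 mat_add)

lemma mat_expand: "mat f = (\<Sum>\<kappa>\<in>keys f. mat (single \<kappa> (lookup f \<kappa>)))"
  by (rule band_eqI) (simp only: ent_sum mat_single, rule ent_mat)

text \<open>
  The operator \<open>\<partial>\<^sup>s\<close> kills \<open>t\<^sup>k\<close> for \<open>k < s\<close> and not for \<open>k = s\<close>.  So the coefficients along one diagonal
  can be recovered one after the other by applying the operator to \<open>t\<^sup>0, t\<^sup>1, t\<^sup>2, \<dots>\<close>.
\<close>

lemma mat_eq_0_imp:
  assumes "mat f = 0" shows "f = 0"
proof (rule poly_mapping_eqI)
  fix \<kappa> :: "int \<times> nat"
  define d where "d = fst \<kappa> - int (snd \<kappa>)"
  have "lookup f (d + int s, s) = 0" for s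
  proof (induction s rule: less_induct)
    case (less s)
    have *: "scale (mono_ent \<kappa> (int s + d) (int s)) (lookup f \<kappa>) =
        (if \<kappa> = (d + int s, s) then scale (fact s) (lookup f (d + int s, s)) else 0)" for \<kappa>
    proof (cases "fst \<kappa> - int (snd \<kappa>) = d")
      case True
      then have \<kappa>: "\<kappa> = (d + int (snd \<kappa>), snd \<kappa>)" by (cases \<kappa>) auto
      have "ffact (of_nat s :: complex) (snd \<kappa>) = fact (snd \<kappa>) * of_nat (s choose snd \<kappa>)"
        by (rule ffact_of_nat)
      moreover have "lookup f \<kappa> = 0" if "snd \<kappa> < s"
        using less.IH[OF that] \<kappa> by simp
      moreover have "\<kappa> = (d + int s, s)" if "snd \<kappa> = s"
        using \<kappa> that by simp
      moreover have "\<kappa> \<noteq> (d + int s, s)" if "snd \<kappa> \<noteq> s"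
        using that by auto
      ultimately show ?thesis
        using True by (cases "snd \<kappa>" s rule: linorder_cases) (simp_all add: mono_ent_def)
    qed (auto simp: mono_ent_def)
    have "0 = ent (mat f) (int s + d) (int s)" using assms by simp
    also have "\<dots> = (\<Sum>\<kappa>\<in>keys f. if \<kappa> = (d + int s, s) then scale (fact s) (lookup f (d + int s, s)) else 0)"
      unfolding ent_mat * ..
    also have "\<dots> = scale (fact s) (lookup f (d + int s, s))"
      by (simp add: sum.delta' sum.delta Poly_Mapping.in_keys_iff)
    finally show ?case by simp
  qed
  from this[of "snd \<kappa>"] show "lookup f \<kappa> = lookup 0 \<kappa>"
    by (simp add: d_def)
qed

lemma mat_inject: "mat f = mat g \<Longrightarrow> f = g"
  using mat_eq_0_imp[of "f - g"] by (simp add: mat_diff)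

lemma ent_mat_tens:
  "ent (mat (tens scale a D)) p k = scale (lookup (dact D (single k 1)) p) a"
proof -
  have lk: "lookup (tens scale a D) \<kappa> = scale (lookup D \<kappa>) a" for \<kappa>
    by (simp add: tens_def Poly_Mapping.map.rep_eq when_def)
  have "keys (tens scale a D) \<subseteq> keys D"
    by (auto simp: Poly_Mapping.in_keys_iff lk)
  then have "ent (mat (tens scale a D)) p k =
      (\<Sum>\<kappa>\<in>keys D. scale (mono_ent \<kappa> p k) (scale (lookup D \<kappa>) a))"
    by (subst ent_mat_superset[of "keys D"]) (auto simp: lk)
  then show ?thesis
    by (simp add: lookup_dact_single_one scale_sum_left mult.commute)
qed

lemma tens_dmono: "tens scale a (dmono i j) = single (i, j) a"
  by (rule poly_mapping_eqI) (auto simp: tens_def dmono_def Poly_Mapping.map.rep_eq lookup_single when_def)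

lemma lookup_dact_mult_monos:
  "lookup (dact (dmult (single (i1, j1) c) (single (i2, j2) c')) (single r 1)) p =
     (if r + i2 - int j2 + i1 - int j1 = p
      then c * (c' * 1 * ffact (of_int r) j2) * ffact (of_int (r + i2 - int j2)) j1 else 0)"
  unfolding dact_dmult dact_single lookup_single when_def ..

lemma mat_mono_mult:
  "mat (single p a) * mat (single q b) =
   mat (tens scale (a * b) (dmult (dmono (fst p) (snd p)) (dmono (fst q) (snd q))))"
proof (rule band_eqI)
  fix k r
  obtain i1 j1 i2 j2 where pq: "p = (i1, j1)" "q = (i2, j2)" by (metis surj_pair)
  let ?M = "mat (single p a)" and ?N = "mat (single q b)"
  have M: "ent ?M k l = (if k = l + i1 - int j1 then scale (ffact (of_int l) j1) a else 0)" for k l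
    by (simp add: mat_single mono_ent_def pq)
  have N: "ent ?N k l = (if k = l + i2 - int j2 then scale (ffact (of_int l) j2) b else 0)" for k l
    by (simp add: mat_single mono_ent_def pq)
  have "ent (?M * ?N) k r = (\<Sum>l\<in>{r + i2 - int j2}. ent ?M k l * ent ?N l r)"
  proof (rule ent_times_superset)
    fix l assume "ent ?N l r \<noteq> 0"
    then show "l \<in> {r + i2 - int j2}" unfolding N by (metis singletonI)
  qed simp
  also have "\<dots> = scale (if r + i2 - int j2 + i1 - int j1 = k
      then 1 * (1 * 1 * ffact (of_int r) j2) * ffact (of_int (r + i2 - int j2)) j1 else 0) (a * b)"
    by (auto simp add: M N scale_mult_left scale_mult_right)
  also have "\<dots> = ent (mat (tens scale (a * b) (dmult (dmono (fst p) (snd p)) (dmono (fst q) (snd q))))) k r"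
    unfolding ent_mat_tens dmono_def pq fst_conv snd_conv lookup_dact_mult_monos ..
  finally show "ent (?M * ?N) k r =
      ent (mat (tens scale (a * b) (dmult (dmono (fst p) (snd p)) (dmono (fst q) (snd q))))) k r" .
qed

lemma fst_sum: "fst (\<Sum>i\<in>I. f i) = (\<Sum>i\<in>I. fst (f i))"
  and snd_sum: "snd (\<Sum>i\<in>I. f i) = (\<Sum>i\<in>I. snd (f i))"
  by (induction I rule: infinite_finite_induct) simp_all

lemma mat_hat_basis_bracket:
  "mat (fst (hat_basis_bracket scale tr a p b q)) =
     mat (single p a) * mat (single q b) -
     mat (single q b) * mat (single p a)"
  unfolding mat_mono_mult by (cases p; cases q) (simp add: hat_basis_bracket_def mat_diff)

lemma mat_hat_bracket:
  "mat (fst (hat_bracket scale tr x y)) = mat (fst x) * mat (fst y) - mat (fst y) * mat (fst x)"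
proof -
  let ?X = "keys (fst x)" and ?Y = "keys (fst y)"
  let ?f = "\<lambda>p. mat (single p (lookup (fst x) p))"
  let ?g = "\<lambda>q. mat (single q (lookup (fst y) q))"
  have "mat (fst (hat_bracket scale tr x y)) = (\<Sum>p\<in>?X. \<Sum>q\<in>?Y. ?f p * ?g q - ?g q * ?f p)"
    unfolding hat_bracket_def ext_bracket_def fst_sum mat_sum mat_hat_basis_bracket ..
  also have "\<dots> = (\<Sum>p\<in>?X. \<Sum>q\<in>?Y. ?f p * ?g q) - (\<Sum>p\<in>?X. \<Sum>q\<in>?Y. ?g q * ?f p)"
    by (simp only: sum_subtractf)
  also have "(\<Sum>p\<in>?X. \<Sum>q\<in>?Y. ?g q * ?f p) = (\<Sum>q\<in>?Y. \<Sum>p\<in>?X. ?g q * ?f p)"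
    by (rule sum.swap)
  also have "\<dots> = sum ?g ?Y * sum ?f ?X" by (rule sum_product[symmetric])
  also have "(\<Sum>p\<in>?X. \<Sum>q\<in>?Y. ?f p * ?g q) = sum ?f ?X * sum ?g ?Y" by (rule sum_product[symmetric])
  also have "sum ?f ?X = mat (fst x)" by (rule mat_expand[symmetric])
  also have "sum ?g ?Y = mat (fst y)" by (rule mat_expand[symmetric])
  finally show ?thesis .
qed

section \<open>Cocycles of step functions\<close>

text \<open>
  Since the step function is constant on either side of its jump, a band matrix has only
  finitely many entries that contribute.
\<close>

definition cocycle :: "int \<Rightarrow> 'a band \<Rightarrow> 'a band \<Rightarrow> complex" where
  "cocycle \<iota> M N = (\<Sum>(p, k) | step \<iota> p \<noteq> step \<iota> k \<and> ent M p k \<noteq> 0.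
     (step \<iota> p - step \<iota> k) * tr (ent M p k * ent N k p))"

lemma cocycle_superset:
  assumes S: "finite S" and "\<And>p k. step \<iota> p \<noteq> step \<iota> k \<Longrightarrow> ent M p k \<noteq> 0 \<Longrightarrow> ent N k p \<noteq> 0 \<Longrightarrow> (p, k) \<in> S"
  shows "cocycle \<iota> M N = (\<Sum>(p, k)\<in>S. (step \<iota> p - step \<iota> k) * tr (ent M p k * ent N k p))"
proof -
  let ?A = "{(p, k). step \<iota> p \<noteq> step \<iota> k \<and> ent M p k \<noteq> 0}"
  obtain b where b: "bandwidth b M" using ex_bandwidth by blast
  have "?A \<subseteq> {\<iota> - b..\<iota> + b} \<times> {\<iota> - b..\<iota> + b}"
  proof (rule subrelI)
    fix p k assume "(p, k) \<in> ?A"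
    then have "step \<iota> p \<noteq> step \<iota> k" "\<bar>p - k\<bar> \<le> b" using bandwidthD[OF b] by auto
    then show "(p, k) \<in> {\<iota> - b..\<iota> + b} \<times> {\<iota> - b..\<iota> + b}" by (auto simp: step_def split: if_splits)
  qed
  then have A: "finite ?A" by (rule finite_subset) simp
  have "cocycle \<iota> M N = (\<Sum>(p, k)\<in>?A \<union> S. (step \<iota> p - step \<iota> k) * tr (ent M p k * ent N k p))"
    unfolding cocycle_def using A S by (intro sum.mono_neutral_left) (auto simp: tr.zero)
  also have "\<dots> = (\<Sum>(p, k)\<in>S. (step \<iota> p - step \<iota> k) * tr (ent M p k * ent N k p))"
  proof (intro sum.mono_neutral_right ballI)
    fix z assume z: "z \<in> ?A \<union> S - S"
    obtain p k where pk: "z = (p, k)" by (cases z)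
    have "ent N k p = 0" using z assms(2)[of p k] unfolding pk by auto
    then show "(case z of (p, k) \<Rightarrow> (step \<iota> p - step \<iota> k) * tr (ent M p k * ent N k p)) = 0"
      by (simp add: pk tr.zero)
  qed (use A S in auto)
  finally show ?thesis .
qed

lemma cocycle_box:
  assumes "bandwidth b M" "finite I" "{\<iota> - b..\<iota> + b} \<subseteq> I"
  shows "cocycle \<iota> M N = (\<Sum>p\<in>I. \<Sum>k\<in>I. (step \<iota> p - step \<iota> k) * tr (ent M p k * ent N k p))"
proof -
  have "cocycle \<iota> M N = (\<Sum>(p, k)\<in>I \<times> I. (step \<iota> p - step \<iota> k) * tr (ent M p k * ent N k p))"
  proof (rule cocycle_superset)
    fix p k assume "step \<iota> p \<noteq> step \<iota> k" "ent M p k \<noteq> 0"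
    then have "p \<in> {\<iota> - b..\<iota> + b} \<and> k \<in> {\<iota> - b..\<iota> + b}"
      using bandwidthD[OF assms(1), of p k] by (auto simp: step_def split: if_splits)
    then show "(p, k) \<in> I \<times> I" using assms(3) by blast
  qed (use assms(2) in simp)
  then show ?thesis by (simp add: sum.cartesian_product)
qed

lemma cocycle_add_left: "cocycle \<iota> (M + M') N = cocycle \<iota> M N + cocycle \<iota> M' N"
proof -
  obtain b c where "bandwidth b M" "bandwidth c M'" using ex_bandwidth by blast
  then have *: "bandwidth (max b c) M" "bandwidth (max b c) M'" by (auto elim: bandwidth_mono)
  then have "bandwidth (max b c) (M + M')"
    unfolding bandwidth_def by (metis add.right_neutral ent_add)
  with * show ?thesis
    by (simp add: cocycle_box[of "max b c" _ "{\<iota> - max b c..\<iota> + max b c}"] ring_distribs tr.add sum.distrib)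
qed

lemma cocycle_add_right: "cocycle \<iota> M (N + N') = cocycle \<iota> M N + cocycle \<iota> M N'"
  unfolding cocycle_def by (simp add: ring_distribs tr.add sum.distrib split_beta)

lemma cocycle_0: "cocycle \<iota> 0 N = 0" "cocycle \<iota> M 0 = 0"
  by (simp_all add: cocycle_def tr.zero split_beta)

lemma cocycle_sum_left: "cocycle \<iota> (\<Sum>i\<in>I. M i) N = (\<Sum>i\<in>I. cocycle \<iota> (M i) N)"
  by (induction I rule: infinite_finite_induct) (simp_all add: cocycle_0 cocycle_add_left)

lemma cocycle_sum_right: "cocycle \<iota> M (\<Sum>i\<in>I. N i) = (\<Sum>i\<in>I. cocycle \<iota> M (N i))"
  by (induction I rule: infinite_finite_induct) (simp_all add: cocycle_0 cocycle_add_right)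

text \<open>
  The functional whose coboundary is the difference of two step cocycles.
\<close>

definition shift_trace :: "int \<Rightarrow> 'a band \<Rightarrow> complex" where
  "shift_trace \<iota> M = (\<Sum>k\<in>{-\<bar>\<iota>\<bar>..\<bar>\<iota>\<bar>}. (step \<iota> k - step 0 k) * tr (ent M k k))"

text \<open>
  With \<open>\<delta> = step \<iota> - step 0\<close>, which has finite support, the difference of the cocycles is
  \<open>\<Sum>p k. (\<delta> p - \<delta> k) tr (M\<^bsub>p k\<^esub> N\<^bsub>k p\<^esub>)\<close>.  The two halves can be summed separately, and the
  cyclicity of the trace turns them into \<open>\<Sum>p. \<delta> p tr (M N)\<^bsub>p p\<^esub>\<close> and \<open>\<Sum>k. \<delta> k tr (N M)\<^bsub>k k\<^esub>\<close>.
\<close>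

lemma cocycle_shift: "cocycle \<iota> M N = cocycle 0 M N + shift_trace \<iota> (M * N - N * M)"
proof -
  obtain b where b: "b \<ge> 0" "bandwidth b M" using ex_bandwidth by blast
  let ?J = "{-\<bar>\<iota>\<bar>..\<bar>\<iota>\<bar>}" and ?I = "{-\<bar>\<iota>\<bar>-b..\<bar>\<iota>\<bar>+b}"
  let ?\<delta> = "\<lambda>k. step \<iota> k - step 0 k" and ?t = "\<lambda>p k. tr (ent M p k * ent N k p)"
  have \<delta>: "?\<delta> k = 0" if "k \<notin> ?J" for k using that by (auto simp: step_def)
  have restr: "(\<Sum>k\<in>?I. ?\<delta> k * f k) = (\<Sum>k\<in>?J. ?\<delta> k * f k)" for f :: "int \<Rightarrow> complex"
    by (rule sum.mono_neutral_right) (use b(1) \<delta> in auto)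
  have "cocycle \<iota> M N - cocycle 0 M N = (\<Sum>p\<in>?I. \<Sum>k\<in>?I. (?\<delta> p - ?\<delta> k) * ?t p k)"
  proof -
    have "{\<iota> - b..\<iota> + b} \<subseteq> ?I" "{0 - b..0 + b} \<subseteq> ?I" by auto
    then show ?thesis
      using cocycle_box[OF b(2), of ?I \<iota> N] cocycle_box[OF b(2), of ?I 0 N]
      by (simp only: finite_atLeastAtMost_int sum_subtractf[symmetric] left_diff_distrib[symmetric])
        (simp add: algebra_simps)
  qed
  also have "\<dots> = (\<Sum>p\<in>?I. ?\<delta> p * (\<Sum>k\<in>?I. ?t p k)) - (\<Sum>k\<in>?I. ?\<delta> k * (\<Sum>p\<in>?I. ?t p k))"
    unfolding left_diff_distrib[of "?\<delta> _"] sum_subtractf sum_distrib_left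
    by (subst sum.swap[of "\<lambda>p k. ?\<delta> k * ?t p k"]) (rule refl)
  also have "\<dots> = (\<Sum>p\<in>?J. ?\<delta> p * (\<Sum>k\<in>?I. ?t p k)) - (\<Sum>k\<in>?J. ?\<delta> k * (\<Sum>p\<in>?I. ?t p k))"
    by (simp only: restr)
  also have "\<dots> = (\<Sum>p\<in>?J. ?\<delta> p * tr (ent (M * N) p p)) - (\<Sum>k\<in>?J. ?\<delta> k * tr (ent (N * M) k k))"
  proof -
    have "(\<Sum>k\<in>?I. ?t p k) = tr (ent (M * N) p p)" if "p \<in> ?J" for p
    proof -
      have "ent (M * N) p p = (\<Sum>k\<in>?I. ent M p k * ent N k p)"
      proof (rule ent_times_superset)
        fix k assume "ent M p k \<noteq> 0"
        from bandwidthD[OF b(2) this] show "k \<in> ?I" using that by auto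
      qed simp
      then show ?thesis by (simp add: tr.sum)
    qed
    moreover have "(\<Sum>p\<in>?I. ?t p k) = tr (ent (N * M) k k)" if "k \<in> ?J" for k
    proof -
      have "ent (N * M) k k = (\<Sum>p\<in>?I. ent N k p * ent M p k)"
      proof (rule ent_times_superset)
        fix p assume "ent M p k \<noteq> 0"
        from bandwidthD[OF b(2) this] show "p \<in> ?I" using that by auto
      qed simp
      then show ?thesis by (simp add: tr.sum tr_commute[of "ent N k _"])
    qed
    ultimately show ?thesis by simp
  qed
  also have "\<dots> = shift_trace \<iota> (M * N - N * M)"
    by (simp add: shift_trace_def tr.diff right_diff_distrib sum_subtractf)
  finally show ?thesis by (simp add: algebra_simps)
qed

lemma shift_trace_add: "shift_trace \<iota> (M + N) = shift_trace \<iota> M + shift_trace \<iota> N"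
  and shift_trace_diff: "shift_trace \<iota> (M - N) = shift_trace \<iota> M - shift_trace \<iota> N"
  by (simp_all add: shift_trace_def tr.add tr.diff ring_distribs sum.distrib sum_subtractf right_diff_distrib)

lemma cocycle_monos:
  "cocycle 0 (mat (single (i1, j1) a)) (mat (single (i2, j2) b)) =
    (if i1 + i2 = int j1 + int j2
     then (-1) ^ j1 * fact j1 * fact j2 * (of_int i1 gchoose (j1 + j2 + 1)) * tr (a * b) else 0)"
proof -
  let ?d = "i1 - int j1"
  let ?I = "{-\<bar>?d\<bar>-\<bar>?d\<bar>..\<bar>?d\<bar>+\<bar>?d\<bar>}"
  let ?S = "(\<lambda>k. (k + ?d, k)) ` {-\<bar>?d\<bar>..\<bar>?d\<bar>}"
  let ?M = "mat (single (i1, j1) a)" and ?N = "mat (single (i2, j2) b)"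
  have "cocycle 0 ?M ?N = (\<Sum>(p, k)\<in>?S. (step 0 p - step 0 k) * tr (ent ?M p k * ent ?N k p))"
  proof (rule cocycle_superset)
    fix p k assume *: "step 0 p \<noteq> step 0 k" "ent ?M p k \<noteq> 0"
    then have "p = k + ?d" by (auto simp: mat_single mono_ent_def split: if_splits)
    moreover have "k \<in> {-\<bar>?d\<bar>..\<bar>?d\<bar>}" using *(1) calculation by (auto simp: step_def split: if_splits)
    ultimately show "(p, k) \<in> ?S" by blast
  qed simp
  also have "\<dots> = (\<Sum>k\<in>{-\<bar>?d\<bar>..\<bar>?d\<bar>}. (step 0 (k + ?d) - step 0 k) * tr (ent ?M (k + ?d) k * ent ?N k (k + ?d)))"
    by (subst sum.reindex) (auto simp: inj_on_def)
  also have "\<dots> = (if i1 + i2 = int j1 + int j2 then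
      (\<Sum>k\<in>{-\<bar>?d\<bar>..\<bar>?d\<bar>}. (step 0 (k + ?d) - step 0 k) * (ffact (of_int k) j1 * ffact (of_int (k + ?d)) j2)) * tr (a * b) else 0)"
  proof -
    have M: "ent ?M (k + ?d) k = scale (ffact (of_int k) j1) a" for k
      by (simp add: mat_single mono_ent_def)
    have N: "ent ?N k (k + ?d) = (if i1 + i2 = int j1 + int j2 then scale (ffact (of_int (k + ?d)) j2) b else 0)" for k
    proof -
      have "k = k + ?d + i2 - int j2 \<longleftrightarrow> i1 + i2 = int j1 + int j2" by auto
      then show ?thesis by (simp only: mat_single mono_ent_def fst_conv snd_conv) simp
    qed
    have t: "tr (scale c a * scale d b) = (c * d) * tr (a * b)" for c d
      by (simp only: scale_mult_left scale_mult_right tr.scale mult.assoc mult.left_commute)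
    show ?thesis
      by (cases "i1 + i2 = int j1 + int j2")
        (simp_all only: M N t simp_thms if_True if_False sum_distrib_right mult.assoc
          mult_zero_right tr.zero sum.neutral_const)
  qed
  also have "(\<Sum>k\<in>{-\<bar>?d\<bar>..\<bar>?d\<bar>}. (step 0 (k + ?d) - step 0 k) * (ffact (of_int k) j1 * ffact (of_int (k + ?d)) j2)) =
      (-1) ^ j1 * fact j1 * fact j2 * (of_int i1 gchoose (j1 + j2 + 1))"
  proof -
    have "(of_int ?d + of_nat j1 :: complex) = of_int i1" by simp
    then show ?thesis using sum_ffact_step[OF finite_atLeastAtMost_int subset_refl, of ?d j1 j2] by (simp only:)
  qed
  finally show ?thesis .
qed

lemma snd_hat_basis_bracket:
  "snd (hat_basis_bracket scale tr a p b q) =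
     cocycle 0 (mat (single p a)) (mat (single q b))"
  by (cases p; cases q) (simp add: hat_basis_bracket_def cocycle_monos)

lemma snd_hat_bracket: "snd (hat_bracket scale tr x y) = cocycle 0 (mat (fst x)) (mat (fst y))"
proof -
  let ?X = "keys (fst x)" and ?Y = "keys (fst y)"
  let ?f = "\<lambda>p. mat (single p (lookup (fst x) p))"
  let ?g = "\<lambda>q. mat (single q (lookup (fst y) q))"
  have "snd (hat_bracket scale tr x y) = (\<Sum>p\<in>?X. \<Sum>q\<in>?Y. cocycle 0 (?f p) (?g q))"
    unfolding hat_bracket_def ext_bracket_def snd_sum snd_hat_basis_bracket ..
  also have "\<dots> = cocycle 0 (sum ?f ?X) (sum ?g ?Y)"
    by (simp only: cocycle_sum_left) (simp only: cocycle_sum_right)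
  also have "sum ?f ?X = mat (fst x)" by (rule mat_expand[symmetric])
  also have "sum ?g ?Y = mat (fst y)" by (rule mat_expand[symmetric])
  finally show ?thesis .
qed

end

section \<open>The twisted subalgebra of differential operators\<close>

context tau_setting
begin

sublocale hatV: vector_space "ext_scale scale :: complex \<Rightarrow> 'a hat_alg \<Rightarrow> 'a hat_alg"
  by (rule vector_space_ext_scale) (rule vector_space_axioms)

abbreviation "hat_L \<equiv> hat_sub scale \<tau> n BB \<epsilon> ell"

lemma map_scale_0: "Poly_Mapping.map (scale c) 0 = 0"
  by (rule poly_mapping_eqI) (simp add: Poly_Mapping.map.rep_eq)

lemma lookup_map_scale: "lookup (Poly_Mapping.map (scale c) f) z = scale c (lookup f z)"
  by (simp add: Poly_Mapping.map.rep_eq when_def)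

lemma map_scale_diff: "Poly_Mapping.map (scale c) (f - g) = Poly_Mapping.map (scale c) f - Poly_Mapping.map (scale c) g"
  by (rule poly_mapping_eqI) (simp add: lookup_map_scale lookup_minus scale_right_diff_distrib)

lemma map_scale_single: "Poly_Mapping.map (scale c) (single z a) = single z (scale c a)"
  by (rule poly_mapping_eqI) (simp add: lookup_map_scale lookup_single when_def)

lift_definition bscale :: "complex \<Rightarrow> 'a band \<Rightarrow> 'a band" is "\<lambda>c M p q. scale c (M p q)"
proof -
  fix c and M :: "int \<Rightarrow> int \<Rightarrow> 'a"
  assume "\<exists>b. \<forall>p q. M p q \<noteq> 0 \<longrightarrow> \<bar>p - q\<bar> \<le> b"
  then show "\<exists>b. \<forall>p q. scale c (M p q) \<noteq> 0 \<longrightarrow> \<bar>p - q\<bar> \<le> b" by auto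
qed

lemma ent_bscale: "ent (bscale c M) p q = scale c (ent M p q)"
  by transfer simp

lemma bscale_times: "bscale c M * N = bscale c (M * N)"
proof (rule band_eqI)
  fix p r
  let ?S = "{q. ent M p q \<noteq> 0}"
  have "ent (bscale c M * N) p r = (\<Sum>q\<in>?S. ent (bscale c M) p q * ent N q r)"
    by (rule ent_times_superset) (auto simp: finite_row ent_bscale)
  then show "ent (bscale c M * N) p r = ent (bscale c (M * N)) p r"
    by (simp add: ent_bscale times_band.rep_eq scale_mult_left scale_sum_right)
qed

lemma skew_bscale: "skew Y \<Longrightarrow> skew (bscale c Y)"
proof -
  assume Y: "skew Y"
  have "star (bscale c Y) = bscale c (star Y)"
    by (rule band_eqI) (simp add: ent_star ent_bscale tau.scale)
  then show ?thesis
    using Y unfolding skew_def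
    by (simp only:) (rule band_eqI, simp only: ent_bscale ent_minus ent_sign_times, cases "even \<epsilon>", simp_all)
qed

lemma mat_map_scale: "mat (Poly_Mapping.map (scale c) f) = bscale c (mat f)"
proof (rule band_eqI)
  fix p k
  have "keys (Poly_Mapping.map (scale c) f) \<subseteq> keys f"
    by (auto simp: Poly_Mapping.in_keys_iff lookup_map_scale)
  then have "ent (mat (Poly_Mapping.map (scale c) f)) p k =
      (\<Sum>\<kappa>\<in>keys f. scale (mono_ent \<kappa> p k) (scale c (lookup f \<kappa>)))"
    by (subst ent_mat_superset[of "keys f"]) (auto simp: lookup_map_scale)
  then show "ent (mat (Poly_Mapping.map (scale c) f)) p k = ent (bscale c (mat f)) p k"
    by (simp add: ent_bscale ent_mat scale_sum_right mult.commute)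
qed

lemma mat_fst_ext_scale: "mat (fst (ext_scale scale c x)) = bscale c (mat (fst x))"
  by (simp add: ext_scale_def mat_map_scale)

lemma bscale_sign: "bscale ((-1) ^ k) M = (-1) ^ k * M"
proof (rule band_eqI)
  fix p q
  show "ent (bscale ((-1) ^ k) M) p q = ent ((-1) ^ k * M) p q"
    by (simp only: ent_bscale ent_sign_times) (cases "even k", simp_all)
qed

lemma ent_mat_adjoint:
  "ent (mat (tens scale a (dmult (single (0, r) ((-1) ^ r)) (dmono m l)))) p k =
    (if p = k + m - int l - int r then scale (ffact (of_int k) l * ffact (of_int (- p - 1)) r) a else 0)"
proof (cases "p = k + m - int l - int r")
  case True
  then have "k + m - int l = p + int r" by simp
  moreover have "(-1) ^ r * ffact (of_int (p + int r)) r = (ffact (of_int (- p - 1)) r :: complex)"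
    using ffact_reflect[of "of_int p :: complex" r] by simp
  ultimately show ?thesis
    unfolding ent_mat_tens dmono_def lookup_dact_mult_monos
    using True by (simp add: mult_ac)
next
  case False
  then show ?thesis
    unfolding ent_mat_tens dmono_def lookup_dact_mult_monos by simp
qed

text \<open>
  Multiplication by \<open>L\<close> from the right supplies the factor \<open>\<partial>\<^bsup>\<ell>\<^sub>j\<^esup>\<close> for \<open>a \<in> BB i j\<close>, and \<open>\<partial>\<^bsup>\<ell>\<^sub>i\<^esup>\<close> for
  \<open>\<tau> a \<in> BB (\<pi> j) (\<pi> i)\<close> because \<open>ell (\<pi> i) = ell i\<close>.
\<close>

lemma mat_hat_gen:
  fixes m :: int and r :: nat
  assumes i: "i \<in> {1..n}" and j: "j \<in> {1..n}" and a: "a \<in> BB i j"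
  defines "X \<equiv> mat (single (m, r) a)"
  shows "mat (fst (hat_gen scale \<tau> \<epsilon> ell i j a r m)) = (X - (-1) ^ \<epsilon> * star X) * weight"
proof -
  have X: "ent X p q = (if p = q + m - int r then scale (ffact (of_int q) r) a else 0)" for p q
    by (simp add: X_def mat_single mono_ent_def)
  have "mat (tens scale a (dmono m (r + ell j))) = X * weight"
  proof (rule band_eqI)
    fix p k
    have "ent X p q \<in> BB i j" for p q
      using subspace_scale[OF BB_subspace[OF i j] a] subspace_0[OF BB_subspace[OF i j]] by (simp add: X)
    then have "ent (X * weight) p k = scale (ffact (of_int k) (ell j)) (ent X p (k - int (ell j)))"
      by (rule BB_times_weight[OF i j])
    also have "\<dots> = ent (mat (tens scale a (dmono m (r + ell j)))) p k"
      using ffact_add[of "of_int k :: complex" "ell j" r]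
      by (auto simp: X tens_dmono mat_single mono_ent_def add.commute algebra_simps)
    finally show "ent (mat (tens scale a (dmono m (r + ell j)))) p k = ent (X * weight) p k" by simp
  qed
  moreover have "mat (tens scale (\<tau> a) (dmult (single (0, r) ((-1) ^ r)) (dmono m (ell i)))) = star X * weight"
  proof (rule band_eqI)
    fix p k
    have \<tau>a: "\<tau> a \<in> BB (\<pi> j) (\<pi> i)" by (rule tau_BB[OF i j a])
    have star: "ent (star X) p q = (if p = q + m - int r then scale (ffact (of_int (- p - 1)) r) (\<tau> a) else 0)" for p q
      unfolding ent_star X by (auto simp: tau.scale)
    note sub = BB_subspace[OF perm_in[OF j] perm_in[OF i]]
    have "ent (star X) p q \<in> BB (\<pi> j) (\<pi> i)" for p q
      using subspace_scale[OF sub \<tau>a] subspace_0[OF sub] by (simp add: star)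
    then have "ent (star X * weight) p k = scale (ffact (of_int k) (ell (\<pi> i))) (ent (star X) p (k - int (ell (\<pi> i))))"
      by (rule BB_times_weight[OF perm_in[OF j] perm_in[OF i]])
    then show "ent (mat (tens scale (\<tau> a) (dmult (single (0, r) ((-1) ^ r)) (dmono m (ell i))))) p k =
        ent (star X * weight) p k"
      by (auto simp: star ent_mat_adjoint ell_perm[OF i])
  qed
  ultimately show ?thesis
    by (simp add: hat_gen_def mat_diff mat_fst_ext_scale bscale_sign left_diff_distrib mult.assoc)
qed

lemma snd_hat_gen: "snd (hat_gen scale \<tau> \<epsilon> ell i j a r m) = 0"
  by (simp add: hat_gen_def ext_scale_def)

lemma star_mat: "\<exists>g. star (mat f) = mat g"
proof -
  let ?g = "\<lambda>\<kappa>. tens scale (\<tau> (lookup f \<kappa>)) (dmult (single (0, snd \<kappa>) ((-1) ^ snd \<kappa>)) (dmono (fst \<kappa>) 0))"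
  have "star (mat (single \<kappa> (lookup f \<kappa>))) = mat (?g \<kappa>)" for \<kappa>
    by (rule band_eqI) (auto simp: ent_star ent_mat_adjoint mat_single mono_ent_def tau.scale ffact_def)
  then have "star (mat f) = mat (\<Sum>\<kappa>\<in>keys f. ?g \<kappa>)"
    unfolding mat_expand[of f] star_sum mat_sum by simp
  then show ?thesis by blast
qed

lemma mat_times: "\<exists>h. mat f * mat g = mat h"
proof -
  have "mat f * mat g = (\<Sum>p\<in>keys f. mat (single p (lookup f p))) *
      (\<Sum>q\<in>keys g. mat (single q (lookup g q)))"
    by (simp only: mat_expand[symmetric])
  also have "\<dots> = mat (\<Sum>p\<in>keys f. \<Sum>q\<in>keys g.
      tens scale (lookup f p * lookup g q) (dmult (dmono (fst p) (snd p)) (dmono (fst q) (snd q))))"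
    by (simp only: sum_product mat_mono_mult mat_sum)
  finally show ?thesis by blast
qed

lemma weight_mat: "\<exists>f. weight = mat f"
proof -
  have "weight = mat (\<Sum>j\<in>{1..n}. single (0, ell j) (idem j))"
    unfolding mat_sum
    by (rule band_eqI) (auto simp: ent_sum ent_weight mat_single mono_ent_def intro!: sum.cong)
  then show ?thesis by blast
qed

lemma commutator_mat: "\<exists>h. mat f * weight * mat g - mat g * weight * mat f = mat h"
  using weight_mat mat_times mat_diff by metis

lemma hat_sub_imp:
  assumes "x \<in> hat_L"
  shows "\<exists>X. skew (mat X) \<and> mat (fst x) = mat X * weight"
proof -
  let ?S = "{x :: 'a hat_alg. \<exists>X. skew (mat X) \<and> mat (fst x) = mat X * weight}"
  have sub: "hatV.subspace ?S"
  proof (rule hatV.subspaceI)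
    show "0 \<in> ?S" by (auto intro!: exI[of _ 0] simp: mat_0 skew_0)
    fix x y :: "'a hat_alg" and c
    assume "x \<in> ?S" "y \<in> ?S"
    then obtain X Y where XY: "skew (mat X)" "mat (fst x) = mat X * weight" "skew (mat Y)" "mat (fst y) = mat Y * weight"
      by blast
    then show "x + y \<in> ?S"
      by (auto intro!: exI[of _ "X + Y"] simp: mat_add skew_add ring_distribs)
    show "ext_scale scale c x \<in> ?S"
      using XY by (auto intro!: exI[of _ "Poly_Mapping.map (scale c) X"]
          simp: mat_map_scale mat_fst_ext_scale skew_bscale bscale_times)
  qed
  have "hat_gen scale \<tau> \<epsilon> ell i j a r m \<in> ?S" if "i \<in> {1..n}" "j \<in> {1..n}" "a \<in> BB i j" for i j a r m
  proof -
    obtain g where "star (mat (single (m, r) a)) = mat g" using star_mat by blast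
    then have "mat (single (m, r) a) - (-1) ^ \<epsilon> * star (mat (single (m, r) a)) =
        mat (single (m, r) a - Poly_Mapping.map (scale ((-1) ^ \<epsilon>)) g)"
      by (simp add: mat_diff mat_map_scale bscale_sign)
    then show ?thesis using mat_hat_gen[OF that] skew_skew_part by (metis (mono_tags, lifting) mem_Collect_eq)
  qed
  moreover have "central \<in> ?S" by (auto intro!: exI[of _ 0] simp: central_def mat_0 skew_0)
  ultimately have "hat_L \<subseteq> ?S"
    unfolding hat_sub_def by (intro hatV.span_minimal sub) auto
  then show ?thesis using assms by blast
qed

lemma ext_scale_half: "ext_scale scale (1 / 2) (x + x) = x" for x :: "('k, 'a) ext"
proof -
  interpret E: vector_space "ext_scale scale :: complex \<Rightarrow> ('k, 'a) ext \<Rightarrow> ('k, 'a) ext"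
    by (rule vector_space_ext_scale) (rule vector_space_axioms)
  have "x + x = ext_scale scale (1 + 1) x" by (simp only: E.scale_left_distrib E.scale_one)
  then show ?thesis by simp
qed

text \<open>
  If \<open>Y\<close> is skew then \<open>2 Y = Y - (-1)\<^sup>\<epsilon> Y\<^sup>*\<close>; splitting \<open>Y\<close> into monomials with coefficients
  in the Peirce components expresses \<open>2 Y L\<close> by generators.
\<close>

lemma in_hat_subI:
  assumes "skew (mat X)" "mat (fst x) = mat X * weight"
  shows "x \<in> hat_L"
proof -
  let ?a = "\<lambda>\<kappa> i j. idem i * lookup X \<kappa> * idem j"
  let ?E = "\<lambda>\<kappa> i j. mat (single \<kappa> (?a \<kappa> i j))"
  define S where "S = (\<Sum>\<kappa>\<in>keys X. \<Sum>i\<in>{1..n}. \<Sum>j\<in>{1..n}. hat_gen scale \<tau> \<epsilon> ell i j (?a \<kappa> i j) (snd \<kappa>) (fst \<kappa>))"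
  have gen: "hat_gen scale \<tau> \<epsilon> ell i j a r m \<in> hat_L" if "i \<in> {1..n}" "j \<in> {1..n}" "a \<in> BB i j" for i j a r m
    unfolding hat_sub_def by (intro hatV.span_base insertI2) (use that in blast)
  have "S \<in> hat_L"
    unfolding S_def hat_sub_def
    by (intro hatV.span_sum gen[unfolded hat_sub_def] idem_times_times_idem)
  have "mat X = (\<Sum>\<kappa>\<in>keys X. \<Sum>i\<in>{1..n}. \<Sum>j\<in>{1..n}. ?E \<kappa> i j)"
  proof -
    have "mat (single \<kappa> (lookup X \<kappa>)) = (\<Sum>i\<in>{1..n}. \<Sum>j\<in>{1..n}. ?E \<kappa> i j)" for \<kappa>
    proof -
      have "single \<kappa> (lookup X \<kappa>) = (\<Sum>i\<in>{1..n}. \<Sum>j\<in>{1..n}. single \<kappa> (?a \<kappa> i j))"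
        by (simp only: single_sum sum_idem_components[symmetric])
      then show ?thesis by (simp only: mat_sum)
    qed
    then show ?thesis by (subst mat_expand) simp
  qed
  then have "mat X - (-1) ^ \<epsilon> * star (mat X) =
      (\<Sum>\<kappa>\<in>keys X. \<Sum>i\<in>{1..n}. \<Sum>j\<in>{1..n}. ?E \<kappa> i j - (-1) ^ \<epsilon> * star (?E \<kappa> i j))"
    by (simp only: star_sum sum_distrib_left sum_subtractf)
  then have "(mat X + mat X) * weight =
      (\<Sum>\<kappa>\<in>keys X. \<Sum>i\<in>{1..n}. \<Sum>j\<in>{1..n}. (?E \<kappa> i j - (-1) ^ \<epsilon> * star (?E \<kappa> i j)) * weight)"
    by (simp only: skew_double[OF assms(1)] sum_distrib_right)
  also have "\<dots> = mat (fst S)"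
    unfolding S_def fst_sum mat_sum
    by (intro sum.cong refl) (simp add: mat_hat_gen[OF _ _ idem_times_times_idem])
  finally have "mat (fst x + fst x) = mat (fst S)"
    by (simp only: mat_add assms(2) distrib_right)
  then have fst: "fst x + fst x = fst S" by (rule mat_inject)
  have "snd S = 0" by (simp add: S_def snd_sum snd_hat_gen)
  then have "x + x = S + ext_scale scale (snd x + snd x) central"
    using fst by (simp add: prod_eq_iff ext_scale_def central_def map_scale_0)
  moreover have "central \<in> hat_L"
    unfolding hat_sub_def by (intro hatV.span_base insertI1)
  ultimately have "x + x \<in> hat_L"
    using \<open>S \<in> hat_L\<close> unfolding hat_sub_def by (simp only:) (intro hatV.span_add hatV.span_scale)
  then have "ext_scale scale (1 / 2) (x + x) \<in> hat_L"
    unfolding hat_sub_def by (rule hatV.span_scale)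
  then show ?thesis by (simp only: ext_scale_half)
qed

lemma mat_bracket_weight:
  assumes "mat (fst x) = Y * weight" "mat (fst y) = Z * weight"
  shows "mat (fst (hat_bracket scale tr x y)) = (Y * weight * Z - Z * weight * Y) * weight"
  by (simp only: mat_hat_bracket assms left_diff_distrib mult.assoc)

lemma hat_bracket_closed:
  assumes "x \<in> hat_L" "y \<in> hat_L"
  shows "hat_bracket scale tr x y \<in> hat_L"
proof -
  obtain X Y where X: "skew (mat X)" "mat (fst x) = mat X * weight" and Y: "skew (mat Y)" "mat (fst y) = mat Y * weight"
    using hat_sub_imp assms by blast
  obtain h where h: "mat X * weight * mat Y - mat Y * weight * mat X = mat h"
    using commutator_mat by blast
  show ?thesis
    by (rule in_hat_subI[of h])
      (use skew_commutator[OF X(1) Y(1)] mat_bracket_weight[OF X(2) Y(2)] in \<open>simp_all only: h\<close>)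
qed

lemma lie_subalgebra_hat: "lie_subalgebra (ext_scale scale) (hat_bracket scale tr) hat_L"
  unfolding lie_subalgebra_def using hat_bracket_closed
  by (simp add: hat_sub_def hatV.subspace_span)

end

section \<open>Finite matrices inside the central extension of infinite matrices\<close>

lemma unit_entry_times:
  "unit_entry a p k * unit_entry b p' k' = (if p' = k then unit_entry (a * b) p k' else (0 :: 'a::ring_1 band))"
proof (rule band_eqI)
  fix r s
  have "ent (unit_entry a p k * unit_entry b p' k') r s =
      (\<Sum>q\<in>{k}. ent (unit_entry a p k) r q * ent (unit_entry b p' k') q s)"
    by (rule ent_times_superset) (auto simp: ent_unit_entry split: if_splits)
  then show "ent (unit_entry a p k * unit_entry b p' k') r s =
      ent (if p' = k then unit_entry (a * b) p k' else 0) r s"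
    by (simp add: ent_unit_entry)
qed

lemma ffact_eq_0: "0 \<le> p \<Longrightarrow> p < int l \<Longrightarrow> ffact (of_int p :: complex) l = 0"
  unfolding ffact_def by (rule prod_zero[OF _ bexI[of _ "nat p"]]) auto

text \<open>
  The parameter \<open>\<iota>\<close> shifts the correspondence between powers of \<open>t\<close> and half-odd indices.
\<close>

locale check_setting = tau_setting scale tr \<tau> n B BB \<pi> \<epsilon> ell
  for scale :: "complex \<Rightarrow> 'a::ring_1 \<Rightarrow> 'a" and tr \<tau> n B BB \<pi> \<epsilon> ell +
  fixes \<iota> :: int
begin

sublocale checkV: vector_space "ext_scale scale :: complex \<Rightarrow> 'a check_alg \<Rightarrow> 'a check_alg"
  by (rule vector_space_ext_scale) (rule vector_space_axioms)

abbreviation "check_L \<equiv> check_sub scale \<tau> n BB \<epsilon> ell \<iota>"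
abbreviation "check_above \<equiv> check_sub_above scale \<tau> n BB \<epsilon> ell \<iota>"
abbreviation "gen \<equiv> check_gen scale \<tau> \<epsilon> ell \<iota>"

text \<open>
  The half-odd index that corresponds to \<open>t\<^sup>p\<close>.  In this numbering the indices excluded for \<open>i\<close>
  are the \<open>p\<close> with \<open>0 \<le> p < ell i\<close>, the powers killed by \<open>\<partial>\<^bsup>\<ell>\<^sub>i\<^esup>\<close>.
\<close>

definition half :: "int \<Rightarrow> real" where
  "half p = of_int p - of_int \<iota> + 1 / 2"

lemma half_eq_iff [simp]: "half p = half q \<longleftrightarrow> p = q"
  by (simp add: half_def)

text \<open>
  The element \<open>a(l\<^sub>1, l\<^sub>2)\<close> multiplies like a matrix entry in row \<open>l\<^sub>1\<close> and column \<open>-l\<^sub>2\<close>.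
\<close>

definition key :: "int \<Rightarrow> int \<Rightarrow> real \<times> real" where
  "key p k = (half p, - half k)"

lemma key_eq_iff [simp]: "key p k = key p' k' \<longleftrightarrow> p = p' \<and> k = k'"
  by (simp add: key_def)

definition to_check :: "'a band \<Rightarrow> real \<times> real \<Rightarrow>\<^sub>0 'a" where
  "to_check F = (\<Sum>(p, k)\<in>support F. single (key p k) (ent F p k))"

lemma to_check_superset:
  assumes "finite S" "support F \<subseteq> S"
  shows "to_check F = (\<Sum>(p, k)\<in>S. single (key p k) (ent F p k))"
  unfolding to_check_def using assms by (intro sum.mono_neutral_left) (auto simp: support_def)

lemma finite_support_0: "finite (support (0 :: 'a band))"
  by (simp add: support_def)

lemma support_add: "support (F + G) \<subseteq> support F \<union> support G"
  for F G :: "'a band"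
  by (auto simp: support_def)

lemma finite_support_add: "finite (support F) \<Longrightarrow> finite (support G) \<Longrightarrow> finite (support (F + G))"
  for F G :: "'a band"
  by (rule finite_subset[OF support_add]) simp

lemma finite_support_sum: "(\<And>i. i \<in> I \<Longrightarrow> finite (support (F i))) \<Longrightarrow> finite (support (\<Sum>i\<in>I. F i))"
  for F :: "'i \<Rightarrow> 'a band"
  by (induction I rule: infinite_finite_induct) (auto intro: finite_support_0 finite_support_add)

lemma to_check_add:
  assumes "finite (support F)" "finite (support G)"
  shows "to_check (F + G) = to_check F + to_check G"
proof -
  let ?S = "support F \<union> support G"
  have S: "finite ?S" using assms by simp
  show ?thesis
    unfolding to_check_superset[OF S support_add] to_check_superset[OF S Un_upper1] to_check_superset[OF S Un_upper2]
    by (simp add: sum.distrib[symmetric] split_beta Poly_Mapping.single_add)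
qed

lemma to_check_0: "to_check 0 = 0"
  by (simp add: to_check_def support_def)

lemma to_check_diff:
  assumes "finite (support F)" "finite (support G)"
  shows "to_check (F - G) = to_check F - to_check G"
  using to_check_add[OF finite_support_diff[OF assms] assms(2)] by (simp add: eq_diff_eq)

lemma to_check_sum:
  "(\<And>i. i \<in> I \<Longrightarrow> finite (support (F i))) \<Longrightarrow> to_check (\<Sum>i\<in>I. F i) = (\<Sum>i\<in>I. to_check (F i))"
proof (induction I rule: infinite_finite_induct)
  case (insert i I)
  then show ?case by (simp add: to_check_add finite_support_sum)
qed (simp_all add: to_check_0)

lemma to_check_unit_entry: "to_check (unit_entry a p k) = single (key p k) a"
  by (subst to_check_superset[of "{(p, k)}"]) (auto simp: support_def ent_unit_entry split: if_splits)

lemma lookup_to_check: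
  assumes "finite (support F)"
  shows "lookup (to_check F) (key p k) = ent F p k"
proof -
  have "lookup (to_check F) (key p k) = (\<Sum>z\<in>support F. if z = (p, k) then ent F p k else 0)"
    unfolding to_check_def lookup_sum by (intro sum.cong) (auto simp: lookup_single when_def split: if_splits)
  then show ?thesis using assms by (simp add: sum.delta support_def)
qed

lemma keys_to_check:
  assumes "finite (support F)"
  shows "keys (to_check F) = (\<lambda>(p, k). key p k) ` support F"
proof
  have "keys (to_check F) \<subseteq> (\<Union>z\<in>support F. keys (case z of (p, k) \<Rightarrow> single (key p k) (ent F p k)))"
    unfolding to_check_def by (rule Poly_Mapping.keys_sum)
  then show "keys (to_check F) \<subseteq> (\<lambda>(p, k). key p k) ` support F"
    by (force split: if_splits)
  show "(\<lambda>(p, k). key p k) ` support F \<subseteq> keys (to_check F)"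
    using lookup_to_check[OF assms] by (auto simp: Poly_Mapping.in_keys_iff support_def)
qed

text \<open>
  The condition \<open>l\<^sub>2 + k\<^sub>1 = 0\<close> says that the column of the first entry is the row of the second one.  If both
  conditions of the central term hold, then \<open>k\<^sub>1 = -l\<^sub>2\<close>, \<open>k\<^sub>2 = -l\<^sub>1\<close> and \<open>H (-l) = 1 - H l\<close> turn
  \<open>H l\<^sub>1 H l\<^sub>2 - H k\<^sub>1 H k\<^sub>2\<close> into \<open>H l\<^sub>1 - H k\<^sub>1\<close>, the difference of the step function at row and column.
\<close>

lemma check_basis_bracket_key:
  "check_basis_bracket tr a (key p k) b (key p' k') =
     (to_check (unit_entry a p k * unit_entry b p' k') - to_check (unit_entry b p' k' * unit_entry a p k),
      cocycle \<iota> (unit_entry a p k) (unit_entry b p' k'))"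
proof -
  have 1: "- half k + half p' = 0 \<longleftrightarrow> p' = k" "half p + - half k' = 0 \<longleftrightarrow> k' = p"
    using half_eq_iff[of p' k] half_eq_iff[of k' p] by linarith+
  have h: "heaviside (half q) = step \<iota> q" "heaviside (- half q) = 1 - step \<iota> q" for q
    by (auto simp: heaviside_def step_def half_def)
  have "cocycle \<iota> (unit_entry a p k) (unit_entry b p' k') = (\<Sum>(r, s)\<in>{(p, k)}. (step \<iota> r - step \<iota> s) *
      tr (ent (unit_entry a p k) r s * ent (unit_entry b p' k') s r))"
    by (rule cocycle_superset) (auto simp: ent_unit_entry split: if_splits)
  then have c: "cocycle \<iota> (unit_entry a p k) (unit_entry b p' k') =
      (if k' = p \<and> p' = k then (step \<iota> p - step \<iota> k) * tr (a * b) else 0)"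
    by (auto simp: ent_unit_entry)
  have e: "to_check (unit_entry a p k * unit_entry b p' k') = (if p' = k then single (key p k') (a * b) else 0)"
     "to_check (unit_entry b p' k' * unit_entry a p k) = (if k' = p then single (key p' k) (b * a) else 0)"
    by (auto simp: unit_entry_times to_check_unit_entry to_check_0)
  show ?thesis
    unfolding c e unfolding key_def check_basis_bracket_def split 1 h
    by (auto simp: algebra_simps)
qed

lemma check_bracket_to_check:
  assumes F: "finite (support F)" and G: "finite (support G)"
    and x: "fst x = to_check F" and y: "fst y = to_check G"
  shows "check_bracket tr x y = (to_check (F * G - G * F), cocycle \<iota> F G)"
proof -
  let ?f = "\<lambda>z. unit_entry (ent F (fst z) (snd z)) (fst z) (snd z)"
  let ?g = "\<lambda>z. unit_entry (ent G (fst z) (snd z)) (fst z) (snd z)"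
  have Fs: "F = sum ?f (support F)" and Gs: "G = sum ?g (support G)"
    using sum_unit_entry[OF F] sum_unit_entry[OF G] by (simp_all add: split_beta)
  have inj: "inj_on (\<lambda>(p, k). key p k) S" for S by (auto simp: inj_on_def)
  have "check_bracket tr x y = (\<Sum>z\<in>support F. \<Sum>w\<in>support G.
     check_basis_bracket tr (ent F (fst z) (snd z)) (key (fst z) (snd z)) (ent G (fst w) (snd w)) (key (fst w) (snd w)))"
    unfolding check_bracket_def ext_bracket_def x y keys_to_check[OF F] keys_to_check[OF G]
      sum.reindex[OF inj]
    by (simp add: comp_def split_beta lookup_to_check[OF F] lookup_to_check[OF G])
  also have "\<dots> = (\<Sum>z\<in>support F. \<Sum>w\<in>support G.
      (to_check (?f z * ?g w) - to_check (?g w * ?f z), cocycle \<iota> (?f z) (?g w)))"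
    by (simp only: check_basis_bracket_key)
  also have "\<dots> = (to_check (F * G - G * F), cocycle \<iota> F G)"
  proof (rule prod_eqI)
    have fin: "finite (support (?f z))" "finite (support (?g z))" for z
      by (simp_all add: finite_support_unit_entry)
    have "to_check (F * G) = (\<Sum>z\<in>support F. \<Sum>w\<in>support G. to_check (?f z * ?g w))"
    proof -
      have "F * G = (\<Sum>z\<in>support F. \<Sum>w\<in>support G. ?f z * ?g w)"
        by (subst Fs, subst Gs) (rule sum_product)
      then show ?thesis
        by (simp add: to_check_sum finite_support_sum finite_support_times fin)
    qed
    moreover have "to_check (G * F) = (\<Sum>z\<in>support F. \<Sum>w\<in>support G. to_check (?g w * ?f z))"
    proof -
      have "G * F = (\<Sum>w\<in>support G. \<Sum>z\<in>support F. ?g w * ?f z)"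
        by (subst Fs, subst Gs) (rule sum_product)
      also have "\<dots> = (\<Sum>z\<in>support F. \<Sum>w\<in>support G. ?g w * ?f z)"
        by (rule sum.swap)
      finally show ?thesis
        by (simp add: to_check_sum finite_support_sum finite_support_times fin)
    qed
    ultimately show "fst (\<Sum>z\<in>support F. \<Sum>w\<in>support G.
      (to_check (?f z * ?g w) - to_check (?g w * ?f z), cocycle \<iota> (?f z) (?g w))) = fst (to_check (F * G - G * F), cocycle \<iota> F G)"
      by (simp add: fst_sum sum_subtractf to_check_diff finite_support_times F G)
    have "cocycle \<iota> F G = (\<Sum>z\<in>support F. \<Sum>w\<in>support G. cocycle \<iota> (?f z) (?g w))"
      by (subst Fs, subst Gs) (simp only: cocycle_sum_left, simp only: cocycle_sum_right)
    then show "snd (\<Sum>z\<in>support F. \<Sum>w\<in>support G.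
      (to_check (?f z * ?g w) - to_check (?g w * ?f z), cocycle \<iota> (?f z) (?g w))) = snd (to_check (F * G - G * F), cocycle \<iota> F G)"
      by (simp only: snd_sum snd_conv)
  qed
  finally show ?thesis .
qed

subsection \<open>Projection away from the killed rows\<close>

text \<open>
  The projection that removes, in the \<open>i\<close>-th Peirce component, the rows not admitted by \<open>idx ell \<iota> i\<close>.
\<close>

lift_definition proj :: "'a band" is
  "\<lambda>p q. if p = q then \<Sum>i\<in>{1..n}. if 0 \<le> p \<and> p < int (ell i) then 0 else idem i else 0"
  by (rule exI[of _ 0]) simp

lemma ent_proj: "ent proj p q =
    (if p = q then \<Sum>i\<in>{1..n}. if 0 \<le> p \<and> p < int (ell i) then 0 else idem i else 0)"
  by transfer simp

lemma ent_proj_times: "ent (proj * M) p k = ent proj p p * ent M p k"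
  by (subst ent_times_superset[of "{p}"]) (auto simp: ent_proj split: if_splits)

lemma ent_times_proj: "ent (M * proj) p k = ent M p k * ent proj k k"
  by (subst ent_times_superset[of "{k}"]) (auto simp: ent_proj split: if_splits)

text \<open>
  The coefficient of \<open>\<partial>\<^bsup>\<ell>\<^sub>j\<^esup>\<close> on \<open>t\<^sup>k\<close> vanishes for \<open>0 \<le> k < ell j\<close>.  Hence inserting the projection after
  \<open>L\<close> changes no product \<open>Y L Z\<close>.
\<close>

lemma weight_proj: "weight * proj = weight"
proof (rule band_eqI)
  fix q k
  have "ent (weight * proj) q k = ent weight q k * ent proj k k"
    by (rule ent_times_proj)
  also have "\<dots> = (\<Sum>j\<in>{1..n}. \<Sum>i\<in>{1..n}. if i = j then
      (if k - q = int (ell j) then scale (ffact (of_int k) (ell j)) (idem j) else 0) else 0)"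
    unfolding ent_weight ent_proj simp_thms if_True sum_product
    by (intro sum.cong refl) (auto simp: scale_mult_left idem_times_idem ffact_eq_0)
  also have "\<dots> = ent weight q k" by (simp add: ent_weight)
  finally show "ent (weight * proj) q k = ent weight q k" .
qed

lemma proj_times_BB:
  assumes "i \<in> {1..n}" "j \<in> {1..n}" "a \<in> BB i j"
  shows "ent proj p p * a = (if 0 \<le> p \<and> p < int (ell i) then 0 else a)"
proof -
  have "ent proj p p * a = (\<Sum>l\<in>{1..n}. if l = i then (if 0 \<le> p \<and> p < int (ell i) then 0 else a) else 0)"
    unfolding ent_proj simp_thms if_True sum_distrib_right
    by (intro sum.cong refl) (auto simp: idem_times_BB[OF assms(3,1,2)])
  then show ?thesis using assms by simp
qed

definition lift_skew :: "'a band \<Rightarrow> 'a check_alg" where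
  "lift_skew Y = (to_check (proj * Y * weight), 0)"

lemma finite_support_lift: "finite (support Y) \<Longrightarrow> finite (support (proj * Y * weight))"
  by (simp add: finite_support_times)

lemma lift_skew_add:
  "finite (support Y) \<Longrightarrow> finite (support Z) \<Longrightarrow> lift_skew (Y + Z) = lift_skew Y + lift_skew Z"
  by (simp add: lift_skew_def ring_distribs to_check_add finite_support_lift)

lemma lift_skew_diff:
  "finite (support Y) \<Longrightarrow> finite (support Z) \<Longrightarrow> lift_skew (Y - Z) = lift_skew Y - lift_skew Z"
  by (simp add: lift_skew_def left_diff_distrib right_diff_distrib to_check_diff finite_support_lift)

lemma lift_skew_sum:
  "(\<And>i. i \<in> I \<Longrightarrow> finite (support (Y i))) \<Longrightarrow> lift_skew (\<Sum>i\<in>I. Y i) = (\<Sum>i\<in>I. lift_skew (Y i))"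
proof (induction I rule: infinite_finite_induct)
  case (insert i I)
  then show ?case by (simp add: lift_skew_add finite_support_sum)
qed (simp_all add: lift_skew_def to_check_0 zero_prod_def)

lemma star_unit_entry: "star (unit_entry a p q) = unit_entry (\<tau> a) (- q - 1) (- p - 1)"
  by (rule band_eqI) (auto simp: ent_star ent_unit_entry)

lemma finite_support_sign: "finite (support M) \<Longrightarrow> finite (support ((-1) ^ k * M))"
  for M :: "'a band"
  by (simp add: finite_support_times)

lemma proj_unit_weight:
  assumes i: "i \<in> {1..n}" and j: "j \<in> {1..n}" and a: "a \<in> BB i j"
  shows "proj * unit_entry a p q * weight = (if 0 \<le> p \<and> p < int (ell i) then 0 else
    unit_entry (scale (ffact (of_int (q + int (ell j))) (ell j)) a) p (q + int (ell j)))"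
proof (rule band_eqI)
  fix r k
  have "ent (unit_entry a p q) r s \<in> BB i j" for r s
    using a subspace_0[OF BB_subspace[OF i j]] by (simp add: ent_unit_entry)
  from BB_times_weight[OF i j this]
  have w: "ent (unit_entry a p q * weight) r k =
      scale (ffact (of_int k) (ell j)) (ent (unit_entry a p q) r (k - int (ell j)))" .
  show "ent (proj * unit_entry a p q * weight) r k = ent (if 0 \<le> p \<and> p < int (ell i) then 0 else
    unit_entry (scale (ffact (of_int (q + int (ell j))) (ell j)) a) p (q + int (ell j))) r k"
    unfolding mult.assoc ent_proj_times w
    by (auto simp: ent_unit_entry scale_mult_right proj_times_BB[OF i j a])
qed

lemma half_in_idx: "half p \<in> idx ell \<iota> i \<longleftrightarrow> \<not> (0 \<le> p \<and> p < int (ell i))"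
proof -
  have "half p \<in> half_odds"
    unfolding half_odds_def half_def by (auto intro: exI[of _ "p - \<iota>"])
  moreover have "(\<exists>k. half p = - of_int \<iota> + of_nat k + 1 / 2 \<and> k < ell i) \<longleftrightarrow> 0 \<le> p \<and> p < int (ell i)"
  proof
    assume "\<exists>k. half p = - of_int \<iota> + of_nat k + 1 / 2 \<and> k < ell i"
    then obtain k where k: "half p = - of_int \<iota> + of_nat k + 1 / 2" "k < ell i" by blast
    then have "p = int k" unfolding half_def by linarith
    with k show "0 \<le> p \<and> p < int (ell i)" by simp
  next
    assume "0 \<le> p \<and> p < int (ell i)"
    then show "\<exists>k. half p = - of_int \<iota> + of_nat k + 1 / 2 \<and> k < ell i"
      by (intro exI[of _ "nat p"]) (auto simp: half_def)
  qed
  ultimately show ?thesis unfolding idx_def by blast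
qed

lemma idx_imp_half: "l \<in> idx ell \<iota> i \<Longrightarrow> \<exists>p. l = half p"
proof -
  assume "l \<in> idx ell \<iota> i"
  then obtain k :: int where "l = of_int k + 1 / 2" unfolding idx_def half_odds_def by blast
  then show ?thesis by (intro exI[of _ "k + \<iota>"]) (simp add: half_def)
qed

lemma ext_scale_single: "ext_scale scale c (single z a, 0) = (single z (scale c a), 0)"
  by (simp add: ext_scale_def map_scale_single)

lemma gen_conv:
  "gen i j a (half p) (half u) =
    (single (key p (int (ell j) - u - 1)) (scale ((-1) ^ \<epsilon> * ffact (of_int u) (ell j)) a) -
     single (key u (int (ell i) - p - 1)) (scale (ffact (of_int p) (ell i)) (\<tau> a)), 0)"
proof -
  have [simp]: "half p + of_int \<iota> - 1 / 2 = of_int p" "half u + of_int \<iota> - 1 / 2 = of_int u"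
    by (simp_all add: half_def)
  have k: "(half p, half u + 2 * of_int \<iota> - of_nat (ell j)) = key p (int (ell j) - u - 1)"
     "(half u, half p + 2 * of_int \<iota> - of_nat (ell i)) = key u (int (ell i) - p - 1)"
    by (simp_all add: key_def half_def)
  show ?thesis
    unfolding check_gen_def k ext_scale_single by simp
qed

text \<open>
  The spanning elements of the algebra of infinite matrices, in the form \<open>P (E - (-1)\<^sup>\<epsilon> E\<^sup>*) L\<close>.  The
  entry of \<open>E\<close> sits in row \<open>p\<close> and column \<open>-u - 1\<close>, so that the transpose exchanges \<open>p\<close> and \<open>u\<close>.  If
  \<open>p\<close> is excluded for \<open>i\<close>, then \<open>P\<close> removes the first term and the weight of the second one is zero; the
  case of \<open>u\<close> is symmetric.
\<close>

lemma lift_skew_unit: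
  assumes i: "i \<in> {1..n}" and j: "j \<in> {1..n}" and a: "a \<in> BB i j"
  shows "lift_skew (unit_entry a p (- u - 1) - (-1) ^ \<epsilon> * star (unit_entry a p (- u - 1))) =
    (if half p \<in> idx ell \<iota> i \<and> half u \<in> idx ell \<iota> j then gen i j a (half p) (half u) else 0)"
proof -
  note ji = perm_in[OF j] perm_in[OF i] tau_BB[OF i j a]
  have sgn: "(-1) ^ \<epsilon> * ffact (of_int (int l - x - 1)) l = (ffact (of_int x) l :: complex)"
    if "k \<in> {1..n}" "l = ell k" for l x k
    using ffact_reflect[of "of_int (- x - 1) :: complex" l] sign_ell[OF that(1), where 'b = complex] that(2)
    by (simp add: algebra_simps)
  have u: "(-1) ^ \<epsilon> * ffact (of_int u) (ell j) = (ffact (of_int (- u - 1 + int (ell j))) (ell j) :: complex)"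
    using sgn[OF j refl, of "int (ell j) - u - 1"] by (simp add: algebra_simps)
  have p: "ffact (of_int p) (ell i) = ((-1) ^ \<epsilon> * ffact (of_int (- p - 1 + int (ell i))) (ell i) :: complex)"
    using sgn[OF i refl, of p] by (simp add: algebra_simps)
  have "lift_skew (unit_entry a p (- u - 1) - (-1) ^ \<epsilon> * star (unit_entry a p (- u - 1))) =
     lift_skew (unit_entry a p (- u - 1)) - lift_skew ((-1) ^ \<epsilon> * star (unit_entry a p (- u - 1)))"
    by (rule lift_skew_diff) (auto simp: star_unit_entry intro: finite_support_sign finite_support_unit_entry)
  also have "lift_skew (unit_entry a p (- u - 1)) =
     (if 0 \<le> p \<and> p < int (ell i) then 0 else
      single (key p (int (ell j) - u - 1)) (scale ((-1) ^ \<epsilon> * ffact (of_int u) (ell j)) a), 0)"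
    unfolding lift_skew_def proj_unit_weight[OF i j a] u by (simp add: to_check_0 to_check_unit_entry algebra_simps)
  also have "lift_skew ((-1) ^ \<epsilon> * star (unit_entry a p (- u - 1))) =
     (if 0 \<le> u \<and> u < int (ell j) then 0 else
      single (key u (int (ell i) - p - 1)) (scale (ffact (of_int p) (ell i)) (\<tau> a)), 0)"
  proof -
    have "(-1) ^ \<epsilon> * star (unit_entry a p (- u - 1)) = unit_entry ((-1) ^ \<epsilon> * \<tau> a) u (- p - 1)"
      by (rule band_eqI) (simp add: star_unit_entry ent_sign_times ent_unit_entry)
    moreover have "(-1) ^ \<epsilon> * \<tau> a \<in> BB (\<pi> j) (\<pi> i)"
      using subspace_neg[OF BB_subspace[OF ji(1,2)] ji(3)] ji(3) by (cases "even \<epsilon>") auto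
    ultimately show ?thesis
      unfolding lift_skew_def using proj_unit_weight[OF ji(1,2)]
      by (simp add: to_check_0 to_check_unit_entry p ell_perm[OF i] ell_perm[OF j] scale_sign scale_mult_right[symmetric] algebra_simps)
  qed
  finally show ?thesis
    unfolding half_in_idx gen_conv
    using ffact_eq_0[of p "ell i"] ffact_eq_0[of u "ell j"] by (auto simp: zero_prod_def)
qed

text \<open>
  Lets statements about spanning elements pass to \<open>P Y L\<close> for finite skew matrices \<open>Y\<close>, entry by
  entry.  It is applied to the whole algebra and to its subspaces of far elements.
\<close>

lemma lift_skew_in_subspace:
  assumes C: "checkV.subspace C" and Y: "skew Y" "finite (support Y)"
    and gens: "\<And>p u i j a. (p, - u - 1) \<in> support Y \<Longrightarrow> i \<in> {1..n} \<Longrightarrow> j \<in> {1..n} \<Longrightarrow> a \<in> BB i j \<Longrightarrow>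
      half p \<in> idx ell \<iota> i \<Longrightarrow> half u \<in> idx ell \<iota> j \<Longrightarrow> gen i j a (half p) (half u) \<in> C"
  shows "lift_skew Y \<in> C"
proof -
  let ?a = "\<lambda>z i j. idem i * ent Y (fst z) (snd z) * idem j"
  let ?E = "\<lambda>z i j. unit_entry (?a z i j) (fst z) (snd z)"
  let ?T = "\<lambda>z i j. ?E z i j - (-1) ^ \<epsilon> * star (?E z i j)"
  have fin: "finite (support (?T z i j))" for z i j
    by (intro finite_support_diff finite_support_sign)
      (simp_all add: star_unit_entry finite_support_unit_entry)
  have comp: "unit_entry a p q = (\<Sum>i\<in>{1..n}. \<Sum>j\<in>{1..n}. unit_entry (idem i * a * idem j) p q)" for a p q
  proof (rule band_eqI)
    fix r s
    show "ent (unit_entry a p q) r s = ent (\<Sum>i\<in>{1..n}. \<Sum>j\<in>{1..n}. unit_entry (idem i * a * idem j) p q) r s"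
      by (cases "r = p \<and> s = q") (simp_all only: ent_sum ent_unit_entry if_True if_False sum.neutral_const simp_thms
          sum_idem_components[symmetric])
  qed
  have "Y = (\<Sum>z\<in>support Y. \<Sum>i\<in>{1..n}. \<Sum>j\<in>{1..n}. ?E z i j)"
    using sum_unit_entry[OF Y(2)] by (simp add: split_beta comp[symmetric])
  then have "Y - (-1) ^ \<epsilon> * star Y = (\<Sum>z\<in>support Y. \<Sum>i\<in>{1..n}. \<Sum>j\<in>{1..n}. ?E z i j) -
      (-1) ^ \<epsilon> * star (\<Sum>z\<in>support Y. \<Sum>i\<in>{1..n}. \<Sum>j\<in>{1..n}. ?E z i j)" by simp
  also have "\<dots> = (\<Sum>z\<in>support Y. \<Sum>i\<in>{1..n}. \<Sum>j\<in>{1..n}. ?T z i j)"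
    by (simp only: star_sum sum_distrib_left sum_subtractf)
  finally have "lift_skew (Y + Y) = (\<Sum>z\<in>support Y. \<Sum>i\<in>{1..n}. \<Sum>j\<in>{1..n}. lift_skew (?T z i j))"
    unfolding skew_double[OF Y(1)] by (simp add: lift_skew_sum finite_support_sum fin)
  also have "\<dots> \<in> C"
  proof (intro checkV.subspace_sum[OF C])
    fix z i j assume z: "z \<in> support Y" and ij: "i \<in> {1..n}" "j \<in> {1..n}"
    obtain p u where pu: "z = (p, - u - 1)" by (metis add_diff_cancel_right' diff_minus_eq_add minus_diff_eq surj_pair uminus_add_conv_diff)
    have "?a z i j \<in> BB i j" by (rule idem_times_times_idem[OF ij])
    then show "lift_skew (?T z i j) \<in> C"
      using lift_skew_unit[OF ij, of "?a z i j" p u] gens[of p u i j "?a z i j"] z ij checkV.subspace_0[OF C]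
      by (auto simp: pu)
  qed
  finally have "ext_scale scale (1 / 2) (lift_skew Y + lift_skew Y) \<in> C"
    by (simp only: lift_skew_add Y(2) checkV.subspace_scale[OF C])
  then show ?thesis by (simp only: ext_scale_half)
qed

lemma check_L_subspace: "checkV.subspace check_L"
  and check_above_subspace: "checkV.subspace (check_above m)"
  unfolding check_sub_def check_sub_above_def by (rule checkV.subspace_span)+

lemma gen_in_check_L:
  "i \<in> {1..n} \<Longrightarrow> j \<in> {1..n} \<Longrightarrow> a \<in> BB i j \<Longrightarrow> l1 \<in> idx ell \<iota> i \<Longrightarrow> l2 \<in> idx ell \<iota> j \<Longrightarrow> gen i j a l1 l2 \<in> check_L"
  unfolding check_sub_def by (intro checkV.span_base insertI2) blast

lemma central_in_check_L: "central \<in> check_L"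
  unfolding check_sub_def by (intro checkV.span_base insertI1)

lemma lift_skew_in_check_L: "skew Y \<Longrightarrow> finite (support Y) \<Longrightarrow> lift_skew Y \<in> check_L"
  by (rule lift_skew_in_subspace[OF check_L_subspace]) (auto intro: gen_in_check_L)

text \<open>
  This is the skewness of \<open>E - (-1)\<^sup>\<epsilon> E\<^sup>*\<close>.
\<close>

lemma gen_swap:
  assumes i: "i \<in> {1..n}" and j: "j \<in> {1..n}"
  shows "gen i j a (half p) (half u) = ext_scale scale (- ((-1) ^ \<epsilon>)) (gen (\<pi> j) (\<pi> i) (\<tau> a) (half u) (half p))"
  unfolding gen_conv ext_scale_def fst_conv snd_conv map_scale_diff map_scale_single tau_tau
    ell_perm[OF i] ell_perm[OF j]
  by (cases "even \<epsilon>") (simp_all add: Poly_Mapping.single_uminus)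

definition ell_max :: int where "ell_max = int (Max (ell ` {1..n}))"

lemma ell_le_max: "i \<in> {1..n} \<Longrightarrow> int (ell i) \<le> ell_max"
  by (simp add: ell_max_def)

lemma half_in_idx_large: "i \<in> {1..n} \<Longrightarrow> p \<ge> ell_max \<Longrightarrow> half p \<in> idx ell \<iota> i"
  using ell_le_max[of i] by (auto simp: half_in_idx)

text \<open>
  The bounds are chosen so that \<open>half p\<close> and \<open>- half u\<close> exceed \<open>m\<close> and lie in all index sets.
\<close>

lemma gen_in_above:
  assumes ij: "i \<in> {1..n}" "j \<in> {1..n}" and a: "a \<in> BB i j"
    and p: "p \<ge> int m + 2 * \<bar>\<iota>\<bar> + ell_max + 2" and u: "- u \<ge> int m + 2 * \<bar>\<iota>\<bar> + ell_max + 2"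
  shows "gen i j a (half p) (half u) \<in> check_above m"
proof -
  define w where "w = 2 * \<iota> - u - 1"
  have w: "half u = - half w" by (simp add: w_def half_def)
  have "0 \<le> ell_max" by (simp add: ell_max_def)
  have "of_nat m < half p" "of_nat m < half w"
    using p u \<open>0 \<le> ell_max\<close> unfolding half_def w_def by linarith+
  moreover have "half p \<in> idx ell \<iota> i" "half w \<in> idx ell \<iota> j"
    by (intro half_in_idx_large ij; use p u in \<open>simp add: w_def\<close>)+
  ultimately show ?thesis
    unfolding check_sub_above_def w by (intro checkV.span_base) (use ij a in blast)
qed

text \<open>
  The spanning elements of \<open>check_above m\<close> have the form \<open>gen i j a l1 (- l2)\<close> with positive \<open>l1\<close> and \<open>l2\<close>.
  The opposite signs are reached by interchanging the two indices.
\<close>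

lemma gen_in_above_swapped:
  assumes ij: "i \<in> {1..n}" "j \<in> {1..n}" and a: "a \<in> BB i j"
    and p: "- p \<ge> int m + 2 * \<bar>\<iota>\<bar> + ell_max + 2" and u: "u \<ge> int m + 2 * \<bar>\<iota>\<bar> + ell_max + 2"
  shows "gen i j a (half p) (half u) \<in> check_above m"
  unfolding gen_swap[OF ij]
  by (intro checkV.subspace_scale[OF check_above_subspace] gen_in_above perm_in ij tau_BB a p u)

text \<open>
  A band matrix whose nonzero rows are far from the origin has its nonzero entries near the two ends of the
  diagonal.  There \<open>p\<close> and \<open>u\<close> have opposite signs and are both large.
\<close>

lemma lift_skew_in_above:
  assumes Y: "skew Y" "finite (support Y)" and b: "bandwidth b Y"
    and far: "\<And>p q. ent Y p q \<noteq> 0 \<Longrightarrow> \<bar>p\<bar> \<ge> int m + 2 * \<bar>\<iota>\<bar> + ell_max + b + 3"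
  shows "lift_skew Y \<in> check_above m"
proof (rule lift_skew_in_subspace[OF check_above_subspace Y])
  fix p u i j a
  assume pu: "(p, - u - 1) \<in> support Y" and ij: "i \<in> {1..n}" "j \<in> {1..n}" and a: "a \<in> BB i j"
  have "\<bar>p\<bar> \<ge> int m + 2 * \<bar>\<iota>\<bar> + ell_max + b + 3" "\<bar>p - (- u - 1)\<bar> \<le> b"
    using pu far bandwidthD[OF b] by (auto simp: support_def)
  then have "(p \<ge> int m + 2 * \<bar>\<iota>\<bar> + ell_max + 2 \<and> - u \<ge> int m + 2 * \<bar>\<iota>\<bar> + ell_max + 2) \<or>
     (- p \<ge> int m + 2 * \<bar>\<iota>\<bar> + ell_max + 2 \<and> u \<ge> int m + 2 * \<bar>\<iota>\<bar> + ell_max + 2)" by linarith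
  then show "gen i j a (half p) (half u) \<in> check_above m"
    using gen_in_above[OF ij a] gen_in_above_swapped[OF ij a] by blast
qed

lemma check_above_antimono: "m \<le> m' \<Longrightarrow> check_above m' \<subseteq> check_above m"
  unfolding check_sub_above_def by (rule checkV.span_mono) force

lemma check_above_subset:
  assumes m: "int m \<ge> 2 * \<bar>\<iota>\<bar> + ell_max"
  shows "check_above m \<subseteq> check_L"
proof -
  have "gen i j a l1 (- l2) \<in> check_L"
    if l: "i \<in> {1..n}" "j \<in> {1..n}" "a \<in> BB i j" "of_nat m < l1" "l1 \<in> idx ell \<iota> i" "of_nat m < l2" "l2 \<in> idx ell \<iota> j"
    for i j a l1 l2
  proof -
    obtain w where w: "l2 = half w" using idx_imp_half l by blast
    have "0 \<le> ell_max" by (simp add: ell_max_def)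
    have "- l2 = half (2 * \<iota> - w - 1)" by (simp add: w half_def)
    moreover have "2 * \<iota> - w - 1 < 0"
    proof -
      have "real_of_int (int m) < of_int w - of_int \<iota> + 1 / 2" using l(6) w by (simp add: half_def)
      then have "int m \<le> w - \<iota>" by linarith
      then show ?thesis using m \<open>0 \<le> ell_max\<close> by linarith
    qed
    ultimately have "- l2 \<in> idx ell \<iota> j" by (simp add: half_in_idx)
    then show ?thesis using l by (intro gen_in_check_L)
  qed
  then show ?thesis
    unfolding check_sub_above_def
    by (intro checkV.span_minimal check_L_subspace) blast
qed

lemma keys_check_above:
  assumes "y \<in> check_above m" "z \<in> keys (fst y)"
  shows "\<bar>fst z\<bar> \<ge> of_nat m - 2 * of_int \<bar>\<iota>\<bar> - of_int ell_max \<and> \<bar>snd z\<bar> \<ge> of_nat m - 2 * of_int \<bar>\<iota>\<bar> - of_int ell_max"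
proof -
  let ?far = "\<lambda>z :: real \<times> real. \<bar>fst z\<bar> \<ge> of_nat m - 2 * of_int \<bar>\<iota>\<bar> - of_int ell_max \<and> \<bar>snd z\<bar> \<ge> of_nat m - 2 * of_int \<bar>\<iota>\<bar> - of_int ell_max"
  let ?S = "{y :: 'a check_alg. \<forall>z. lookup (fst y) z \<noteq> 0 \<longrightarrow> ?far z}"
  have sub: "checkV.subspace ?S"
  proof (rule checkV.subspaceI)
    show "0 \<in> ?S" by simp
    fix x y c assume xy: "x \<in> ?S" "y \<in> ?S"
    show "x + y \<in> ?S"
    proof (intro CollectI allI impI)
      fix z assume "lookup (fst (x + y)) z \<noteq> 0"
      then have "lookup (fst x) z \<noteq> 0 \<or> lookup (fst y) z \<noteq> 0"
        by (auto simp: lookup_add)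
      then show "?far z" using xy by blast
    qed
    show "ext_scale scale c x \<in> ?S"
      using xy by (auto simp: ext_scale_def lookup_map_scale)
  qed
  have "gen i j a l1 (- l2) \<in> ?S"
    if l: "i \<in> {1..n}" "j \<in> {1..n}" "of_nat m < l1" "l1 \<in> idx ell \<iota> i" "of_nat m < l2" "l2 \<in> idx ell \<iota> j"
    for i j a l1 l2
  proof (intro CollectI allI impI)
    fix z assume nz: "lookup (fst (gen i j a l1 (- l2))) z \<noteq> 0"
    have "z = (l1, - l2 + 2 * of_int \<iota> - of_nat (ell j)) \<or> z = (- l2, l1 + 2 * of_int \<iota> - of_nat (ell i))"
      using nz unfolding check_gen_def ext_scale_single
      by (auto simp: lookup_minus lookup_single when_def split: if_splits)
    moreover have "real (ell i) \<le> of_int ell_max" "real (ell j) \<le> of_int ell_max"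
      using ell_le_max[OF l(1)] ell_le_max[OF l(2)] by (metis of_int_le_iff of_int_of_nat_eq)+
    moreover have "\<bar>real_of_int \<iota>\<bar> = of_int \<bar>\<iota>\<bar>" by simp
    ultimately show "?far z"
      using l(3,5) by (elim disjE) (simp, linarith)+
  qed
  then have "check_above m \<subseteq> ?S"
    unfolding check_sub_above_def by (intro checkV.span_minimal sub) blast
  then have "y \<in> ?S" using assms(1) by blast
  then show ?thesis using assms(2) unfolding Poly_Mapping.in_keys_iff by blast
qed

text \<open>
  The finitely many entries of \<open>x\<close> cannot be composed with entries far from the origin.
\<close>

lemma check_bracket_above:
  fixes x :: "'a check_alg"
  shows "\<exists>m0. \<forall>m\<ge>m0. \<forall>y\<in>check_above m. check_bracket tr y x = 0"
proof -
  let ?c = "\<Sum>z\<in>keys (fst x). \<bar>fst z\<bar> + \<bar>snd z\<bar>"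
  obtain m0 :: nat where m0: "real m0 > ?c + 2 * of_int \<bar>\<iota>\<bar> + of_int ell_max"
    using reals_Archimedean2 by blast
  have "check_bracket tr y x = 0" if m: "m \<ge> m0" and y: "y \<in> check_above m" for m y
    unfolding check_bracket_def ext_bracket_def
  proof (intro sum.neutral ballI)
    fix z w assume z: "z \<in> keys (fst y)" and w: "w \<in> keys (fst x)"
    have "\<bar>fst w\<bar> + \<bar>snd w\<bar> \<le> ?c"
      by (rule member_le_sum[of w]) (use w in auto)
    moreover have "real m \<ge> real m0" using m by simp
    ultimately have "snd z + fst w \<noteq> 0" "fst z + snd w \<noteq> 0"
      using keys_check_above[OF y z] m0 by linarith+
    then show "check_basis_bracket tr (lookup (fst y) z) z (lookup (fst x) w) w = 0"
      by (cases z; cases w) (simp add: check_basis_bracket_def zero_prod_def)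
  qed
  then show ?thesis by blast
qed

subsection \<open>Truncation\<close>

text \<open>
  Truncation of \<open>Y\<close> expressed by \<open>M = Y L\<close>: in the \<open>j\<close>-th Peirce component the column \<open>k\<close> of \<open>M\<close>
  comes from the column \<open>k - ell j\<close> of \<open>Y\<close>.  This is linear in \<open>M\<close> and involves no choice of \<open>Y\<close>.
\<close>

lift_definition window :: "int \<Rightarrow> 'a band \<Rightarrow> 'a band" is
  "\<lambda>K M p k. \<Sum>j\<in>{1..n}. if p \<in> {-K..<K} \<and> k - int (ell j) \<in> {-K..<K} then M p k * idem j else 0"
proof -
  fix K and M :: "int \<Rightarrow> int \<Rightarrow> 'a"
  assume "\<exists>b. \<forall>p q. M p q \<noteq> 0 \<longrightarrow> \<bar>p - q\<bar> \<le> b"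
  then obtain b where b: "\<And>p q. M p q \<noteq> 0 \<Longrightarrow> \<bar>p - q\<bar> \<le> b" by blast
  have "\<bar>p - k\<bar> \<le> b" if "(\<Sum>j\<in>{1..n}. if p \<in> {-K..<K} \<and> k - int (ell j) \<in> {-K..<K} then M p k * idem j else 0) \<noteq> 0" for p k
  proof (rule b)
    show "M p k \<noteq> 0" using that by (auto intro: sum.neutral)
  qed
  then show "\<exists>b. \<forall>p k. (\<Sum>j\<in>{1..n}. if p \<in> {-K..<K} \<and> k - int (ell j) \<in> {-K..<K} then M p k * idem j else 0) \<noteq> 0 \<longrightarrow> \<bar>p - k\<bar> \<le> b"
    by blast
qed

lemma ent_window: "ent (window K M) p k =
    (\<Sum>j\<in>{1..n}. if p \<in> {-K..<K} \<and> k - int (ell j) \<in> {-K..<K} then ent M p k * idem j else 0)"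
  by transfer simp

lemma window_times_weight: "window K (Y * weight) = trunc K Y * weight"
  by (rule band_eqI)
    (simp only: ent_window ent_times_weight[of "trunc K Y"], intro sum.cong refl,
      auto simp: ent_times_weight_idem ent_trunc)

lemma window_add: "window K (M + N) = window K M + window K N"
  by (rule band_eqI) (simp only: ent_window ent_add sum.distrib[symmetric], intro sum.cong refl, simp add: ring_distribs)

lemma window_bscale: "window K (bscale c M) = bscale c (window K M)"
  by (rule band_eqI) (simp only: ent_window ent_bscale scale_sum_right, intro sum.cong refl, simp add: scale_mult_left)

end

section \<open>The constants as finite sums\<close>

lemma ser_x_nth: "(ser_x * F) $ r $ l = (if r = 0 then 0 else F $ (r - 1) $ l)"
  and ser_y_nth: "(ser_y * F) $ r $ l = (if l = 0 then 0 else F $ r $ (l - 1))"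
  and ser_z_nth: "(ser_z * F) $ r $ l = fls_X * F $ r $ l"
  by (simp_all add: ser_x_def ser_y_def ser_z_def)

lemma Im_genfun_nth: "Im_genfun c $ r $ l = fls_const (c r l) * fls_X_intpow (- int r - int l - 1)"
  by (simp add: Im_genfun_def)

lemma Im_genfun_diff: "Im_genfun (\<lambda>r l. c r l - d r l) = Im_genfun c - Im_genfun d"
proof (intro fps_ext)
  fix r l
  have "fls_const (c r l - d r l) = fls_const (c r l) - fls_const (d r l)" by (rule fls_eqI) simp
  then show "Im_genfun (\<lambda>r l. c r l - d r l) $ r $ l = (Im_genfun c - Im_genfun d) $ r $ l"
    by (simp only: Im_genfun_nth fps_sub_nth left_diff_distrib)
qed

lemma Im_genfun_0: "Im_genfun (\<lambda>r l. 0) = 0"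
  by (intro fps_ext) (simp add: Im_genfun_nth del: fls_const_0 fls_X_intpow_times_conv_shift)

text \<open>
  The series \<open>(z + y)\<^sup>k (z + x)\<^bsup>-k-1\<^esup>\<close>, as \<open>powi_point\<close> shows.
\<close>

definition point_genfun :: "int \<Rightarrow> xyz_series" where
  "point_genfun k = Im_genfun (\<lambda>r l. (of_int (- k - 1) gchoose r) * (of_int k gchoose l))"

lemma X_times_point:
  "fls_X * (fls_const c * fls_X_intpow (- int r - int l - 1)) = (fls_const c * fls_X_intpow (- int r - int l) :: complex fls)"
proof -
  have "fls_X * (fls_const c * fls_X_intpow (- int r - int l - 1)) =
      (fls_const c * (fls_X * fls_X_intpow (- int r - int l - 1)) :: complex fls)"
    by (simp only: mult.left_commute)
  then show ?thesis by (simp only: fls_X_times_intpow diff_add_cancel)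
qed

lemma gchoose_Pascal: "(a + 1 gchoose l) = (a gchoose l) + (if l = 0 then 0 else a gchoose (l - 1))" for a :: complex
  by (cases l) (simp_all add: gbinomial_Suc_Suc)

lemma shift_point:
  "r \<noteq> 0 \<Longrightarrow> fls_const c * fls_X_intpow (- int (r - 1) - int l - 1) = (fls_const c * fls_X_intpow (- int r - int l) :: complex fls)"
  "l \<noteq> 0 \<Longrightarrow> fls_const c * fls_X_intpow (- int r - int (l - 1) - 1) = (fls_const c * fls_X_intpow (- int r - int l) :: complex fls)"
  by (simp_all add: of_nat_diff del: fls_X_intpow_times_conv_shift)

lemma zx_times_point:
  "((ser_z + ser_x) * point_genfun k) $ r $ l =
    fls_const ((of_int (- k) gchoose r) * (of_int k gchoose l)) * fls_X_intpow (- int r - int l)"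
proof -
  have e: "(of_int (- k) :: complex) = of_int (- k - 1) + 1" by simp
  have "((ser_z + ser_x) * point_genfun k) $ r $ l =
      fls_const ((of_int (- k - 1) gchoose r) * (of_int k gchoose l)) * fls_X_intpow (- int r - int l) +
      fls_const ((if r = 0 then 0 else of_int (- k - 1) gchoose (r - 1)) * (of_int k gchoose l)) * fls_X_intpow (- int r - int l)"
    unfolding distrib_right fps_add_nth ser_z_nth ser_x_nth point_genfun_def Im_genfun_nth X_times_point
    by (cases "r = 0") (simp_all only: simp_thms if_True if_False shift_point(1) mult_zero_left fls_const_0 not_False_eq_True)
  also have "\<dots> = fls_const ((of_int (- k) gchoose r) * (of_int k gchoose l)) * fls_X_intpow (- int r - int l)"
    unfolding e gchoose_Pascal distrib_right fls_plus_const[symmetric] ..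
  finally show ?thesis .
qed

lemma zy_times_point:
  "((ser_z + ser_y) * point_genfun k) $ r $ l =
    fls_const ((of_int (- k - 1) gchoose r) * (of_int (k + 1) gchoose l)) * fls_X_intpow (- int r - int l)"
proof -
  have e: "(of_int (k + 1) :: complex) = of_int k + 1" by simp
  have "((ser_z + ser_y) * point_genfun k) $ r $ l =
      fls_const ((of_int (- k - 1) gchoose r) * (of_int k gchoose l)) * fls_X_intpow (- int r - int l) +
      fls_const ((of_int (- k - 1) gchoose r) * (if l = 0 then 0 else of_int k gchoose (l - 1))) * fls_X_intpow (- int r - int l)"
    unfolding distrib_right fps_add_nth ser_z_nth ser_y_nth point_genfun_def Im_genfun_nth X_times_point
    by (cases "l = 0") (simp_all only: simp_thms if_True if_False shift_point(2) mult_zero_left mult_zero_right fls_const_0 not_False_eq_True)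
  also have "\<dots> = fls_const ((of_int (- k - 1) gchoose r) * (of_int (k + 1) gchoose l)) * fls_X_intpow (- int r - int l)"
    unfolding e gchoose_Pascal distrib_left fls_plus_const[symmetric] distrib_right ..
  finally show ?thesis .
qed

text \<open>
  Pascal's rule, applied to the lower indices belonging to \<open>x\<close> on one side and to \<open>y\<close> on the other.
\<close>

lemma point_genfun_Suc: "(ser_z + ser_x) * point_genfun (k + 1) = (ser_z + ser_y) * point_genfun k"
proof -
  have "- (k + 1) = - k - 1" by simp
  then show ?thesis by (intro fps_ext) (simp only: zx_times_point zy_times_point)
qed

lemma point_genfun_0: "(ser_z + ser_x) * point_genfun 0 = 1"
proof (intro fps_ext)
  fix r l
  show "((ser_z + ser_x) * point_genfun 0) $ r $ l = 1 $ r $ l"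
    unfolding zx_times_point by (cases r; cases l) simp_all
qed

lemma inverse_zx: "inverse (ser_z + ser_x) = inv_x"
  by (rule nested_inverse_unique) (rule inv_x)

lemma powi_point: "((ser_z + ser_y) * inverse (ser_z + ser_x)) powi k = (ser_z + ser_x) * point_genfun k"
proof -
  let ?U = "(ser_z + ser_y) * inv_x" and ?V = "(ser_z + ser_x) * inv_y"
  have "?U * ?V = ((ser_z + ser_x) * inv_x) * ((ser_z + ser_y) * inv_y)"
    by (simp only: mult_ac)
  then have UV: "?U * ?V = 1" by (simp only: inv_x inv_y mult_1)
  have step: "(ser_z + ser_x) * point_genfun (k + 1) = ?U * ((ser_z + ser_x) * point_genfun k)" for k
  proof -
    have "?U * ((ser_z + ser_x) * point_genfun k) = ((ser_z + ser_x) * inv_x) * ((ser_z + ser_y) * point_genfun k)"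
      by (simp only: mult_ac)
    then show ?thesis by (simp only: inv_x mult_1 point_genfun_Suc)
  qed
  have pos: "?U ^ m = (ser_z + ser_x) * point_genfun (int m)" for m
  proof (induction m)
    case (Suc m)
    then show ?case using step[of "int m"] by (simp only: power_Suc of_nat_Suc add.commute)
  qed (simp add: point_genfun_0)
  have neg: "?V ^ m = (ser_z + ser_x) * point_genfun (- int m)" for m
  proof (induction m)
    case (Suc m)
    have "?V ^ Suc m = ?V * (?U * ((ser_z + ser_x) * point_genfun (- int (Suc m))))"
      using step[of "- int (Suc m)"] Suc by simp
    also have "\<dots> = (?U * ?V) * ((ser_z + ser_x) * point_genfun (- int (Suc m)))"
      by (simp only: mult_ac)
    finally show ?case by (simp only: UV mult_1)
  qed (simp add: point_genfun_0)
  show ?thesis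
  proof (cases "k \<ge> 0")
    case True
    then have "int (nat k) = k" by simp
    then show ?thesis
      using pos[of "nat k"] True by (simp only: inverse_zx power_int_def if_True)
  next
    case False
    then have "- int (nat (- k)) = k" by simp
    then show ?thesis
      using neg[of "nat (- k)"] False by (simp only: inverse_zx power_int_def nested_inverse_unique[OF UV] if_False)
  qed
qed

text \<open>
  Write \<open>U = (z + y) / (z + x)\<close>.  Passing from \<open>\<iota>\<close> to \<open>\<iota> + 1\<close> lowers the coefficient of the
  summand \<open>k = \<iota>\<close> by \<open>1\<close> and changes no other, which subtracts
  \<open>(x - y) (z + y)\<^sup>\<iota> (z + x)\<^bsup>-\<iota>-1\<^esup> = U\<^sup>\<iota> - U\<^bsup>\<iota>+1\<^esup>\<close> from \<open>(x - y) F\<^sub>\<iota>\<close>.  Hence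
  \<open>(x - y) F\<^sub>\<iota> - U\<^sup>\<iota>\<close> does not depend on \<open>\<iota>\<close>, and for \<open>\<iota> = 0\<close> it equals \<open>-1\<close>.
\<close>

lemma is_Im_step:
  "is_Im \<iota> (\<lambda>r l. \<Sum>k\<in>{-\<bar>\<iota>\<bar>..\<bar>\<iota>\<bar>}. (step \<iota> k - step 0 k) * ((of_int (- k - 1) gchoose r) * (of_int k gchoose l)))"
    (is "is_Im \<iota> (?c \<iota>)")
proof -
  have sup: "?c \<iota> r l = (\<Sum>k\<in>I. (step \<iota> k - step 0 k) * ((of_int (- k - 1) gchoose r) * (of_int k gchoose l)))"
    if "finite I" "{-\<bar>\<iota>\<bar>..\<bar>\<iota>\<bar>} \<subseteq> I" for \<iota> I r l
    by (rule sum.mono_neutral_left) (use that in \<open>auto simp: step_def\<close>)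
  have "?c \<iota> r l - ?c (\<iota> + 1) r l = (of_int (- \<iota> - 1) gchoose r) * (of_int \<iota> gchoose l)" for \<iota> r l
  proof -
    let ?I = "{-\<bar>\<iota>\<bar>-1..\<bar>\<iota>\<bar>+1}"
    have "?c \<iota> r l - ?c (\<iota> + 1) r l = (\<Sum>k\<in>?I. (step \<iota> k - step (\<iota> + 1) k) * ((of_int (- k - 1) gchoose r) * (of_int k gchoose l)))"
      by (subst (1 2) sup[of ?I]) (auto simp: sum_subtractf[symmetric] left_diff_distrib)
    also have "\<dots> = (\<Sum>k\<in>?I. if k = \<iota> then (of_int (- \<iota> - 1) gchoose r) * (of_int \<iota> gchoose l) else 0)"
      by (intro sum.cong refl) (auto simp: step_def)
    also have "\<dots> = (of_int (- \<iota> - 1) gchoose r) * (of_int \<iota> gchoose l)"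
      by (subst sum.delta) auto
    finally show ?thesis .
  qed
  then have rec: "Im_genfun (?c \<iota>) - Im_genfun (?c (\<iota> + 1)) = point_genfun \<iota>" for \<iota>
    unfolding point_genfun_def Im_genfun_diff[symmetric] by simp
  define H where "H \<iota> = (ser_x - ser_y) * Im_genfun (?c \<iota>) - (ser_z + ser_x) * point_genfun \<iota>" for \<iota>
  have H: "H (\<iota> + 1) = H \<iota>" for \<iota>
  proof -
    have "H \<iota> - H (\<iota> + 1) = (ser_x - ser_y) * (Im_genfun (?c \<iota>) - Im_genfun (?c (\<iota> + 1))) -
        (ser_z + ser_x) * point_genfun \<iota> + (ser_z + ser_x) * point_genfun (\<iota> + 1)"
      by (simp add: H_def right_diff_distrib)
    also have "\<dots> = 0" unfolding rec point_genfun_Suc by (simp add: algebra_simps)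
    finally show ?thesis by simp
  qed
  have "H \<iota> = H 0"
  proof (induction \<iota> rule: int_induct[of _ 0])
    case (step2 i)
    then show ?case using H[of "i - 1"] by simp
  qed (simp_all add: H)
  also have "H 0 = - 1"
    unfolding H_def point_genfun_0 by (simp add: Im_genfun_0)
  finally show ?thesis
    unfolding is_Im_def powi_point H_def by (simp add: algebra_simps)
qed

lemma Im_const_eq:
  "fact r * fact l * Im_const \<iota> r l =
    (\<Sum>k\<in>{-\<bar>\<iota>\<bar>..\<bar>\<iota>\<bar>}. (step \<iota> k - step 0 k) * (ffact (of_int (- k - 1)) r * ffact (of_int k) l))"
  unfolding is_Im_unique[OF is_Im_Im_const is_Im_step] sum_distrib_left ffact_conv_gbinomial
  by (intro sum.cong refl) (simp add: mult_ac)

section \<open>The representation\<close>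

locale smooth_module = check_setting scale tr \<tau> n B BB \<pi> \<epsilon> ell \<iota> + N: vector_space scaleN
  for scale :: "complex \<Rightarrow> 'a::ring_1 \<Rightarrow> 'a" and tr \<tau> n B BB \<pi> \<epsilon> ell \<iota>
    and scaleN :: "complex \<Rightarrow> 'v::ab_group_add \<Rightarrow> 'v" +
  fixes \<rho> :: "'a check_alg \<Rightarrow> 'v \<Rightarrow> 'v" and N0 :: "'v set" and m0 :: nat
  assumes rep: "lie_representation (ext_scale scale) (check_bracket tr) check_L scaleN \<rho>"
    and generated: "generates_module check_L scaleN \<rho> N0"
    and N0_killed: "\<forall>x\<in>check_above m0. \<forall>v\<in>N0. \<rho> x v = 0"
begin

lemma rho_linear: "x \<in> check_L \<Longrightarrow> Vector_Spaces.linear scaleN scaleN (\<rho> x)"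
  and rho_add: "x \<in> check_L \<Longrightarrow> y \<in> check_L \<Longrightarrow> \<rho> (x + y) v = \<rho> x v + \<rho> y v"
  and rho_scale: "x \<in> check_L \<Longrightarrow> \<rho> (ext_scale scale c x) v = scaleN c (\<rho> x v)"
  and rho_bracket: "x \<in> check_L \<Longrightarrow> y \<in> check_L \<Longrightarrow> \<rho> (check_bracket tr x y) v = \<rho> x (\<rho> y v) - \<rho> y (\<rho> x v)"
  using rep unfolding lie_representation_def by blast+

lemma rho_vadd: "x \<in> check_L \<Longrightarrow> \<rho> x (v + w) = \<rho> x v + \<rho> x w"
  and rho_vscale: "x \<in> check_L \<Longrightarrow> \<rho> x (scaleN c v) = scaleN c (\<rho> x v)"
  by (rule module_hom.add[OF Vector_Spaces.linear.axioms(3)[OF rho_linear]] module_hom.scale[OF Vector_Spaces.linear.axioms(3)[OF rho_linear]]; assumption)+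

lemma rho_v0: "x \<in> check_L \<Longrightarrow> \<rho> x 0 = 0"
  using rho_vadd[of x 0 0] by simp

lemma zero_in_check_L: "0 \<in> check_L"
  by (rule checkV.subspace_0[OF check_L_subspace])

lemma rho_0: "\<rho> 0 v = 0"
  using rho_add[OF zero_in_check_L zero_in_check_L, of v] by simp

lemma rho_sum:
  "(\<And>i. i \<in> I \<Longrightarrow> f i \<in> check_L) \<Longrightarrow> \<rho> (\<Sum>i\<in>I. f i) v = (\<Sum>i\<in>I. \<rho> (f i) v)"
proof (induction I rule: infinite_finite_induct)
  case (insert i I)
  then show ?case
    by (simp add: rho_add checkV.subspace_sum[OF check_L_subspace])
qed (simp_all add: rho_0)

text \<open>
  The vectors annihilated by all sufficiently far elements form a subspace, which contains the
  generating subspace.  It is invariant: if \<open>y\<close> is far enough to commute with \<open>x\<close> then \<open>y x w = x y w\<close>.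
\<close>

lemma eventually_killed: "\<exists>m. \<forall>x\<in>check_above m. \<rho> x v = 0"
proof -
  obtain c :: nat where c: "int c \<ge> 2 * \<bar>\<iota>\<bar> + ell_max" by (meson nat_le_iff order_refl)
  let ?W = "{v. \<exists>m. \<forall>x\<in>check_above m. \<rho> x v = 0}"
  have larger: "\<exists>m\<ge>k. \<forall>x\<in>check_above m. \<rho> x v = 0" if v: "v \<in> ?W" for v k
  proof -
    obtain m where "\<forall>x\<in>check_above m. \<rho> x v = 0" using v by blast
    then show ?thesis using check_above_antimono[of m "max m k"] by (intro exI[of _ "max m k"]) auto
  qed
  have sub: "check_above m \<subseteq> check_L" if "m \<ge> c" for m
    by (rule check_above_subset) (use c that in linarith)
  have 1: "N.subspace ?W"
  proof (rule N.subspaceI)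
    show "0 \<in> ?W" using rho_v0 sub by blast
  next
    fix v w assume "v \<in> ?W" "w \<in> ?W"
    then obtain m where m: "m \<ge> c" "\<forall>x\<in>check_above m. \<rho> x v = 0" using larger by blast
    obtain m' where m': "m' \<ge> m" "\<forall>x\<in>check_above m'. \<rho> x w = 0" using larger[OF \<open>w \<in> ?W\<close>] by blast
    have "\<rho> x (v + w) = 0" if "x \<in> check_above m'" for x
    proof -
      have "m' \<ge> c" using m m' by simp
      then have "x \<in> check_L" using that sub by blast
      moreover have "x \<in> check_above m" using that m'(1) check_above_antimono by blast
      ultimately show ?thesis using that m(2) m'(2) rho_vadd[of x v w] by simp
    qed
    then show "v + w \<in> ?W" by blast
  next
    fix a v assume "v \<in> ?W"
    then obtain m where m: "m \<ge> c" "\<forall>x\<in>check_above m. \<rho> x v = 0" using larger by blast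
    then have "\<rho> x (scaleN a v) = 0" if "x \<in> check_above m" for x
    proof -
      have "x \<in> check_L" using that sub m by blast
      then show ?thesis using that m(2) rho_vscale[of x a v] by simp
    qed
    then show "scaleN a v \<in> ?W" by blast
  qed
  have 2: "N0 \<subseteq> ?W" using N0_killed by blast
  have 3: "\<rho> x w \<in> ?W" if x: "x \<in> check_L" and w: "w \<in> ?W" for x w
  proof -
    obtain m1 where m1: "\<forall>m\<ge>m1. \<forall>y\<in>check_above m. check_bracket tr y x = 0"
      using check_bracket_above by blast
    obtain m where m: "m \<ge> max m1 c" "\<forall>y\<in>check_above m. \<rho> y w = 0" using larger[OF w] by blast
    have "\<rho> y (\<rho> x w) = 0" if y: "y \<in> check_above m" for y
    proof -
      have "y \<in> check_L" using sub[of m] m y by auto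
      moreover have "check_bracket tr y x = 0" using m1 m(1) y by (meson max.boundedE)
      moreover have "\<rho> y w = 0" using m(2) y by blast
      ultimately show ?thesis
        using rho_bracket[of y x w] x by (simp add: rho_0 rho_v0)
    qed
    then show ?thesis by blast
  qed
  have "?W = UNIV"
    by (rule generated[unfolded generates_module_def, THEN spec, THEN mp]) (intro conjI ballI 1 2 3)
  then show ?thesis by blast
qed

lemma lift_skew_killed:
  "\<exists>R. \<forall>Y. skew Y \<longrightarrow> finite (support Y) \<longrightarrow> bandwidth b Y \<longrightarrow>
     (\<forall>p q. ent Y p q \<noteq> 0 \<longrightarrow> \<bar>p\<bar> \<ge> R) \<longrightarrow> \<rho> (lift_skew Y) v = 0"
proof -
  obtain m where m: "\<forall>x\<in>check_above m. \<rho> x v = 0" using eventually_killed by blast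
  show ?thesis
    by (intro exI[of _ "int m + 2 * \<bar>\<iota>\<bar> + ell_max + b + 3"] allI impI m[rule_format] lift_skew_in_above)
      auto
qed

lemma gen_killed:
  "\<exists>R. \<forall>i\<in>{1..n}. \<forall>j\<in>{1..n}. \<forall>a\<in>BB i j. \<forall>p u. \<rho> (gen i j a (half p) (half u)) v \<noteq> 0 \<longrightarrow>
    \<not> (p \<ge> R \<and> - u \<ge> R) \<and> \<not> (- p \<ge> R \<and> u \<ge> R)"
proof -
  obtain m where m: "\<forall>x\<in>check_above m. \<rho> x v = 0" using eventually_killed by blast
  show ?thesis
    using gen_in_above[of _ _ _ m] gen_in_above_swapped[of _ _ _ m] m
    by (intro exI[of _ "int m + 2 * \<bar>\<iota>\<bar> + ell_max + 2"]) blast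
qed

text \<open>
  The pairs of indices that contribute to one coefficient of the defining series, in terms of powers of \<open>t\<close>.
\<close>

definition mode_set :: "nat \<Rightarrow> nat \<Rightarrow> 'a \<Rightarrow> int \<Rightarrow> 'v \<Rightarrow> (int \<times> int) set" where
  "mode_set i j a s v = {(p, u). half p \<in> idx ell \<iota> i \<and> half u \<in> idx ell \<iota> j \<and> p + u = s \<and>
     \<rho> (gen i j a (half p) (half u)) v \<noteq> 0}"

lemma finite_mode_set:
  assumes "i \<in> {1..n}" "j \<in> {1..n}" "a \<in> BB i j"
  shows "finite (mode_set i j a s v)"
proof -
  obtain R where R: "\<And>p u. \<rho> (gen i j a (half p) (half u)) v \<noteq> 0 \<Longrightarrow>
    \<not> (p \<ge> R \<and> - u \<ge> R) \<and> \<not> (- p \<ge> R \<and> u \<ge> R)"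
    using gen_killed assms by metis
  have "mode_set i j a s v \<subseteq> (\<lambda>p. (p, s - p)) ` {-\<bar>R\<bar>-\<bar>s\<bar>..\<bar>R\<bar>+\<bar>s\<bar>}"
  proof (rule subrelI)
    fix p u assume "(p, u) \<in> mode_set i j a s v"
    then have "p + u = s" "\<not> (p \<ge> R \<and> - u \<ge> R) \<and> \<not> (- p \<ge> R \<and> u \<ge> R)"
      using R by (auto simp: mode_set_def)
    then have "u = s - p" "p \<in> {-\<bar>R\<bar>-\<bar>s\<bar>..\<bar>R\<bar>+\<bar>s\<bar>}" by auto
    then show "(p, u) \<in> (\<lambda>p. (p, s - p)) ` {-\<bar>R\<bar>-\<bar>s\<bar>..\<bar>R\<bar>+\<bar>s\<bar>}" by blast
  qed
  then show ?thesis by (rule finite_subset) simp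
qed

lemma mode_set_image:
  "{(l1, l2). l1 \<in> idx ell \<iota> i \<and> l2 \<in> idx ell \<iota> j \<and> l1 + l2 = of_int s - 2 * of_int \<iota> + 1 \<and>
      \<rho> (gen i j a l1 l2) v \<noteq> 0} = (\<lambda>(p, u). (half p, half u)) ` mode_set i j a s v"
proof -
  have "half p + half u = of_int s - 2 * of_int \<iota> + 1 \<longleftrightarrow> p + u = s" for p u
  proof -
    have "half p + half u = of_int (p + u) - 2 * of_int \<iota> + 1" by (simp add: half_def)
    then have "half p + half u = of_int s - 2 * of_int \<iota> + 1 \<longleftrightarrow> real_of_int (p + u) = of_int s" by linarith
    then show ?thesis by (simp only: of_int_eq_iff)
  qed
  then show ?thesis
    unfolding mode_set_def using idx_imp_half by (auto simp: image_iff) metis+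
qed

lemma finite_modes:
  fixes d :: real
  assumes "i \<in> {1..n}" "j \<in> {1..n}" "a \<in> BB i j"
  shows "finite {(l1, l2). l1 \<in> idx ell \<iota> i \<and> l2 \<in> idx ell \<iota> j \<and> l1 + l2 = d \<and> \<rho> (gen i j a l1 l2) v \<noteq> 0}"
    (is "finite ?S")
proof (cases "?S = {}")
  case False
  then obtain l1 l2 where l: "(l1, l2) \<in> ?S" by auto
  then obtain p u where "l1 = half p" "l2 = half u" "l1 + l2 = d" using idx_imp_half by blast
  then have d: "d = of_int (p + u) - 2 * of_int \<iota> + 1" by (simp add: half_def)
  show ?thesis unfolding d mode_set_image using finite_mode_set[OF assms] by simp
qed (simp only: finite.emptyI)

subsection \<open>Approximations\<close>

text \<open>
  For an element \<open>Y L + c \<kappa>\<close>, the truncation \<open>P Y\<^sub>K L\<close> with the central term \<open>c\<close> plus a correction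
  that accounts for the difference of the two cocycles.
\<close>

definition approx :: "int \<Rightarrow> 'a hat_alg \<Rightarrow> 'a check_alg" where
  "approx K x = (to_check (proj * window K (mat (fst x))), shift_trace \<iota> (mat (fst x)) + snd x)"

lemma approx_eq:
  assumes "mat (fst x) = Y * weight"
  shows "approx K x = lift_skew (trunc K Y) + ext_scale scale (shift_trace \<iota> (mat (fst x)) + snd x) central"
  unfolding approx_def lift_skew_def assms window_times_weight
  by (simp add: ext_scale_def central_def map_scale_0 mult.assoc)

lemma hat_L_cases:
  assumes "x \<in> hat_L"
  obtains Y where "skew Y" "mat (fst x) = Y * weight"
  using hat_sub_imp[OF assms] by blast

lemma approx_in_check_L:
  assumes "x \<in> hat_L" shows "approx K x \<in> check_L"
proof -
  obtain Y where Y: "skew Y" "mat (fst x) = Y * weight" using hat_L_cases[OF assms] .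
  show ?thesis
    unfolding approx_eq[OF Y(2)]
    by (intro checkV.subspace_add[OF check_L_subspace] checkV.subspace_scale[OF check_L_subspace]
      lift_skew_in_check_L skew_trunc finite_support_trunc central_in_check_L Y)
qed

lemma rho_approx:
  assumes "skew Y" "mat (fst x) = Y * weight"
  shows "\<rho> (approx K x) v = \<rho> (lift_skew (trunc K Y)) v + scaleN (shift_trace \<iota> (mat (fst x)) + snd x) (\<rho> central v)"
  unfolding approx_eq[OF assms(2)]
  by (subst rho_add) (auto simp: rho_scale central_in_check_L lift_skew_in_check_L skew_trunc finite_support_trunc assms
    checkV.subspace_scale[OF check_L_subspace])

lemma approx_stable:
  assumes "x \<in> hat_L"
  shows "\<exists>K0. \<forall>K\<ge>K0. \<rho> (approx K x) v = \<rho> (approx K0 x) v"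
proof -
  obtain Y where Y: "skew Y" "mat (fst x) = Y * weight" using hat_L_cases[OF assms] .
  obtain b where b: "b \<ge> 0" "bandwidth b Y" using ex_bandwidth by blast
  obtain R where R: "\<And>Z. skew Z \<Longrightarrow> finite (support Z) \<Longrightarrow> bandwidth b Z \<Longrightarrow>
     (\<And>p q. ent Z p q \<noteq> 0 \<Longrightarrow> \<bar>p\<bar> \<ge> R) \<Longrightarrow> \<rho> (lift_skew Z) v = 0"
    using lift_skew_killed[of b v] by blast
  have "\<rho> (lift_skew (trunc K Y)) v = \<rho> (lift_skew (trunc (R + b) Y)) v" if "K \<ge> R + b" for K
  proof -
    let ?D = "trunc K Y - trunc (R + b) Y"
    have D: "skew ?D" "finite (support ?D)" "bandwidth b ?D"
      by (intro skew_diff skew_trunc finite_support_diff finite_support_trunc bandwidth_diff bandwidth_trunc Y b)+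
    have ag: "agree R (trunc K Y) (trunc (R + b) Y)"
    proof -
      have "agree R (trunc K Y) Y" "agree R (trunc (R + b) Y) Y"
        using agree_mono[OF agree_trunc[OF b(2), of K], of R] agree_trunc[OF b(2), of "R + b"] that by simp_all
      then show ?thesis by (simp add: agree_def)
    qed
    have "\<bar>p\<bar> \<ge> R" if "ent ?D p q \<noteq> 0" for p q
    proof (rule ccontr)
      assume "\<not> \<bar>p\<bar> \<ge> R"
      then have "ent (trunc K Y) p q = ent (trunc (R + b) Y) p q" using ag by (simp add: agree_def)
      with that show False by simp
    qed
    from R[OF D this] have "\<rho> (lift_skew ?D) v = 0" .
    moreover have "trunc K Y = trunc (R + b) Y + ?D" by simp
    then have "lift_skew (trunc K Y) = lift_skew (trunc (R + b) Y) + lift_skew ?D"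
      using lift_skew_add[OF finite_support_trunc D(2), of "R + b" Y] by metis
    ultimately show ?thesis
      using rho_add[of "lift_skew (trunc (R + b) Y)" "lift_skew ?D" v] lift_skew_in_check_L D Y
      by (simp add: skew_trunc finite_support_trunc)
  qed
  then have "\<forall>K\<ge>R + b. \<rho> (approx K x) v = \<rho> (approx (R + b) x) v"
    unfolding rho_approx[OF Y] by metis
  then show ?thesis by blast
qed

text \<open>
  The action of \<open>approx K x\<close> on \<open>v\<close> for any sufficiently large \<open>K\<close>.
\<close>

definition sigma :: "'a hat_alg \<Rightarrow> 'v \<Rightarrow> 'v" where
  "sigma = (\<lambda>x\<in>hat_L. \<lambda>v. \<rho> (approx (SOME K0. \<forall>K\<ge>K0. \<rho> (approx K x) v = \<rho> (approx K0 x) v) x) v)"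

lemma sigma_approx:
  assumes "x \<in> hat_L"
  shows "\<exists>K0. \<forall>K\<ge>K0. sigma x v = \<rho> (approx K x) v"
proof -
  define k where "k = (SOME K0. \<forall>K\<ge>K0. \<rho> (approx K x) v = \<rho> (approx K0 x) v)"
  have K: "\<forall>K\<ge>k. \<rho> (approx K x) v = \<rho> (approx k x) v"
    unfolding k_def by (rule someI_ex[OF approx_stable[OF assms]])
  have e: "sigma x v = \<rho> (approx k x) v"
    unfolding sigma_def restrict_apply'[OF assms] k_def ..
  show ?thesis
  proof (intro exI allI impI)
    fix K assume "K \<ge> k"
    with K have "\<rho> (approx K x) v = \<rho> (approx k x) v" by blast
    then show "sigma x v = \<rho> (approx K x) v" using e by simp
  qed
qed

lemma finite_support_window: "finite (support (proj * window K M))"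
proof -
  let ?J = "{-K..<K}"
  have "support (window K M) \<subseteq> ?J \<times> (\<Union>j\<in>{1..n}. (\<lambda>q. q + int (ell j)) ` ?J)"
  proof (rule subrelI)
    fix p k assume "(p, k) \<in> support (window K M)"
    then have "ent (window K M) p k \<noteq> 0" by (simp add: support_def)
    then obtain j where "j \<in> {1..n}" "p \<in> ?J" "k - int (ell j) \<in> ?J"
      unfolding ent_window by (elim sum.not_neutral_contains_not_neutral) (auto split: if_splits)
    then show "(p, k) \<in> ?J \<times> (\<Union>j\<in>{1..n}. (\<lambda>q. q + int (ell j)) ` ?J)"
      by (intro SigmaI UN_I[of j] image_eqI[of _ _ "k - int (ell j)"]) auto
  qed
  then have "finite (support (window K M))" by (rule finite_subset) auto
  then show ?thesis by (simp add: finite_support_times)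
qed

lemma approx_add: "approx K (x + y) = approx K x + approx K y"
  by (simp add: approx_def mat_add window_add distrib_left to_check_add finite_support_window shift_trace_add)

lemma to_check_bscale:
  assumes "finite (support F)"
  shows "to_check (bscale c F) = Poly_Mapping.map (scale c) (to_check F)"
proof (rule poly_mapping_eqI)
  fix z
  have "support (bscale c F) \<subseteq> support F" by (auto simp: support_def ent_bscale)
  then have "lookup (to_check (bscale c F)) z =
      lookup (\<Sum>(p, k)\<in>support F. single (key p k) (scale c (ent F p k))) z"
    by (subst to_check_superset[OF assms]) (simp_all add: ent_bscale)
  also have "\<dots> =
      scale c (lookup (\<Sum>(p, k)\<in>support F. single (key p k) (ent F p k)) z)"
    unfolding lookup_sum scale_sum_right by (intro sum.cong refl) (auto simp: lookup_single when_def)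
  also have "\<dots> = lookup (Poly_Mapping.map (scale c) (to_check F)) z"
    by (simp add: to_check_def lookup_map_scale)
  finally show "lookup (to_check (bscale c F)) z = lookup (Poly_Mapping.map (scale c) (to_check F)) z" .
qed

lemma times_bscale: "M * bscale c N = bscale c (M * N)"
  by (rule band_eqI) (simp add: ent_bscale times_band.rep_eq scale_mult_right scale_sum_right)

lemma shift_trace_bscale: "shift_trace k (bscale c M) = c * shift_trace k M"
  unfolding shift_trace_def ent_bscale tr.scale sum_distrib_left
  by (intro sum.cong refl) (rule mult.left_commute)

lemma approx_scale: "approx K (ext_scale scale c x) = ext_scale scale c (approx K x)"
  unfolding approx_def ext_scale_def fst_conv snd_conv mat_map_scale window_bscale times_bscale
    to_check_bscale[OF finite_support_window] shift_trace_bscale distrib_left ..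

lemma hat_L_subspace: "hatV.subspace hat_L"
  unfolding hat_sub_def by (rule hatV.subspace_span)

lemma sigma_add:
  assumes "x \<in> hat_L" "y \<in> hat_L" shows "sigma (x + y) v = sigma x v + sigma y v"
proof -
  obtain K1 where K1: "\<And>K. K \<ge> K1 \<Longrightarrow> sigma x v = \<rho> (approx K x) v" using sigma_approx[OF assms(1)] by blast
  obtain K2 where K2: "\<And>K. K \<ge> K2 \<Longrightarrow> sigma y v = \<rho> (approx K y) v" using sigma_approx[OF assms(2)] by blast
  obtain K3 where K3: "\<And>K. K \<ge> K3 \<Longrightarrow> sigma (x + y) v = \<rho> (approx K (x + y)) v"
    using sigma_approx[OF hatV.subspace_add[OF hat_L_subspace assms]] by blast
  let ?K = "max K1 (max K2 K3)"
  show ?thesis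
    using K1[of ?K] K2[of ?K] K3[of ?K] rho_add[OF approx_in_check_L[OF assms(1)] approx_in_check_L[OF assms(2)], of ?K ?K v]
    by (simp add: approx_add)
qed

lemma sigma_scale:
  assumes "x \<in> hat_L" shows "sigma (ext_scale scale c x) v = scaleN c (sigma x v)"
proof -
  obtain K1 where K1: "\<And>K. K \<ge> K1 \<Longrightarrow> sigma x v = \<rho> (approx K x) v" using sigma_approx[OF assms(1)] by blast
  obtain K3 where K3: "\<And>K. K \<ge> K3 \<Longrightarrow> sigma (ext_scale scale c x) v = \<rho> (approx K (ext_scale scale c x)) v"
    using sigma_approx[OF hatV.subspace_scale[OF hat_L_subspace assms]] by blast
  let ?K = "max K1 K3"
  show ?thesis
    using K1[of ?K] K3[of ?K] rho_scale[OF approx_in_check_L[OF assms(1)], of c ?K v]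
    by (simp add: approx_scale)
qed

lemma sigma_linear:
  assumes "x \<in> hat_L" shows "Vector_Spaces.linear scaleN scaleN (sigma x)"
  unfolding Vector_Spaces.linear_iff
proof (intro conjI allI)
  show "vector_space scaleN" "vector_space scaleN" by (rule N.vector_space_axioms)+
  fix v w c
  obtain K1 where K1: "\<And>K. K \<ge> K1 \<Longrightarrow> sigma x v = \<rho> (approx K x) v" using sigma_approx[OF assms] by blast
  obtain K2 where K2: "\<And>K. K \<ge> K2 \<Longrightarrow> sigma x w = \<rho> (approx K x) w" using sigma_approx[OF assms] by blast
  obtain K3 where K3: "\<And>K. K \<ge> K3 \<Longrightarrow> sigma x (v + w) = \<rho> (approx K x) (v + w)" using sigma_approx[OF assms] by blast
  obtain K4 where K4: "\<And>K. K \<ge> K4 \<Longrightarrow> sigma x (scaleN c v) = \<rho> (approx K x) (scaleN c v)" using sigma_approx[OF assms] by blast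
  let ?K = "max (max K1 K2) (max K3 K4)"
  show "sigma x (v + w) = sigma x v + sigma x w"
    using K1[of ?K] K2[of ?K] K3[of ?K] rho_vadd[OF approx_in_check_L[OF assms], of ?K v w] by simp
  show "sigma x (scaleN c v) = scaleN c (sigma x v)"
    using K1[of ?K] K4[of ?K] rho_vscale[OF approx_in_check_L[OF assms], of ?K c v] by simp
qed

subsection \<open>Compatibility with brackets\<close>

lemma bandwidth_proj: "bandwidth 0 proj"
  by (simp add: bandwidth_def ent_proj)

text \<open>
  Only the entries near the jump of the step function matter, and these agree with those of the
  untruncated matrices up to the factor \<open>P\<close>.  By cyclicity of the trace and \<open>L P = L\<close> this factor can be absorbed.
\<close>

lemma cocycle_trunc:
  assumes b: "b \<ge> 0" "bandwidth b Y" "bandwidth b Z" "bandwidth b weight" and K: "K > \<bar>\<iota>\<bar> + 3 * b"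
  shows "cocycle \<iota> (proj * trunc K Y * weight) (proj * trunc K Z * weight) = cocycle \<iota> (Y * weight) (Z * weight)"
proof -
  let ?I = "{\<iota> - 2 * b..\<iota> + 2 * b}"
  have agr: "agree (K - b) (trunc K X * weight) (X * weight)" if "bandwidth b X" for X
    by (rule agree_times[OF agree_trunc[OF that] agree_refl that])
  have ent: "ent (proj * trunc K X * weight) p k = ent proj p p * ent (X * weight) p k"
    if "bandwidth b X" "p \<in> ?I" for X p k
  proof -
    have "\<bar>p\<bar> < K - b" using that(2) K by auto
    then show ?thesis
      using agr[OF that(1)] unfolding mult.assoc ent_proj_times agree_def by simp
  qed
  have bM: "bandwidth (2 * b) (proj * trunc K Y * weight)" "bandwidth (2 * b) (Y * weight)"
    using bandwidth_times[OF bandwidth_times[OF bandwidth_proj bandwidth_trunc[OF b(2), of K]] b(4)]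
      bandwidth_times[OF b(2,4)] by simp_all
  have wp: "ent (X * weight) p k * ent proj k k = ent (X * weight) p k" for X p k
    using ent_times_proj[of "X * weight" p k] by (simp only: mult.assoc weight_proj)
  have "tr (ent proj p p * ent (Y * weight) p k * (ent proj k k * ent (Z * weight) k p)) =
      tr (ent (Y * weight) p k * ent (Z * weight) k p)" for p k
  proof -
    have "ent proj p p * ent (Y * weight) p k * (ent proj k k * ent (Z * weight) k p) =
        ent proj p p * ((ent (Y * weight) p k * ent proj k k) * ent (Z * weight) k p)"
      by (simp only: mult.assoc)
    also have "tr \<dots> = tr ((ent (Y * weight) p k * ent (Z * weight) k p) * ent proj p p)"
      unfolding wp by (rule tr_commute)
    finally show ?thesis by (simp only: mult.assoc wp)
  qed
  then show ?thesis
    unfolding cocycle_box[OF bM(1) finite_atLeastAtMost_int order_refl] cocycle_box[OF bM(2) finite_atLeastAtMost_int order_refl]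
    by (intro sum.cong refl) (simp only: ent[OF b(2)] ent[OF b(3)])
qed

lemma agree_trunc_product:
  assumes b: "b \<ge> 0" "bandwidth b Y" "bandwidth b Z" "bandwidth b weight"
  shows "agree (K - 3 * b) (trunc K Y * weight * trunc K Z) (Y * weight * Z)"
proof (rule agree_times)
  show "bandwidth (2 * b) (Y * weight)" using bandwidth_times[OF b(2,4)] by simp
  have "agree (K - b) (trunc K Y * weight) (Y * weight)"
    by (rule agree_times[OF agree_trunc[OF b(2)] agree_refl b(2)])
  then show "agree (K - 3 * b) (trunc K Y * weight) (Y * weight)"
    by (rule agree_mono) (use b(1) in simp)
  show "agree (K - 3 * b + 2 * b) (trunc K Z) Z"
    by (rule agree_mono[OF agree_trunc[OF b(3)]]) simp
qed

text \<open>
  Let \<open>W = Y L Z - Z L Y\<close> and \<open>V = Y\<^sub>K L Z\<^sub>K - Z\<^sub>K L Y\<^sub>K\<close>.  The bracket of the approximations of \<open>x\<close>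
  and \<open>y\<close> is \<open>P V L\<close> with a central term, and by \<open>cocycle_shift\<close> that term is the one belonging to the
  approximation \<open>P W\<^sub>K L\<close> of \<open>[x, y]\<close>.  The difference \<open>V - W\<^sub>K\<close> is skew and vanishes in all rows except
  those near or beyond the ends of the window, so it acts as zero on \<open>v\<close>.
\<close>

lemma sigma_bracket:
  assumes x: "x \<in> hat_L" and y: "y \<in> hat_L"
  shows "sigma (hat_bracket scale tr x y) v = sigma x (sigma y v) - sigma y (sigma x v)"
proof -
  let ?xy = "hat_bracket scale tr x y"
  obtain Y where Y: "skew Y" "mat (fst x) = Y * weight" using hat_L_cases[OF x] .
  obtain Z where Z: "skew Z" "mat (fst y) = Z * weight" using hat_L_cases[OF y] .
  define W where "W = Y * weight * Z - Z * weight * Y"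
  have xy: "?xy \<in> hat_L" by (rule hat_bracket_closed[OF x y])
  have W: "skew W" "mat (fst ?xy) = W * weight"
    unfolding W_def by (rule skew_commutator[OF Y(1) Z(1)], rule mat_bracket_weight[OF Y(2) Z(2)])
  obtain b1 where b1: "b1 \<ge> 0" "bandwidth b1 Y" using ex_bandwidth by blast
  obtain b2 where b2: "b2 \<ge> 0" "bandwidth b2 Z" using ex_bandwidth by blast
  obtain b3 where b3: "b3 \<ge> 0" "bandwidth b3 weight" using ex_bandwidth by blast
  define b where "b = max b1 (max b2 b3)"
  have b: "b \<ge> 0" "bandwidth b Y" "bandwidth b Z" "bandwidth b weight"
    using b1 b2 b3 by (auto simp: b_def elim: bandwidth_mono)
  obtain R where R: "\<And>D. skew D \<Longrightarrow> finite (support D) \<Longrightarrow> bandwidth (3 * b) D \<Longrightarrow>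
     (\<And>p q. ent D p q \<noteq> 0 \<Longrightarrow> \<bar>p\<bar> \<ge> R) \<Longrightarrow> \<rho> (lift_skew D) v = 0"
    using lift_skew_killed[of "3 * b" v] by blast
  obtain K1 where K1: "\<And>K. K \<ge> K1 \<Longrightarrow> sigma x v = \<rho> (approx K x) v" using sigma_approx[OF x] by blast
  obtain K2 where K2: "\<And>K. K \<ge> K2 \<Longrightarrow> sigma y v = \<rho> (approx K y) v" using sigma_approx[OF y] by blast
  obtain K3 where K3: "\<And>K. K \<ge> K3 \<Longrightarrow> sigma x (sigma y v) = \<rho> (approx K x) (sigma y v)" using sigma_approx[OF x] by blast
  obtain K4 where K4: "\<And>K. K \<ge> K4 \<Longrightarrow> sigma y (sigma x v) = \<rho> (approx K y) (sigma x v)" using sigma_approx[OF y] by blast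
  obtain K5 where K5: "\<And>K. K \<ge> K5 \<Longrightarrow> sigma ?xy v = \<rho> (approx K ?xy) v" using sigma_approx[OF xy] by blast
  \<comment> \<open>One window serves the five vectors involved; the last two bounds are for the cocycle and for the error term.\<close>
  obtain K where K: "K \<ge> K1" "K \<ge> K2" "K \<ge> K3" "K \<ge> K4" "K \<ge> K5" "K > \<bar>\<iota>\<bar> + 3 * b" "K - 3 * b \<ge> R"
  proof
    let ?K = "\<bar>K1\<bar> + \<bar>K2\<bar> + \<bar>K3\<bar> + \<bar>K4\<bar> + \<bar>K5\<bar> + \<bar>\<iota>\<bar> + 3 * b + \<bar>R\<bar> + 1"
    show "?K \<ge> K1" "?K \<ge> K2" "?K \<ge> K3" "?K \<ge> K4" "?K \<ge> K5" "?K > \<bar>\<iota>\<bar> + 3 * b" "?K - 3 * b \<ge> R"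
      using b(1) by linarith+
  qed
  let ?A = "trunc K Y" and ?C = "trunc K Z"
  define V where "V = ?A * weight * ?C - ?C * weight * ?A"
  define D where "D = V - trunc K W"
  have finV: "finite (support V)"
    unfolding V_def by (intro finite_support_diff finite_support_times disjI2 finite_support_trunc)
  have skewV: "skew V" unfolding V_def by (intro skew_commutator skew_trunc Y Z)
  have D: "skew D" "finite (support D)" "bandwidth (3 * b) D"
  proof -
    show "skew D" unfolding D_def by (intro skew_diff skewV skew_trunc W)
    show "finite (support D)" unfolding D_def by (intro finite_support_diff finV finite_support_trunc)
    have 3: "b + b + b = 3 * b" by simp
    have "bandwidth (b + b + b) V" "bandwidth (b + b + b) (trunc K W)"
      unfolding V_def W_def by (intro bandwidth_trunc bandwidth_diff bandwidth_times b)+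
    then show "bandwidth (3 * b) D" unfolding D_def 3 by (rule bandwidth_diff)
  qed
  have far: "\<bar>p\<bar> \<ge> R" if "ent D p q \<noteq> 0" for p q
  proof (rule ccontr)
    assume "\<not> \<bar>p\<bar> \<ge> R"
    then have p: "\<bar>p\<bar> < K - 3 * b" using K(7) by simp
    have "bandwidth (b + b + b) W" unfolding W_def by (intro bandwidth_diff bandwidth_times b)
    then have "bandwidth (3 * b) W" by simp
    from agree_trunc[OF this, of K] have "ent (trunc K W) p q = ent W p q" using p by (simp add: agree_def)
    moreover have "agree (K - 3 * b) V W"
      unfolding V_def W_def by (intro agree_diff agree_trunc_product b)
    then have "ent V p q = ent W p q" using p by (simp add: agree_def)
    ultimately show False using that by (simp add: D_def)
  qed
  have killed: "\<rho> (lift_skew D) v = 0" by (rule R[OF D far])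
  have fst_approx: "fst (approx K x) = to_check (proj * ?A * weight)" "fst (approx K y) = to_check (proj * ?C * weight)"
    by (simp_all add: approx_def Y(2) Z(2) window_times_weight mult.assoc)
  have pw: "proj * A * weight * (proj * C * weight) = proj * (A * weight * C) * weight" for A C
  proof -
    have "proj * A * weight * (proj * C * weight) = proj * A * (weight * proj) * C * weight" by (simp only: mult.assoc)
    then show ?thesis by (simp only: weight_proj mult.assoc)
  qed
  have "check_bracket tr (approx K x) (approx K y) =
      (to_check (proj * ?A * weight * (proj * ?C * weight) - proj * ?C * weight * (proj * ?A * weight)),
       cocycle \<iota> (proj * ?A * weight) (proj * ?C * weight))"
    by (rule check_bracket_to_check[OF _ _ fst_approx]) (intro finite_support_lift finite_support_trunc)+
  also have "\<dots> = (to_check (proj * V * weight), cocycle \<iota> (Y * weight) (Z * weight))"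
    unfolding pw cocycle_trunc[OF b K(6)] by (simp only: V_def right_diff_distrib left_diff_distrib)
  also have "\<dots> = lift_skew V + ext_scale scale (cocycle \<iota> (Y * weight) (Z * weight)) central"
    by (simp add: lift_skew_def ext_scale_def central_def map_scale_0)
  also have "lift_skew V = lift_skew (trunc K W) + lift_skew D"
  proof -
    have "V = trunc K W + D" by (simp add: D_def)
    then show ?thesis using lift_skew_add[OF finite_support_trunc D(2), of K W] by metis
  qed
  also have "cocycle \<iota> (Y * weight) (Z * weight) = shift_trace \<iota> (mat (fst ?xy)) + snd ?xy"
    unfolding cocycle_shift[of \<iota>] snd_hat_bracket mat_hat_bracket Y(2) Z(2) by simp
  also have "lift_skew (trunc K W) + lift_skew D + ext_scale scale (shift_trace \<iota> (mat (fst ?xy)) + snd ?xy) central =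
      approx K ?xy + lift_skew D"
    unfolding approx_eq[OF W(2)] by (simp only: add_ac)
  finally have "\<rho> (check_bracket tr (approx K x) (approx K y)) v = \<rho> (approx K ?xy) v + \<rho> (lift_skew D) v"
    using rho_add[OF approx_in_check_L[OF xy, of K] lift_skew_in_check_L[OF D(1,2)], of v] by simp
  then have "\<rho> (approx K ?xy) v = \<rho> (approx K x) (\<rho> (approx K y) v) - \<rho> (approx K y) (\<rho> (approx K x) v)"
    using rho_bracket[OF approx_in_check_L[OF x, of K] approx_in_check_L[OF y, of K], of v] killed by simp
  then show ?thesis
    using K1[OF K(1)] K2[OF K(2)] K3[OF K(3)] K4[OF K(4)] K5[OF K(5)] by simp
qed

lemma sigma_representation:
  "lie_representation (ext_scale scale) (hat_bracket scale tr) hat_L scaleN sigma"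
  unfolding lie_representation_def using sigma_linear sigma_add sigma_scale sigma_bracket by blast

lemma central_in_hat_L: "central \<in> hat_L"
  unfolding hat_sub_def by (intro hatV.span_base insertI1)

lemma sigma_central: "sigma central = \<rho> central"
proof
  fix v
  obtain K0 where K0: "\<And>K. K \<ge> K0 \<Longrightarrow> sigma central v = \<rho> (approx K central) v"
    using sigma_approx[OF central_in_hat_L] by blast
  have c: "mat (fst (central :: 'a hat_alg)) = 0 * weight" by (simp add: central_def mat_0)
  have "trunc K0 (0 :: 'a band) = 0" by (rule band_eqI) (simp add: ent_trunc)
  moreover have "lift_skew 0 = 0" by (simp add: lift_skew_def to_check_0 zero_prod_def)
  moreover have "shift_trace \<iota> 0 = 0" by (simp add: shift_trace_def tr.zero)
  ultimately have "approx K0 central = central"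
    unfolding approx_eq[OF c] by (simp add: c) (simp add: central_def ext_scale_def map_scale_0)
  then show "sigma central v = \<rho> central v" using K0[of K0] by simp
qed

end

context smooth_module
begin

subsection \<open>Values on generators\<close>

lemma star_trunc: "star (trunc K M) = trunc K (star M)"
  by (rule band_eqI) (auto simp: ent_star ent_trunc)

lemma trunc_skew_part: "trunc K (X - (-1) ^ \<epsilon> * star X) = trunc K X - (-1) ^ \<epsilon> * star (trunc K X)"
  by (rule band_eqI) (simp add: star_trunc ent_trunc ent_sign_times)

lemma gen_scale: "gen i j (scale c a) (half p) (half u) = ext_scale scale c (gen i j a (half p) (half u))"
  unfolding gen_conv ext_scale_def fst_conv snd_conv map_scale_diff map_scale_single tau.scale mult_zero_right scale_scale
  by (simp only: mult.commute)

text \<open>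
  The entries of the monomial matrix \<open>X\<close> lie on the single diagonal where the row \<open>p\<close> and the column
  \<open>-u - 1\<close> satisfy \<open>p + u = m - r - 1\<close>, and each of them contributes at most one spanning element.
\<close>

lemma rho_lift_trunc_mono:
  fixes m :: int and r :: nat
  assumes i: "i \<in> {1..n}" and j: "j \<in> {1..n}" and a: "a \<in> BB i j"
    and K: "\<And>p u. (p, u) \<in> mode_set i j a (m - int r - 1) v \<Longrightarrow> p \<in> {-K..<K} \<and> - u - 1 \<in> {-K..<K}"
  defines "X \<equiv> mat (single (m, r) a)"
  shows "\<rho> (lift_skew (trunc K (X - (-1) ^ \<epsilon> * star X))) v =
    (\<Sum>(p, u)\<in>mode_set i j a (m - int r - 1) v.
       scaleN (ffact (of_int (- u - 1)) r) (\<rho> (gen i j a (half p) (half u)) v))"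
proof -
  let ?M = "mode_set i j a (m - int r - 1) v"
  define S where "S = {(p, u). p \<in> {-K..<K} \<and> - u - 1 \<in> {-K..<K} \<and> p + u = m - int r - 1}"
  let ?c = "\<lambda>u. ffact (of_int (- u - 1)) r :: complex"
  let ?E = "\<lambda>z. unit_entry (scale (?c (snd z)) a) (fst z) (- snd z - 1)"
  let ?I = "\<lambda>z. half (fst z) \<in> idx ell \<iota> i \<and> half (snd z) \<in> idx ell \<iota> j"
  let ?g = "\<lambda>z. gen i j a (half (fst z)) (half (snd z))"
  have finS: "finite S"
    by (rule finite_subset[of _ "{-K..<K} \<times> {-K - 1..K}"]) (auto simp: S_def)
  have X: "ent X p q = (if p = q + m - int r then scale (ffact (of_int q) r) a else 0)" for p q
    by (simp add: X_def mat_single mono_ent_def)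
  have "trunc K X = (\<Sum>z\<in>S. ?E z)"
  proof (rule band_eqI)
    fix p q
    have "ent (\<Sum>z\<in>S. ?E z) p q = (\<Sum>z\<in>S. if z = (p, - q - 1) then scale (?c (- q - 1)) a else 0)"
      unfolding ent_sum by (intro sum.cong refl) (auto simp: ent_unit_entry)
    also have "\<dots> = (if (p, - q - 1) \<in> S then scale (?c (- q - 1)) a else 0)"
      using finS by (simp add: sum.delta)
    also have "\<dots> = ent (trunc K X) p q"
      by (auto simp: ent_trunc X S_def)
    finally show "ent (trunc K X) p q = ent (\<Sum>z\<in>S. ?E z) p q" ..
  qed
  then have "trunc K (X - (-1) ^ \<epsilon> * star X) = (\<Sum>z\<in>S. ?E z - (-1) ^ \<epsilon> * star (?E z))"
    unfolding trunc_skew_part by (simp only: star_sum sum_distrib_left sum_subtractf)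
  then have "lift_skew (trunc K (X - (-1) ^ \<epsilon> * star X)) = (\<Sum>z\<in>S. lift_skew (?E z - (-1) ^ \<epsilon> * star (?E z)))"
    by (simp only:) (intro lift_skew_sum finite_support_diff finite_support_sign,
      simp_all add: star_unit_entry finite_support_unit_entry)
  also have "\<dots> = (\<Sum>z\<in>S. if ?I z then ext_scale scale (?c (snd z)) (?g z) else 0)"
  proof (intro sum.cong refl)
    fix z :: "int \<times> int"
    have "scale (?c (snd z)) a \<in> BB i j" by (rule subspace_scale[OF BB_subspace[OF i j] a])
    from lift_skew_unit[OF i j this]
    show "lift_skew (?E z - (-1) ^ \<epsilon> * star (?E z)) = (if ?I z then ext_scale scale (?c (snd z)) (?g z) else 0)"
      by (simp only: gen_scale)
  qed
  finally have "\<rho> (lift_skew (trunc K (X - (-1) ^ \<epsilon> * star X))) v =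
      \<rho> (\<Sum>z\<in>S. if ?I z then ext_scale scale (?c (snd z)) (?g z) else 0) v" by simp
  also have "\<dots> = (\<Sum>z\<in>S. \<rho> (if ?I z then ext_scale scale (?c (snd z)) (?g z) else 0) v)"
    by (rule rho_sum) (auto intro: zero_in_check_L checkV.subspace_scale[OF check_L_subspace] gen_in_check_L i j a)
  also have "\<dots> = (\<Sum>z\<in>S. if ?I z then scaleN (?c (snd z)) (\<rho> (?g z) v) else 0)"
    by (intro sum.cong refl) (simp add: rho_0 rho_scale[OF gen_in_check_L[OF i j a]])
  also have "\<dots> = (\<Sum>z\<in>?M. if ?I z then scaleN (?c (snd z)) (\<rho> (?g z) v) else 0)"
  proof (rule sum.mono_neutral_right[OF finS])
    show "?M \<subseteq> S"
    proof (rule subrelI)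
      fix p u assume pu: "(p, u) \<in> ?M"
      then have "p + u = m - int r - 1" by (simp add: mode_set_def)
      with K[OF pu] show "(p, u) \<in> S" by (simp add: S_def)
    qed
    show "\<forall>z\<in>S - ?M. (if ?I z then scaleN (?c (snd z)) (\<rho> (?g z) v) else 0) = 0"
    proof
      fix z assume z: "z \<in> S - ?M"
      then have "?I z \<Longrightarrow> \<rho> (?g z) v = 0" by (auto simp: S_def mode_set_def)
      then show "(if ?I z then scaleN (?c (snd z)) (\<rho> (?g z) v) else 0) = 0" by simp
    qed
  qed
  also have "\<dots> = (\<Sum>(p, u)\<in>?M. scaleN (?c u) (\<rho> (gen i j a (half p) (half u)) v))"
    by (intro sum.cong refl) (auto simp: mode_set_def)
  finally show ?thesis .
qed

lemma ffact_0: "ffact x 0 = 1"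
  by (simp add: ffact_def)

text \<open>
  On the diagonal, \<open>a \<otimes> t\<^sup>m \<partial>\<^bsup>r+\<ell>\<^sub>j\<^esup>\<close> and \<open>\<tau> a \<otimes> (-\<partial>)\<^sup>r t\<^sup>m \<partial>\<^bsup>\<ell>\<^sub>i\<^esup>\<close> have the entries
  \<open>\<langle>k\<rangle>\<^bsub>r+\<ell>\<^sub>j\<^esub> a\<close> and \<open>\<langle>-k-1\<rangle>\<^sub>r \<langle>k\<rangle>\<^bsub>\<ell>\<^sub>i\<^esub> \<tau> a\<close>, if their degree is zero.  So the
  two sums are those of \<open>Im_const_eq\<close>.
\<close>

lemma shift_trace_hat_gen:
  "shift_trace \<iota> (mat (fst (hat_gen scale \<tau> \<epsilon> ell i j a r m))) =
    (if m = int (r + ell j) then fact (r + ell j) * Im_const \<iota> 0 (r + ell j) * tr a else 0) -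
    (if m = int (r + ell i) then (-1) ^ \<epsilon> * fact r * fact (ell i) * Im_const \<iota> r (ell i) * tr a else 0)"
proof -
  let ?D = "dmult (single (0, r) ((-1) ^ r)) (dmono m (ell i))"
  let ?\<delta> = "\<lambda>k. step \<iota> k - step 0 k" and ?J = "{-\<bar>\<iota>\<bar>..\<bar>\<iota>\<bar>}"
  have "mat (fst (hat_gen scale \<tau> \<epsilon> ell i j a r m)) =
      mat (tens scale a (dmono m (r + ell j))) - bscale ((-1) ^ \<epsilon>) (mat (tens scale (\<tau> a) ?D))"
    by (simp add: hat_gen_def mat_diff mat_fst_ext_scale)
  then have "shift_trace \<iota> (mat (fst (hat_gen scale \<tau> \<epsilon> ell i j a r m))) =
      shift_trace \<iota> (mat (tens scale a (dmono m (r + ell j)))) -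
      (-1) ^ \<epsilon> * shift_trace \<iota> (mat (tens scale (\<tau> a) ?D))"
    by (simp only: shift_trace_diff shift_trace_bscale)
  also have "shift_trace \<iota> (mat (tens scale a (dmono m (r + ell j)))) =
      (if m = int (r + ell j) then fact (r + ell j) * Im_const \<iota> 0 (r + ell j) * tr a else 0)"
  proof -
    have "ent (mat (tens scale a (dmono m (r + ell j)))) k k =
        (if m = int (r + ell j) then scale (ffact (of_int k) (r + ell j)) a else 0)" for k
      unfolding tens_dmono mat_single mono_ent_def by auto
    then have "shift_trace \<iota> (mat (tens scale a (dmono m (r + ell j)))) =
        (if m = int (r + ell j) then (\<Sum>k\<in>?J. ?\<delta> k * (ffact (of_int (- k - 1)) 0 * ffact (of_int k) (r + ell j))) * tr a else 0)"
      unfolding shift_trace_def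
      by (cases "m = int (r + ell j)")
        (simp_all only: simp_thms if_True if_False tr.scale tr.zero sum_distrib_right mult.assoc
          mult_zero_right sum.neutral_const ffact_0 mult_1_left)
    then show ?thesis unfolding Im_const_eq[symmetric] by simp
  qed
  also have "shift_trace \<iota> (mat (tens scale (\<tau> a) ?D)) =
      (if m = int (r + ell i) then fact r * fact (ell i) * Im_const \<iota> r (ell i) * tr a else 0)"
  proof -
    have "ent (mat (tens scale (\<tau> a) ?D)) k k =
        (if m = int (r + ell i) then scale (ffact (of_int (- k - 1)) r * ffact (of_int k) (ell i)) (\<tau> a) else 0)" for k
      unfolding ent_mat_adjoint by (auto simp: mult.commute)
    then have "shift_trace \<iota> (mat (tens scale (\<tau> a) ?D)) =
        (if m = int (r + ell i) then (\<Sum>k\<in>?J. ?\<delta> k * (ffact (of_int (- k - 1)) r * ffact (of_int k) (ell i))) * tr a else 0)"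
      unfolding shift_trace_def
      by (cases "m = int (r + ell i)")
        (simp_all only: simp_thms if_True if_False tr.scale tr.zero tr_tau sum_distrib_right mult.assoc
          mult_zero_right sum.neutral_const)
    then show ?thesis unfolding Im_const_eq[symmetric] by simp
  qed
  finally show ?thesis
    by (cases "m = int (r + ell i)") (simp_all only: simp_thms if_True if_False mult_zero_right mult.assoc)
qed

lemma hat_gen_in_hat_L:
  "i \<in> {1..n} \<Longrightarrow> j \<in> {1..n} \<Longrightarrow> a \<in> BB i j \<Longrightarrow> hat_gen scale \<tau> \<epsilon> ell i j a r m \<in> hat_L"
  unfolding hat_sub_def by (intro hatV.span_base insertI2) blast

lemma sigma_hat_gen:
  assumes i: "i \<in> {1..n}" and j: "j \<in> {1..n}" and a: "a \<in> BB i j"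
  shows "sigma (hat_gen scale \<tau> \<epsilon> ell i j a r m) v =
    (\<Sum>(p, u)\<in>mode_set i j a (m - int r - 1) v.
       scaleN (ffact (of_int (- u - 1)) r) (\<rho> (gen i j a (half p) (half u)) v)) +
    scaleN (shift_trace \<iota> (mat (fst (hat_gen scale \<tau> \<epsilon> ell i j a r m)))) (\<rho> central v)"
proof -
  let ?x = "hat_gen scale \<tau> \<epsilon> ell i j a r m" and ?M = "mode_set i j a (m - int r - 1) v"
  let ?X = "mat (single (m, r) a)"
  obtain K0 where K0: "\<And>K. K \<ge> K0 \<Longrightarrow> sigma ?x v = \<rho> (approx K ?x) v"
    using sigma_approx[OF hat_gen_in_hat_L[OF i j a]] by blast
  define K where "K = \<bar>K0\<bar> + (\<Sum>z\<in>?M. \<bar>fst z\<bar> + \<bar>snd z\<bar>) + 2"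
  have nonneg: "0 \<le> (\<Sum>z\<in>?M. \<bar>fst z\<bar> + \<bar>snd z\<bar>)" by (intro sum_nonneg) simp
  have box: "p \<in> {-K..<K} \<and> - u - 1 \<in> {-K..<K}" if "(p, u) \<in> ?M" for p u
  proof -
    have "\<bar>fst (p, u)\<bar> + \<bar>snd (p, u)\<bar> \<le> (\<Sum>z\<in>?M. \<bar>fst z\<bar> + \<bar>snd z\<bar>)"
      by (rule member_le_sum[OF that]) (auto intro: finite_mode_set i j a)
    then show ?thesis unfolding K_def by auto
  qed
  have "sigma ?x v = \<rho> (approx K ?x) v"
    by (rule K0) (use nonneg in \<open>simp add: K_def\<close>)
  moreover have "\<rho> (lift_skew (trunc K (?X - (-1) ^ \<epsilon> * star ?X))) v =
      (\<Sum>(p, u)\<in>?M. scaleN (ffact (of_int (- u - 1)) r) (\<rho> (gen i j a (half p) (half u)) v))"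
    by (rule rho_lift_trunc_mono[OF i j a]) (rule box)
  ultimately show ?thesis
    unfolding rho_approx[OF skew_skew_part mat_hat_gen[OF i j a, where m = m and r = r]] snd_hat_gen add_0_right
    by (simp only:)
qed

lemma sum_modes:
  "(\<Sum>(l1, l2)\<in>{(l1, l2). l1 \<in> idx ell \<iota> i \<and> l2 \<in> idx ell \<iota> j \<and>
         - l1 - l2 - 2 * of_int \<iota> - of_nat r - 1 = - of_int m - 1 \<and> \<rho> (gen i j a l1 l2) v \<noteq> 0}.
      scaleN (ffact (of_real (- l2 - of_int \<iota> - 1 / 2)) r) (\<rho> (gen i j a l1 l2) v)) =
   (\<Sum>(p, u)\<in>mode_set i j a (m - int r - 1) v.
       scaleN (ffact (of_int (- u - 1)) r) (\<rho> (gen i j a (half p) (half u)) v))"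
proof -
  have "- l1 - l2 - 2 * of_int \<iota> - of_nat r - 1 = - of_int m - 1 \<longleftrightarrow>
      l1 + l2 = of_int (m - int r - 1) - 2 * of_int \<iota> + 1" for l1 l2 :: real
    by auto
  moreover have "inj_on (\<lambda>(p, u). (half p, half u)) S" for S
    by (auto simp: inj_on_def)
  moreover have "complex_of_real (- half u - of_int \<iota> - 1 / 2) = of_int (- u - 1)" for u
    by (simp add: half_def)
  ultimately show ?thesis
    by (simp only: mode_set_image sum.reindex comp_def split_beta fst_conv snd_conv)
      (simp only: case_prod_unfold)
qed

lemma representation_unique:
  assumes "lie_representation (ext_scale scale) (hat_bracket scale tr) hat_L scaleN \<sigma>"
    and "lie_representation (ext_scale scale) (hat_bracket scale tr) hat_L scaleN \<sigma>'"
    and "\<sigma> \<in> extensional hat_L" "\<sigma>' \<in> extensional hat_L" and "\<sigma> central = \<sigma>' central"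
    and gens: "\<And>i j a r m v. i \<in> {1..n} \<Longrightarrow> j \<in> {1..n} \<Longrightarrow> a \<in> BB i j \<Longrightarrow>
      \<sigma> (hat_gen scale \<tau> \<epsilon> ell i j a r m) v = \<sigma>' (hat_gen scale \<tau> \<epsilon> ell i j a r m) v"
  shows "\<sigma> = \<sigma>'"
proof (rule extensionalityI[OF assms(3,4)])
  have lin: "s (x + y) v = s x v + s y v" "s (ext_scale scale c x) v = scaleN c (s x v)"
    if "lie_representation (ext_scale scale) (hat_bracket scale tr) hat_L scaleN s" "x \<in> hat_L" "y \<in> hat_L"
    for s x y c v
    using that unfolding lie_representation_def by blast+
  have zero: "s 0 v = 0"
    if "lie_representation (ext_scale scale) (hat_bracket scale tr) hat_L scaleN s" for s v
    using lin(1)[OF that, of 0 0 v] hatV.subspace_0[OF hat_L_subspace] by simp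
  let ?S = "{x \<in> hat_L. \<sigma> x = \<sigma>' x}"
  have "hatV.subspace ?S"
  proof (rule hatV.subspaceI)
    show "0 \<in> ?S"
      using zero[OF assms(1)] zero[OF assms(2)] hatV.subspace_0[OF hat_L_subspace] by (auto simp: fun_eq_iff)
    show "x + y \<in> ?S" if "x \<in> ?S" "y \<in> ?S" for x y
      using that lin(1)[OF assms(1)] lin(1)[OF assms(2)] hatV.subspace_add[OF hat_L_subspace] by (auto simp: fun_eq_iff)
    show "ext_scale scale c x \<in> ?S" if "x \<in> ?S" for c x
      using that lin(2)[OF assms(1), of x x] lin(2)[OF assms(2), of x x] hatV.subspace_scale[OF hat_L_subspace]
      by (auto simp: fun_eq_iff)
  qed
  moreover have "insert central {hat_gen scale \<tau> \<epsilon> ell i j a r m | i j a r m. i \<in> {1..n} \<and> j \<in> {1..n} \<and> a \<in> BB i j} \<subseteq> ?S"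
    using assms(5) gens central_in_hat_L hat_gen_in_hat_L by (auto simp: fun_eq_iff)
  ultimately have "hat_L \<subseteq> ?S"
    unfolding hat_sub_def[of scale \<tau> n BB \<epsilon> ell] by (intro hatV.span_minimal)
  then show "\<sigma> x = \<sigma>' x" if "x \<in> hat_L" for x using that by blast
qed

end

theorem theorem2p5:
  fixes scale :: "complex \<Rightarrow> 'a::ring_1 \<Rightarrow> 'a"
    and tr :: "'a \<Rightarrow> complex"
    and \<tau> :: "'a \<Rightarrow> 'a"
    and n :: nat
    and B :: "nat \<Rightarrow> 'a set"
    and BB :: "nat \<Rightarrow> nat \<Rightarrow> 'a set"
    and \<pi> :: "nat \<Rightarrow> nat"
    and \<epsilon> :: nat
    and ell :: "nat \<Rightarrow> nat"
    and \<iota> :: int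
    and scaleN :: "complex \<Rightarrow> 'v::ab_group_add \<Rightarrow> 'v"
    and \<rho> :: "'a check_alg \<Rightarrow> 'v \<Rightarrow> 'v"
    and N0 :: "'v set"
    and m0 :: nat
  assumes "tau_setting scale tr \<tau> n B BB \<pi> \<epsilon> ell"
    and "vector_space scaleN"
    and "lie_representation (ext_scale scale) (check_bracket tr)
           (check_sub scale \<tau> n BB \<epsilon> ell \<iota>) scaleN \<rho>"
    and "module.subspace scaleN N0"
    and "generates_module (check_sub scale \<tau> n BB \<epsilon> ell \<iota>) scaleN \<rho> N0"
    and "int m0 > ell_tilde n ell \<iota>"
    and "\<forall>x\<in>check_sub_above scale \<tau> n BB \<epsilon> ell \<iota> m0. \<forall>v\<in>N0. \<rho> x v = 0"
  shows
    "lie_subalgebra (ext_scale scale) (hat_bracket scale tr) (hat_sub scale \<tau> n BB \<epsilon> ell) \<and>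
     (\<forall>i\<in>{1..n}. \<forall>j\<in>{1..n}. \<forall>a\<in>BB i j. \<forall>(d::real) v.
        finite {(l1, l2). l1 \<in> idx ell \<iota> i \<and> l2 \<in> idx ell \<iota> j \<and> l1 + l2 = d \<and>
                  \<rho> (check_gen scale \<tau> \<epsilon> ell \<iota> i j a l1 l2) v \<noteq> 0}) \<and>
     (\<exists>!\<sigma>.
        \<sigma> \<in> extensional (hat_sub scale \<tau> n BB \<epsilon> ell) \<and>
        lie_representation (ext_scale scale) (hat_bracket scale tr)
          (hat_sub scale \<tau> n BB \<epsilon> ell) scaleN \<sigma> \<and>
        \<sigma> central = \<rho> central \<and>
        (\<forall>i\<in>{1..n}. \<forall>j\<in>{1..n}. \<forall>a\<in>BB i j. \<forall>(r::nat) (m::int) v.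
           \<sigma> (hat_gen scale \<tau> \<epsilon> ell i j a r m) v =
             (\<Sum>(l1, l2)\<in>{(l1, l2). l1 \<in> idx ell \<iota> i \<and> l2 \<in> idx ell \<iota> j \<and>
                   - l1 - l2 - 2 * of_int \<iota> - of_nat r - 1 = - of_int m - 1 \<and>
                   \<rho> (check_gen scale \<tau> \<epsilon> ell \<iota> i j a l1 l2) v \<noteq> 0}.
                scaleN (ffact (of_real (- l2 - of_int \<iota> - 1 / 2)) r)
                  (\<rho> (check_gen scale \<tau> \<epsilon> ell \<iota> i j a l1 l2) v))
             + (if - m - 1 = - int r - int (ell j) - 1
                then scaleN (fact (r + ell j) * Im_const \<iota> 0 (r + ell j) * tr a) (\<rho> central v)
                else 0)
             - (if - m - 1 = - int r - int (ell i) - 1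
                then scaleN ((-1) ^ \<epsilon> * fact r * fact (ell i) * Im_const \<iota> r (ell i) * tr a) (\<rho> central v)
                else 0)))"
proof -
  interpret smooth_module scale tr \<tau> n B BB \<pi> \<epsilon> ell \<iota> scaleN \<rho> N0 m0
    using assms by (intro smooth_module.intro check_setting.intro smooth_module_axioms.intro)
  let ?formula = "\<lambda>\<sigma>. \<forall>i\<in>{1..n}. \<forall>j\<in>{1..n}. \<forall>a\<in>BB i j. \<forall>(r::nat) (m::int) v.
           \<sigma> (hat_gen scale \<tau> \<epsilon> ell i j a r m) v =
             (\<Sum>(l1, l2)\<in>{(l1, l2). l1 \<in> idx ell \<iota> i \<and> l2 \<in> idx ell \<iota> j \<and>
                   - l1 - l2 - 2 * of_int \<iota> - of_nat r - 1 = - of_int m - 1 \<and>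
                   \<rho> (check_gen scale \<tau> \<epsilon> ell \<iota> i j a l1 l2) v \<noteq> 0}.
                scaleN (ffact (of_real (- l2 - of_int \<iota> - 1 / 2)) r)
                  (\<rho> (check_gen scale \<tau> \<epsilon> ell \<iota> i j a l1 l2) v))
             + (if - m - 1 = - int r - int (ell j) - 1
                then scaleN (fact (r + ell j) * Im_const \<iota> 0 (r + ell j) * tr a) (\<rho> central v)
                else 0)
             - (if - m - 1 = - int r - int (ell i) - 1
                then scaleN ((-1) ^ \<epsilon> * fact r * fact (ell i) * Im_const \<iota> r (ell i) * tr a) (\<rho> central v)
                else 0)"
  have formula: "?formula sigma"
  proof (intro ballI allI, goal_cases)
    case (1 i j a r m v)
    have m: "- m - 1 = - int r - int l - 1 \<longleftrightarrow> m = int (r + l)" for l by auto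
    show ?case
      unfolding sigma_hat_gen[OF 1] sum_modes shift_trace_hat_gen m
      by (simp add: N.scale_left_diff_distrib)
  qed
  have "\<exists>!\<sigma>. \<sigma> \<in> extensional hat_L \<and>
      lie_representation (ext_scale scale) (hat_bracket scale tr) hat_L scaleN \<sigma> \<and>
      \<sigma> central = \<rho> central \<and> ?formula \<sigma>"
  proof (rule ex1I[of _ sigma])
    show "sigma \<in> extensional hat_L \<and>
      lie_representation (ext_scale scale) (hat_bracket scale tr) hat_L scaleN sigma \<and>
      sigma central = \<rho> central \<and> ?formula sigma"
      using formula sigma_representation sigma_central by (simp add: sigma_def)
    fix \<sigma>
    assume \<sigma>: "\<sigma> \<in> extensional hat_L \<and>
      lie_representation (ext_scale scale) (hat_bracket scale tr) hat_L scaleN \<sigma> \<and>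
      \<sigma> central = \<rho> central \<and> ?formula \<sigma>"
    show "\<sigma> = sigma"
    proof (rule representation_unique)
      show "\<sigma> central = sigma central" using \<sigma> sigma_central by simp
      show "sigma \<in> extensional hat_L" by (simp add: sigma_def)
      fix i j a r m v assume "i \<in> {1..n}" "j \<in> {1..n}" "a \<in> BB i j"
      then show "\<sigma> (hat_gen scale \<tau> \<epsilon> ell i j a r m) v = sigma (hat_gen scale \<tau> \<epsilon> ell i j a r m) v"
        using \<sigma> formula by simp
    qed (use \<sigma> sigma_representation in blast)+
  qed
  then show ?thesis
    using lie_subalgebra_hat finite_modes by blast
qed

end
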